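(* Let $B$ be a Banach space and let $\mathbb X$ be a continuous $(\mathcal F_t)$-adapted $B$-valued process which is semilocally summable with respect to the bilinear maps (tensor products) $B\times B\to B\hat\otimes_\pi B$ given by $(a,b)\mapsto a\otimes b$ and $(a,b)\mapsto b\otimes a$. Then $\mathbb X$ admits a tensor quadratic variation.
   Context: Fix $T>0$ and a probability space $(\Omega,\mathcal F,\mathbb P)$ with a filtration $(\mathcal F_t)_{t\in[0,T]}$ satisfying the usual conditions. Processes on $[0,T]$ are extended by $\mathbb X_t=\mathbb X_0$ for $t\le0$ and $\mathbb X_t=\mathbb X_T$ for $t\ge T$. $B\hat\otimes_\pi B$ is the projective tensor product. Tensor quadratic variation: $\mathbb X$ admits a tensor quadratic variation if there is a $B\hat\otimes_\pi B$-valued process $[\mathbb X]^\otimes$ such that the Bochner integrals $\int_0^t\frac{(\mathbb X_{s+\epsilon}-\mathbb X_s)\otimes(\mathbb X_{s+\epsilon}-\mathbb X_s)}{\epsilon}ds$ converge to $[\mathbb X]^\otimes_t$ uniformly in $t\in[0,T]$ in probability (for the norm of $B\hat\otimes_\pi B$) as $\epsilon\downarrow0$. Summability (Dinculeanu): let $b:E\times F\to G$ be a bounded bilinear map between Banach spaces (here $E=F=B$, $G=B\hat\otimes_\pi B$). A càdlàg adapted $E$-valued process $\mathbb X$ with $\mathbb X_t\in L^1(\Omega;E)$ for all $t$ is summable with respect to $b$ if the finitely additive $L^1(\Omega;E)$-valued measure $I_{\mathbb X}$ on the ring generated by the predictable rectangles, determined by $I_{\mathbb X}(A\times\{0\})=\mathbf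 1_A\mathbb X_0$ ($A\in\mathcal F_0$) and $I_{\mathbb X}(A\times]s,t])=\mathbf 1_A(\mathbb X_t-\mathbb X_s)$ ($A\in\mathcal F_s$), extends to a $\sigma$-additive $L^1(\Omega;E)$-valued measure on the predictable $\sigma$-field, with finite semivariation $\sup\|\sum_ib(I_{\mathbb X}(A_i),y_i)\|_{L^1(\Omega;G)}<\infty$, the supremum being over finite families of disjoint predictable sets $A_i$ and $y_i\in F$ with $\|y_i\|\le1$. It is locally summable if there are stopping times $T_n\uparrow\infty$ such that every stopped process $\mathbb X^{T_n}$ is summable. It is semilocally summable if it is the sum of a locally summable process and an adapted process with paths of bounded variation. *)

theory Defs
  imports "HOL-Probability.Probability"
begin

section \<open>The projective tensor product\<close>

text \<open>
  The algebraic tensor product is the quotient of formal sums by the bilinearity relations; the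
  projective tensor product is its completion, by Cauchy sequences, for the projective norm.
\<close>

subsection \<open>Algebraic tensor product\<close>

text \<open>
  A list of pairs stands for the formal sum of the corresponding elementary tensors. Scalars need
  not be recorded separately, because they can be moved into the first component.
\<close>

inductive tensor_eq ::
  "('a::real_vector \<times> 'b::real_vector) list \<Rightarrow> ('a \<times> 'b) list \<Rightarrow> bool" where
  refl: "tensor_eq u u"
| sym: "tensor_eq u v \<Longrightarrow> tensor_eq v u"
| trans: "tensor_eq u v \<Longrightarrow> tensor_eq v w \<Longrightarrow> tensor_eq u w"
| comm: "tensor_eq (u @ v) (v @ u)"
| append: "tensor_eq u u' \<Longrightarrow> tensor_eq v v' \<Longrightarrow> tensor_eq (u @ v) (u' @ v')"
| add_left: "tensor_eq [(a + a', b)] [(a, b), (a', b)]"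
| add_right: "tensor_eq [(a, b + b')] [(a, b), (a, b')]"
| scale: "tensor_eq [(r *\<^sub>R a, b)] [(a, r *\<^sub>R b)]"
| zero: "tensor_eq [(0, b)] []"

lemma equivp_tensor_eq: "equivp tensor_eq"
  by (intro equivpI reflpI sympI transpI)
     (rule tensor_eq.refl, erule tensor_eq.sym, erule (1) tensor_eq.trans)

definition tensor_scale ::
  "real \<Rightarrow> ('a::real_vector \<times> 'b::real_vector) list \<Rightarrow> ('a \<times> 'b) list" where
  "tensor_scale r = map (\<lambda>(a, b). (r *\<^sub>R a, b))"

lemma tensor_scale_simps [simp]:
  "tensor_scale r [] = []"
  "tensor_scale r ((a, b) # u) = (r *\<^sub>R a, b) # tensor_scale r u"
  "tensor_scale r (u @ v) = tensor_scale r u @ tensor_scale r v"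
  by (simp_all add: tensor_scale_def)

lemma tensor_eq_Cons: "tensor_eq [x] w \<Longrightarrow> tensor_eq u v \<Longrightarrow> tensor_eq (x # u) (w @ v)"
  using tensor_eq.append[of "[x]" w u v] by simp

lemma tensor_eq_scale: "tensor_eq u v \<Longrightarrow> tensor_eq (tensor_scale r u) (tensor_scale r v)"
proof (induction rule: tensor_eq.induct)
  case (add_left a a' b)
  then show ?case by (simp add: scaleR_add_right tensor_eq.add_left)
next
  case (scale s a b)
  have "tensor_eq [(s *\<^sub>R (r *\<^sub>R a), b)] [(r *\<^sub>R a, s *\<^sub>R b)]"
    by (rule tensor_eq.scale)
  then show ?case by (simp add: mult.commute)
next
  case (trans u v w)
  from trans.IH show ?case by (rule tensor_eq.trans)
next
  case (sym u v)
  from sym.IH show ?case by (rule tensor_eq.sym)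
qed (simp_all add: tensor_eq.refl tensor_eq.comm tensor_eq.append tensor_eq.add_right
    tensor_eq.zero)

lemma tensor_eq_scale_add:
  "tensor_eq (tensor_scale (r + s) u) (tensor_scale r u @ tensor_scale s u)"
proof (induction u)
  case Nil
  then show ?case by (simp add: tensor_eq.refl)
next
  case (Cons x u)
  obtain a b where x: "x = (a, b)" by (cases x)
  let ?r = "tensor_scale r u" and ?s = "tensor_scale s u"
  have "tensor_eq (tensor_scale (r + s) (x # u))
      ([(r *\<^sub>R a, b), (s *\<^sub>R a, b)] @ (?r @ ?s))"
    using tensor_eq_Cons[OF tensor_eq.add_left[of "r *\<^sub>R a" "s *\<^sub>R a" b] Cons.IH]
    by (simp add: x scaleR_add_left)
  also have "[(r *\<^sub>R a, b), (s *\<^sub>R a, b)] @ (?r @ ?s)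
      = [(r *\<^sub>R a, b)] @ (([(s *\<^sub>R a, b)] @ ?r) @ ?s)" by simp
  finally have 1: "tensor_eq (tensor_scale (r + s) (x # u)) \<dots>" .
  have "tensor_eq ([(r *\<^sub>R a, b)] @ (([(s *\<^sub>R a, b)] @ ?r) @ ?s))
      ([(r *\<^sub>R a, b)] @ ((?r @ [(s *\<^sub>R a, b)]) @ ?s))"
    by (intro tensor_eq.append tensor_eq.refl tensor_eq.comm)
  then have "tensor_eq (tensor_scale (r + s) (x # u))
      ([(r *\<^sub>R a, b)] @ ((?r @ [(s *\<^sub>R a, b)]) @ ?s))"
    by (rule tensor_eq.trans[OF 1])
  then show ?case by (simp add: x)
qed

lemma tensor_eq_scale_0: "tensor_eq (tensor_scale 0 u) []"
proof (induction u)
  case (Cons x u)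
  then show ?case
    using tensor_eq_Cons[OF tensor_eq.zero[of "snd x"] Cons.IH] by (cases x) simp
qed (simp add: tensor_eq.refl)

lemma tensor_scale_1: "tensor_scale 1 u = u"
  by (induction u) auto

lemma tensor_scale_scale: "tensor_scale r (tensor_scale s u) = tensor_scale (r * s) u"
  by (induction u) auto

quotient_type (overloaded) ('a, 'b) tensor = "('a::real_vector \<times> 'b::real_vector) list" / tensor_eq
  by (rule equivp_tensor_eq)

instantiation tensor :: (real_vector, real_vector) real_vector
begin

lift_definition zero_tensor :: "('a, 'b) tensor" is "[]" .
lift_definition plus_tensor :: "('a, 'b) tensor \<Rightarrow> ('a, 'b) tensor \<Rightarrow> ('a, 'b) tensor"
  is "(@)" by (rule tensor_eq.append)
lift_definition scaleR_tensor :: "real \<Rightarrow> ('a, 'b) tensor \<Rightarrow> ('a, 'b) tensor"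
  is tensor_scale by (rule tensor_eq_scale)
definition uminus_tensor :: "('a, 'b) tensor \<Rightarrow> ('a, 'b) tensor"
  where "uminus_tensor x = (-1) *\<^sub>R x"
definition minus_tensor :: "('a, 'b) tensor \<Rightarrow> ('a, 'b) tensor \<Rightarrow> ('a, 'b) tensor"
  where "minus_tensor x y = x + (-1) *\<^sub>R y"

instance
proof
  fix x y z :: "('a, 'b) tensor" and r s :: real
  show "x + y + z = x + (y + z)" by transfer (simp add: tensor_eq.refl)
  show "x + y = y + x" by transfer (rule tensor_eq.comm)
  show "0 + x = x" by transfer (simp add: tensor_eq.refl)
  have add: "(r + s) *\<^sub>R x = r *\<^sub>R x + s *\<^sub>R x" for r s
    by transfer (rule tensor_eq_scale_add)
  have one: "1 *\<^sub>R x = x" by transfer (simp add: tensor_scale_1 tensor_eq.refl)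
  have zero: "0 *\<^sub>R x = 0" by transfer (rule tensor_eq_scale_0)
  show "- x + x = 0"
    using add[of "-1" 1] by (simp add: uminus_tensor_def one zero)
  show "x - y = x + - y" by (simp add: uminus_tensor_def minus_tensor_def)
  show "r *\<^sub>R (x + y) = r *\<^sub>R x + r *\<^sub>R y" by transfer (simp add: tensor_eq.refl)
  show "(r + s) *\<^sub>R x = r *\<^sub>R x + s *\<^sub>R x" by (rule add)
  show "r *\<^sub>R s *\<^sub>R x = (r * s) *\<^sub>R x"
    by transfer (simp add: tensor_scale_scale tensor_eq.refl)
  show "1 *\<^sub>R x = x" by (rule one)
qed

end

lift_definition elem_tensor :: "'a::real_vector \<Rightarrow> 'b::real_vector \<Rightarrow> ('a, 'b) tensor"
  is "\<lambda>a b. [(a, b)]" .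

abbreviation tensor_sum :: "('a::real_vector \<times> 'b::real_vector) list \<Rightarrow> ('a, 'b) tensor" where
  "tensor_sum u \<equiv> (\<Sum>(a, b)\<leftarrow>u. elem_tensor a b)"

lemma tensor_sum_eq_abs: "tensor_sum u = abs_tensor u"
proof (induction u)
  case Nil
  then show ?case by (simp add: zero_tensor_def)
next
  case (Cons x u)
  then show ?case
    by (cases x) (simp add: elem_tensor.abs_eq plus_tensor.abs_eq)
qed

lemma tensor_sum_exists: "\<exists>u. z = tensor_sum u"
  unfolding tensor_sum_eq_abs
  by (rule exI[of _ "rep_tensor z"]) (simp add: Quotient3_abs_rep[OF Quotient3_tensor])

lemma elem_tensor_add_left: "elem_tensor (a + a') b = elem_tensor a b + elem_tensor a' b"
  unfolding elem_tensor.abs_eq plus_tensor.abs_eq tensor.abs_eq_iff append_Cons append_Nil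
  by (rule tensor_eq.add_left)

lemma elem_tensor_add_right: "elem_tensor a (b + b') = elem_tensor a b + elem_tensor a b'"
  unfolding elem_tensor.abs_eq plus_tensor.abs_eq tensor.abs_eq_iff append_Cons append_Nil
  by (rule tensor_eq.add_right)

lemma elem_tensor_scaleR_left: "elem_tensor (r *\<^sub>R a) b = r *\<^sub>R elem_tensor a b"
  unfolding elem_tensor.abs_eq scaleR_tensor.abs_eq tensor.abs_eq_iff tensor_scale_simps
  by (rule tensor_eq.refl)

lemma elem_tensor_scaleR_right: "elem_tensor a (r *\<^sub>R b) = r *\<^sub>R elem_tensor a b"
  unfolding elem_tensor.abs_eq scaleR_tensor.abs_eq tensor.abs_eq_iff tensor_scale_simps
  by (rule tensor_eq.sym[OF tensor_eq.scale])

lemmas elem_tensor_bilinear =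
  elem_tensor_add_left elem_tensor_add_right elem_tensor_scaleR_left elem_tensor_scaleR_right

subsection \<open>Projective norm\<close>

definition proj_norm :: "('a::real_normed_vector, 'b::real_normed_vector) tensor \<Rightarrow> real" where
  "proj_norm z = (INF u \<in> {u. z = tensor_sum u}. \<Sum>(a, b)\<leftarrow>u. norm a * norm b)"

abbreviation tensor_cost :: "('a::real_normed_vector \<times> 'b::real_normed_vector) list \<Rightarrow> real" where
  "tensor_cost u \<equiv> (\<Sum>(a, b)\<leftarrow>u. norm a * norm b)"

lemma tensor_cost_nonneg: "0 \<le> tensor_cost u"
  by (intro sum_list_nonneg) auto

lemma proj_norm_nonneg: "0 \<le> proj_norm z"
  unfolding proj_norm_def using tensor_sum_exists[of z]
  by (intro cINF_greatest) (auto intro: tensor_cost_nonneg)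

lemma proj_norm_le: "z = tensor_sum u \<Longrightarrow> proj_norm z \<le> tensor_cost u"
  unfolding proj_norm_def
  by (rule cINF_lower) (auto intro!: bdd_belowI2[where m=0] tensor_cost_nonneg)

lemma proj_norm_approx:
  assumes "0 < e"
  obtains u where "z = tensor_sum u" "tensor_cost u < proj_norm z + e"
proof -
  have "\<exists>u\<in>{u. z = tensor_sum u}. tensor_cost u < proj_norm z + e"
    using assms tensor_sum_exists[of z] unfolding proj_norm_def
    by (subst cINF_less_iff[symmetric])
       (auto intro!: bdd_belowI2[where m=0] tensor_cost_nonneg)
  then show ?thesis using that by blast
qed

lemma proj_norm_elem: "proj_norm (elem_tensor a b) \<le> norm a * norm b"
  using proj_norm_le[of "elem_tensor a b" "[(a, b)]"] by simp

lemma proj_norm_zero [simp]: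
  "proj_norm (0 :: ('a::real_normed_vector, 'b::real_normed_vector) tensor) = 0"
  using proj_norm_le[of "0 :: ('a, 'b) tensor" "[]"] proj_norm_nonneg[of "0 :: ('a, 'b) tensor"]
  by simp

lemma proj_norm_triangle: "proj_norm (x + y) \<le> proj_norm x + proj_norm y"
proof (rule field_le_epsilon)
  fix e :: real assume "0 < e"
  then have e: "0 < e / 2" by simp
  obtain u where u: "x = tensor_sum u" "tensor_cost u < proj_norm x + e / 2"
    using proj_norm_approx[OF e] .
  obtain v where v: "y = tensor_sum v" "tensor_cost v < proj_norm y + e / 2"
    using proj_norm_approx[OF e] .
  have "proj_norm (x + y) \<le> tensor_cost (u @ v)"
    by (rule proj_norm_le) (simp add: u v)
  with u v show "proj_norm (x + y) \<le> proj_norm x + proj_norm y + e" by simp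
qed

lemma proj_norm_scale_le: "proj_norm (r *\<^sub>R x) \<le> \<bar>r\<bar> * proj_norm x"
proof (cases "r = 0")
  case False
  show ?thesis
  proof (rule field_le_epsilon)
    fix e :: real assume "0 < e"
    then have e: "0 < e / \<bar>r\<bar>" using False by simp
    obtain u where u: "x = tensor_sum u" "tensor_cost u < proj_norm x + e / \<bar>r\<bar>"
      using proj_norm_approx[OF e] .
    have sum: "r *\<^sub>R tensor_sum u = tensor_sum (tensor_scale r u)"
      by (induction u) (auto simp: scaleR_add_right elem_tensor_bilinear)
    have cost: "tensor_cost (tensor_scale r u) = \<bar>r\<bar> * tensor_cost u"
      by (induction u) (auto simp: algebra_simps)
    have "proj_norm (r *\<^sub>R x) \<le> \<bar>r\<bar> * tensor_cost u"
      using proj_norm_le[of "r *\<^sub>R x" "tensor_scale r u"] u sum cost by simp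
    also have "\<dots> \<le> \<bar>r\<bar> * (proj_norm x + e / \<bar>r\<bar>)"
      using u by (intro mult_left_mono) auto
    finally show "proj_norm (r *\<^sub>R x) \<le> \<bar>r\<bar> * proj_norm x + e"
      using False by (simp add: algebra_simps)
  qed
qed simp

lemma proj_norm_scale: "proj_norm (r *\<^sub>R x) = \<bar>r\<bar> * proj_norm x"
proof (cases "r = 0")
  case False
  have "proj_norm x = proj_norm (inverse r *\<^sub>R (r *\<^sub>R x))" using False by simp
  also have "\<dots> \<le> \<bar>inverse r\<bar> * proj_norm (r *\<^sub>R x)" by (rule proj_norm_scale_le)
  finally have "\<bar>r\<bar> * proj_norm x \<le> proj_norm (r *\<^sub>R x)"
    using False by (simp add: field_simps abs_inverse)
  with proj_norm_scale_le[of r x] show ?thesis by simp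
qed simp

lemma proj_norm_minus_commute: "proj_norm (x - y) = proj_norm (y - x)"
  using proj_norm_scale[of "-1" "x - y"] by simp

lemma proj_norm_triangle_diff: "proj_norm (x - z) \<le> proj_norm (x - y) + proj_norm (y - z)"
  using proj_norm_triangle[of "x - y" "y - z"] by simp

lemma proj_norm_abs_diff: "\<bar>proj_norm x - proj_norm y\<bar> \<le> proj_norm (x - y)"
  using proj_norm_triangle[of "x - y" y] proj_norm_triangle[of "y - x" x]
  by (simp add: proj_norm_minus_commute[of y x])

lemma proj_norm_add_diff:
  "proj_norm ((x + y) - (x' + y')) \<le> proj_norm (x - x') + proj_norm (y - y')"
  using proj_norm_triangle[of "x - x'" "y - y'"] by (simp add: algebra_simps)

subsection \<open>Completion\<close>

text \<open>
  Only the seminorm properties of the projective norm are needed here: Cauchy sequences are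
  identified when their difference tends to zero.
\<close>

definition proj_Cauchy ::
  "(nat \<Rightarrow> ('a::real_normed_vector, 'b::real_normed_vector) tensor) \<Rightarrow> bool" where
  "proj_Cauchy x \<longleftrightarrow> (\<forall>e>0. \<exists>N. \<forall>m\<ge>N. \<forall>n\<ge>N. proj_norm (x m - x n) < e)"

definition proj_rel ::
  "(nat \<Rightarrow> ('a::real_normed_vector, 'b::real_normed_vector) tensor)
    \<Rightarrow> (nat \<Rightarrow> ('a, 'b) tensor) \<Rightarrow> bool" where
  "proj_rel x y \<longleftrightarrow> proj_Cauchy x \<and> proj_Cauchy y \<and> (\<lambda>n. proj_norm (x n - y n)) \<longlonglongrightarrow> 0"

lemma proj_Cauchy_const: "proj_Cauchy (\<lambda>n. z)"
  by (simp add: proj_Cauchy_def)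

lemma proj_Cauchy_add:
  assumes "proj_Cauchy x" "proj_Cauchy y" shows "proj_Cauchy (\<lambda>n. x n + y n)"
  unfolding proj_Cauchy_def
proof (intro allI impI)
  fix e :: real assume "0 < e"
  then have e: "0 < e / 2" by simp
  obtain N1 where N1: "\<forall>m\<ge>N1. \<forall>n\<ge>N1. proj_norm (x m - x n) < e / 2"
    using assms(1) e unfolding proj_Cauchy_def by blast
  obtain N2 where N2: "\<forall>m\<ge>N2. \<forall>n\<ge>N2. proj_norm (y m - y n) < e / 2"
    using assms(2) e unfolding proj_Cauchy_def by blast
  have "proj_norm (x m + y m - (x n + y n)) < e" if "m \<ge> max N1 N2" "n \<ge> max N1 N2" for m n
    using N1[rule_format, of m n] N2[rule_format, of m n] that
      proj_norm_add_diff[of "x m" "y m" "x n" "y n"] by simp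
  then show "\<exists>N. \<forall>m\<ge>N. \<forall>n\<ge>N. proj_norm (x m + y m - (x n + y n)) < e" by blast
qed

lemma proj_Cauchy_scale:
  assumes "proj_Cauchy x" shows "proj_Cauchy (\<lambda>n. r *\<^sub>R x n)"
  unfolding proj_Cauchy_def
proof (intro allI impI)
  fix e :: real assume "0 < e"
  then have e: "0 < e / (\<bar>r\<bar> + 1)" by simp
  obtain N where N: "\<forall>m\<ge>N. \<forall>n\<ge>N. proj_norm (x m - x n) < e / (\<bar>r\<bar> + 1)"
    using assms e unfolding proj_Cauchy_def by blast
  have "proj_norm (r *\<^sub>R x m - r *\<^sub>R x n) < e" if "m \<ge> N" "n \<ge> N" for m n
  proof -
    have "proj_norm (r *\<^sub>R x m - r *\<^sub>R x n) = \<bar>r\<bar> * proj_norm (x m - x n)"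
      by (metis proj_norm_scale scaleR_diff_right)
    also have "\<dots> \<le> (\<bar>r\<bar> + 1) * proj_norm (x m - x n)"
      by (intro mult_right_mono proj_norm_nonneg) simp
    also have "\<dots> < e"
      using N[rule_format, OF that] by (simp add: pos_less_divide_eq mult.commute)
    finally show ?thesis .
  qed
  then show "\<exists>N. \<forall>m\<ge>N. \<forall>n\<ge>N. proj_norm (r *\<^sub>R x m - r *\<^sub>R x n) < e" by blast
qed

lemma proj_Cauchy_norm_convergent:
  assumes "proj_Cauchy x" shows "convergent (\<lambda>n. proj_norm (x n))"
proof (rule Cauchy_convergent, rule metric_CauchyI)
  fix e :: real assume "0 < e"
  then obtain N where N: "\<forall>m\<ge>N. \<forall>n\<ge>N. proj_norm (x m - x n) < e"
    using assms unfolding proj_Cauchy_def by blast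
  have "dist (proj_norm (x m)) (proj_norm (x n)) < e" if "m \<ge> N" "n \<ge> N" for m n
    using N[rule_format, OF that] proj_norm_abs_diff[of "x m" "x n"] by (simp add: dist_real_def)
  then show "\<exists>N. \<forall>m\<ge>N. \<forall>n\<ge>N. dist (proj_norm (x m)) (proj_norm (x n)) < e" by blast
qed

lemma proj_null_le:
  assumes "(\<lambda>n. f n) \<longlonglongrightarrow> (0::real)" "\<And>n. proj_norm (x n) \<le> f n"
  shows "(\<lambda>n. proj_norm (x n)) \<longlonglongrightarrow> 0"
  by (rule tendsto_sandwich[OF _ _ tendsto_const assms(1)])
     (auto intro!: always_eventually simp: assms(2) proj_norm_nonneg)

lemma proj_rel_refl: "proj_Cauchy x \<Longrightarrow> proj_rel x x"
  by (simp add: proj_rel_def)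

lemma part_equivp_proj_rel:
  "part_equivp (proj_rel ::
    (nat \<Rightarrow> ('a::real_normed_vector, 'b::real_normed_vector) tensor) \<Rightarrow> _)" (is "part_equivp ?R")
proof (rule part_equivpI)
  show "\<exists>x. ?R x x"
    by (intro exI[of _ "\<lambda>n. 0"] proj_rel_refl proj_Cauchy_const)
  show "symp ?R"
    by (rule sympI) (simp add: proj_rel_def proj_norm_minus_commute)
  show "transp ?R"
  proof (rule transpI)
    fix x y z :: "nat \<Rightarrow> ('a, 'b) tensor"
    assume xy: "proj_rel x y" and yz: "proj_rel y z"
    have "(\<lambda>n. proj_norm (x n - z n)) \<longlonglongrightarrow> 0"
      by (rule proj_null_le[where f="\<lambda>n. proj_norm (x n - y n) + proj_norm (y n - z n)"])
         (use xy yz in \<open>auto simp: proj_rel_def proj_norm_triangle_diff intro: tendsto_add_zero\<close>)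
    with xy yz show "proj_rel x z" by (simp add: proj_rel_def)
  qed
qed

quotient_type (overloaded) ('a, 'b) proj_tensor =
  "nat \<Rightarrow> ('a::real_normed_vector, 'b::real_normed_vector) tensor" / partial: proj_rel
  by (rule part_equivp_proj_rel)

instantiation proj_tensor :: (real_normed_vector, real_normed_vector) real_normed_vector
begin

lift_definition zero_proj_tensor :: "('a, 'b) proj_tensor" is "\<lambda>n. 0"
  by (intro proj_rel_refl proj_Cauchy_const)
lift_definition plus_proj_tensor ::
  "('a, 'b) proj_tensor \<Rightarrow> ('a, 'b) proj_tensor \<Rightarrow> ('a, 'b) proj_tensor"
  is "\<lambda>x y n. x n + y n"
proof -
  fix x x' y y' :: "nat \<Rightarrow> ('a, 'b) tensor"
  assume x: "proj_rel x x'" and y: "proj_rel y y'"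
  have "(\<lambda>n. proj_norm ((x n + y n) - (x' n + y' n))) \<longlonglongrightarrow> 0"
    by (rule proj_null_le[where f="\<lambda>n. proj_norm (x n - x' n) + proj_norm (y n - y' n)"])
       (use x y in \<open>auto simp only: proj_rel_def proj_norm_add_diff intro: tendsto_add_zero\<close>)
  with x y show "proj_rel (\<lambda>n. x n + y n) (\<lambda>n. x' n + y' n)"
    by (simp add: proj_rel_def proj_Cauchy_add)
qed
lift_definition scaleR_proj_tensor :: "real \<Rightarrow> ('a, 'b) proj_tensor \<Rightarrow> ('a, 'b) proj_tensor"
  is "\<lambda>r x n. r *\<^sub>R x n"
proof -
  fix r and x x' :: "nat \<Rightarrow> ('a, 'b) tensor"
  assume x: "proj_rel x x'"
  have "(\<lambda>n. proj_norm (r *\<^sub>R x n - r *\<^sub>R x' n)) \<longlonglongrightarrow> 0"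
    using x tendsto_mult_right_zero[of "\<lambda>n. proj_norm (x n - x' n)" sequentially "\<bar>r\<bar>"]
    by (simp add: proj_rel_def proj_norm_scale flip: scaleR_diff_right)
  with x show "proj_rel (\<lambda>n. r *\<^sub>R x n) (\<lambda>n. r *\<^sub>R x' n)"
    by (simp add: proj_rel_def proj_Cauchy_scale)
qed
definition uminus_proj_tensor :: "('a, 'b) proj_tensor \<Rightarrow> ('a, 'b) proj_tensor"
  where "uminus_proj_tensor x = (-1) *\<^sub>R x"
definition minus_proj_tensor ::
  "('a, 'b) proj_tensor \<Rightarrow> ('a, 'b) proj_tensor \<Rightarrow> ('a, 'b) proj_tensor"
  where "minus_proj_tensor x y = x + (-1) *\<^sub>R y"
lift_definition norm_proj_tensor :: "('a, 'b) proj_tensor \<Rightarrow> real"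
  is "\<lambda>x. lim (\<lambda>n. proj_norm (x n))"
proof -
  fix x y :: "nat \<Rightarrow> ('a, 'b) tensor" assume xy: "proj_rel x y"
  have "(\<lambda>n. proj_norm (x n) - proj_norm (y n)) \<longlonglongrightarrow> 0"
    by (rule Lim_null_comparison[of _ "\<lambda>n. proj_norm (x n - y n)"])
       (use xy in \<open>auto simp: proj_rel_def proj_norm_abs_diff\<close>)
  moreover have "(\<lambda>n. proj_norm (y n)) \<longlonglongrightarrow> lim (\<lambda>n. proj_norm (y n))"
    using xy by (simp add: proj_rel_def proj_Cauchy_norm_convergent flip: convergent_LIMSEQ_iff)
  ultimately have "(\<lambda>n. proj_norm (x n)) \<longlonglongrightarrow> lim (\<lambda>n. proj_norm (y n))"
    by (rule Lim_transform[rotated])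
  then show "lim (\<lambda>n. proj_norm (x n)) = lim (\<lambda>n. proj_norm (y n))" by (rule limI)
qed
definition sgn_proj_tensor :: "('a, 'b) proj_tensor \<Rightarrow> ('a, 'b) proj_tensor"
  where "sgn_proj_tensor x = inverse (norm x) *\<^sub>R x"
definition dist_proj_tensor :: "('a, 'b) proj_tensor \<Rightarrow> ('a, 'b) proj_tensor \<Rightarrow> real"
  where "dist_proj_tensor x y = norm (x - y)"
definition uniformity_proj_tensor ::
  "(('a, 'b) proj_tensor \<times> ('a, 'b) proj_tensor) filter"
  where "uniformity_proj_tensor = (INF e\<in>{0<..}. principal {(x, y). dist x y < e})"
definition open_proj_tensor :: "('a, 'b) proj_tensor set \<Rightarrow> bool"
  where "open_proj_tensor U = (\<forall>x\<in>U. eventually (\<lambda>(x', y). x' = x \<longrightarrow> y \<in> U) uniformity)"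

instance
proof
  fix x y z :: "('a, 'b) proj_tensor" and r s :: real
  have lim: "proj_Cauchy u \<Longrightarrow> (\<lambda>n. proj_norm (u n)) \<longlonglongrightarrow> lim (\<lambda>n. proj_norm (u n))"
    for u :: "nat \<Rightarrow> ('a, 'b) tensor"
    using proj_Cauchy_norm_convergent convergent_LIMSEQ_iff by blast
  have C: "proj_rel u u \<longleftrightarrow> proj_Cauchy u" for u :: "nat \<Rightarrow> ('a, 'b) tensor"
    by (auto simp: proj_rel_def)
  note closed = proj_Cauchy_add proj_Cauchy_scale proj_rel_refl
  show "x + y + z = x + (y + z)"
    by transfer (simp add: C add.assoc closed)
  show "x + y = y + x"
    by transfer (simp add: C add.commute closed)
  show "0 + x = x" by transfer (simp add: C)
  show "- x + x = 0"
    unfolding uminus_proj_tensor_def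
    by transfer (simp add: C proj_rel_refl proj_Cauchy_const)
  show "x - y = x + - y" by (simp add: uminus_proj_tensor_def minus_proj_tensor_def)
  show "r *\<^sub>R (x + y) = r *\<^sub>R x + r *\<^sub>R y"
    by transfer (simp add: C scaleR_add_right closed)
  show "(r + s) *\<^sub>R x = r *\<^sub>R x + s *\<^sub>R x"
    by transfer (simp add: C scaleR_add_left closed)
  show "r *\<^sub>R s *\<^sub>R x = (r * s) *\<^sub>R x"
    by transfer (simp add: C closed)
  show "1 *\<^sub>R x = x" by transfer simp
  show "sgn x = inverse (norm x) *\<^sub>R x" by (rule sgn_proj_tensor_def)
  show "dist x y = norm (x - y)" by (rule dist_proj_tensor_def)
  show "uniformity = (INF e\<in>{0<..}. principal {(x, y::('a, 'b) proj_tensor). dist x y < e})"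
    by (rule uniformity_proj_tensor_def)
  show "open U = (\<forall>x\<in>U. \<forall>\<^sub>F (x', y) in uniformity. x' = x \<longrightarrow> y \<in> U)"
    for U :: "('a, 'b) proj_tensor set"
    by (rule open_proj_tensor_def)
  show "norm x = 0 \<longleftrightarrow> x = 0"
  proof transfer
    fix u :: "nat \<Rightarrow> ('a, 'b) tensor" assume "proj_rel u u"
    then have u: "proj_Cauchy u" by (simp add: C)
    show "lim (\<lambda>n. proj_norm (u n)) = 0 \<longleftrightarrow> proj_rel u (\<lambda>n. 0)"
      using lim[OF u] u by (auto simp: proj_rel_def proj_Cauchy_const dest: limI)
  qed
  show "norm (x + y) \<le> norm x + norm y"
  proof transfer
    fix u v :: "nat \<Rightarrow> ('a, 'b) tensor" assume "proj_rel u u" "proj_rel v v"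
    then have u: "proj_Cauchy u" and v: "proj_Cauchy v" by (simp_all add: C)
    show "lim (\<lambda>n. proj_norm (u n + v n)) \<le> lim (\<lambda>n. proj_norm (u n)) + lim (\<lambda>n. proj_norm (v n))"
      by (rule LIMSEQ_le[OF lim[OF proj_Cauchy_add[OF u v]] tendsto_add[OF lim[OF u] lim[OF v]]])
         (auto intro: proj_norm_triangle)
  qed
  show "norm (r *\<^sub>R x) = \<bar>r\<bar> * norm x"
  proof transfer
    fix r and u :: "nat \<Rightarrow> ('a, 'b) tensor" assume "proj_rel u u"
    then have u: "proj_Cauchy u" by (simp add: C)
    show "lim (\<lambda>n. proj_norm (r *\<^sub>R u n)) = \<bar>r\<bar> * lim (\<lambda>n. proj_norm (u n))"
      unfolding proj_norm_scale by (rule limI) (intro tendsto_mult tendsto_const lim[OF u])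
  qed
qed

end

definition proj_embed ::
  "('a::real_normed_vector, 'b::real_normed_vector) tensor \<Rightarrow> ('a, 'b) proj_tensor" where
  "proj_embed z = abs_proj_tensor (\<lambda>n. z)"

lemma norm_abs_proj_tensor:
  "proj_Cauchy u \<Longrightarrow> norm (abs_proj_tensor u) = lim (\<lambda>n. proj_norm (u n))"
  by (simp add: norm_proj_tensor.abs_eq proj_rel_refl)

lemma proj_embed_add: "proj_embed x + proj_embed y = proj_embed (x + y)"
  by (simp add: proj_embed_def plus_proj_tensor.abs_eq proj_rel_refl proj_Cauchy_const)

lemma proj_embed_scale: "r *\<^sub>R proj_embed x = proj_embed (r *\<^sub>R x)"
  by (simp add: proj_embed_def scaleR_proj_tensor.abs_eq proj_rel_refl proj_Cauchy_const)

lemma norm_proj_embed: "norm (proj_embed z) = proj_norm z"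
  by (simp add: proj_embed_def norm_abs_proj_tensor proj_Cauchy_const)

lemma proj_embed_minus: "- proj_embed x = proj_embed (- x)"
  using proj_embed_scale[of "-1" x] by simp

lemma proj_embed_diff: "proj_embed x - proj_embed y = proj_embed (x - y)"
  by (simp only: diff_conv_add_uminus proj_embed_minus proj_embed_add)

lemma proj_Cauchy_diff_const: "proj_Cauchy u \<Longrightarrow> proj_Cauchy (\<lambda>m. u m - z)"
  using proj_Cauchy_add[OF _ proj_Cauchy_const[of "- z"], of u] by simp

lemma abs_diff_proj_embed:
  assumes "proj_Cauchy u"
  shows "abs_proj_tensor u - proj_embed z = abs_proj_tensor (\<lambda>m. u m - z)"
proof -
  have "abs_proj_tensor u - proj_embed z = abs_proj_tensor u + proj_embed (- z)"
    by (simp only: diff_conv_add_uminus proj_embed_minus)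
  also have "\<dots> = abs_proj_tensor (\<lambda>m. u m + - z)"
    unfolding proj_embed_def
    by (intro plus_proj_tensor.abs_eq proj_rel_refl assms proj_Cauchy_const)
  finally show ?thesis by simp
qed

lemma norm_abs_diff_proj_embed_le:
  assumes u: "proj_Cauchy u" and N: "\<forall>m\<ge>N. proj_norm (u m - z) < e"
  shows "norm (abs_proj_tensor u - proj_embed z) \<le> e"
proof -
  have "norm (abs_proj_tensor u - proj_embed z) = lim (\<lambda>m. proj_norm (u m - z))"
    by (simp add: abs_diff_proj_embed u norm_abs_proj_tensor proj_Cauchy_diff_const)
  also have "\<dots> \<le> e"
    using N proj_Cauchy_norm_convergent[OF proj_Cauchy_diff_const[OF u, of z]]
    by (intro Lim_bounded[where M=N]) (auto simp: convergent_LIMSEQ_iff less_imp_le)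
  finally show ?thesis .
qed

lemma proj_embed_limit:
  assumes u: "proj_Cauchy u"
  shows "(\<lambda>n. proj_embed (u n)) \<longlonglongrightarrow> abs_proj_tensor u"
proof (rule metric_LIMSEQ_I)
  fix e :: real assume e: "0 < e"
  then obtain N where N: "\<forall>m\<ge>N. \<forall>n\<ge>N. proj_norm (u m - u n) < e / 2"
    using u unfolding proj_Cauchy_def by (meson half_gt_zero)
  have "dist (proj_embed (u n)) (abs_proj_tensor u) < e" if "n \<ge> N" for n
    using norm_abs_diff_proj_embed_le[OF u, of N "u n" "e / 2"] N that e
    by (simp add: dist_norm norm_minus_commute)
  then show "\<exists>N. \<forall>n\<ge>N. dist (proj_embed (u n)) (abs_proj_tensor u) < e" by blast
qed

lemma proj_embed_dense:
  assumes "0 < e" shows "\<exists>z. norm (x - proj_embed z) < e"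
proof -
  obtain u where u: "proj_Cauchy u" "x = abs_proj_tensor u"
    using Quotient_proj_tensor unfolding Quotient_def proj_rel_def by metis
  from assms have "\<forall>\<^sub>F n in sequentially. dist (proj_embed (u n)) x < e"
    using proj_embed_limit[OF u(1)] u(2) by (simp add: tendstoD)
  then obtain n where "dist (proj_embed (u n)) x < e"
    by (auto simp: eventually_sequentially)
  then show ?thesis by (auto simp: dist_norm norm_minus_commute)
qed

instance proj_tensor :: (real_normed_vector, real_normed_vector) banach
proof
  fix X :: "nat \<Rightarrow> ('a, 'b) proj_tensor" assume X: "Cauchy X"
  have "\<forall>n. \<exists>z. norm (X n - proj_embed z) < inverse (real (Suc n))"
    by (auto intro!: proj_embed_dense)
  then obtain u where u: "\<And>n. norm (X n - proj_embed (u n)) < inverse (real (Suc n))"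
    by metis
  have close: "(\<lambda>n. X n - proj_embed (u n)) \<longlonglongrightarrow> 0"
    by (rule Lim_null_comparison[OF _ LIMSEQ_inverse_real_of_nat])
       (intro always_eventually allI less_imp_le u)
  have "Cauchy (\<lambda>n. proj_embed (u n))"
  proof (rule CauchyI)
    fix e :: real assume "0 < e"
    then have e: "0 < e / 3" by simp
    obtain N1 where N1: "\<forall>m\<ge>N1. \<forall>n\<ge>N1. norm (X m - X n) < e / 3"
      using CauchyD[OF X e] by blast
    obtain N2 where N2: "\<forall>n\<ge>N2. norm (X n - proj_embed (u n)) < e / 3"
      using LIMSEQ_D[OF close e] by auto
    have "norm (proj_embed (u m) - proj_embed (u n)) < e"
      if "m \<ge> max N1 N2" "n \<ge> max N1 N2" for m n
    proof -
      have "norm (proj_embed (u m) - proj_embed (u n))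
          = norm ((X m - X n) - (X m - proj_embed (u m)) + (X n - proj_embed (u n)))"
        by simp
      also have "\<dots> \<le> norm (X m - X n) + norm (X m - proj_embed (u m))
          + norm (X n - proj_embed (u n))"
        by (intro norm_triangle_le add_right_mono norm_triangle_ineq4)
      also have "\<dots> < e"
        using N1[rule_format, of m n] N2[rule_format, of m] N2[rule_format, of n] that by simp
      finally show ?thesis .
    qed
    then show "\<exists>N. \<forall>m\<ge>N. \<forall>n\<ge>N. norm (proj_embed (u m) - proj_embed (u n)) < e" by blast
  qed
  then have "proj_Cauchy u"
    by (simp add: Cauchy_iff proj_Cauchy_def proj_embed_diff norm_proj_embed)
  from tendsto_add[OF close proj_embed_limit[OF this]] have "X \<longlonglongrightarrow> abs_proj_tensor u" by simp
  then show "convergent X" by (rule convergentI)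
qed

definition ptensor :: "'a::real_normed_vector \<Rightarrow> 'b::real_normed_vector \<Rightarrow> ('a, 'b) proj_tensor"
    (infixr "\<otimes>\<^sub>\<pi>" 75) where
  "a \<otimes>\<^sub>\<pi> b = proj_embed (elem_tensor a b)"

lemma bounded_bilinear_ptensor: "bounded_bilinear (\<otimes>\<^sub>\<pi>)"
proof
  fix a a' :: 'a and b b' :: 'b and r :: real
  show "(a + a') \<otimes>\<^sub>\<pi> b = a \<otimes>\<^sub>\<pi> b + a' \<otimes>\<^sub>\<pi> b" "a \<otimes>\<^sub>\<pi> (b + b') = a \<otimes>\<^sub>\<pi> b + a \<otimes>\<^sub>\<pi> b'"
    "(r *\<^sub>R a) \<otimes>\<^sub>\<pi> b = r *\<^sub>R (a \<otimes>\<^sub>\<pi> b)" "a \<otimes>\<^sub>\<pi> (r *\<^sub>R b) = r *\<^sub>R (a \<otimes>\<^sub>\<pi> b)"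
    by (simp_all add: ptensor_def elem_tensor_bilinear proj_embed_add proj_embed_scale)
  show "\<exists>K. \<forall>(a::'a) (b::'b). norm (a \<otimes>\<^sub>\<pi> b) \<le> norm a * norm b * K"
    by (rule exI[of _ 1]) (simp add: ptensor_def norm_proj_embed proj_norm_elem)
qed

section \<open>Strong measurability and the Bochner integral\<close>

text \<open>
  The library's Bochner integral, \<^const>\<open>has_bochner_integral\<close>, is restricted to second countable
  target spaces. Here the Banach space is arbitrary, so Borel measurability is replaced by
  pointwise approximability by simple functions; otherwise the definition is the library's.
\<close>

definition strongly_measurable :: "'a measure \<Rightarrow> ('a \<Rightarrow> 'b::topological_space) \<Rightarrow> bool" where
  "strongly_measurable M f \<longleftrightarrow>
    (\<exists>s. (\<forall>i. simple_function M (s i)) \<and> (\<forall>x\<in>space M. (\<lambda>i::nat. s i x) \<longlonglongrightarrow> f x))"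

definition has_Bochner_integral :: "'a measure \<Rightarrow> ('a \<Rightarrow> 'b::real_normed_vector) \<Rightarrow> 'b \<Rightarrow> bool" where
  "has_Bochner_integral M f x \<longleftrightarrow> strongly_measurable M f \<and>
    (\<exists>s. (\<forall>i::nat. Bochner_Integration.simple_bochner_integrable M (s i)) \<and>
      (\<lambda>i. \<integral>\<^sup>+y. ennreal (norm (f y - s i y)) \<partial>M) \<longlonglongrightarrow> 0 \<and>
      (\<lambda>i. Bochner_Integration.simple_bochner_integral M (s i)) \<longlonglongrightarrow> x)"

text \<open>
  Elements of $L^1(\Omega; E)$ are represented by functions; equality in $L^1$ is equality almost
  everywhere.
\<close>

definition L1_norm :: "'a measure \<Rightarrow> ('a \<Rightarrow> 'b::real_normed_vector) \<Rightarrow> ennreal" where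
  "L1_norm M f = (\<integral>\<^sup>+x. ennreal (norm (f x)) \<partial>M)"

definition in_L1 :: "'a measure \<Rightarrow> ('a \<Rightarrow> 'b::real_normed_vector) \<Rightarrow> bool" where
  "in_L1 M f \<longleftrightarrow> strongly_measurable M f \<and> L1_norm M f < \<infinity>"

section \<open>Filtrations and processes on a bounded time interval\<close>

text \<open>
  Processes and filtrations are indexed by all reals, but only their values at times in
  $[0,T]$ matter.
\<close>

locale usual_filtration = prob_space M + complete_measure M for M :: "'a measure" +
  fixes F :: "real \<Rightarrow> 'a measure" and T :: real
  assumes T_pos: "0 < T"
    and subalg: "0 \<le> t \<Longrightarrow> t \<le> T \<Longrightarrow> subalgebra M (F t)"
    and filtration_mono: "0 \<le> s \<Longrightarrow> s \<le> t \<Longrightarrow> t \<le> T \<Longrightarrow> sets (F s) \<subseteq> sets (F t)"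
    and right_continuous: "0 \<le> t \<Longrightarrow> t < T \<Longrightarrow> (\<Inter>s\<in>{t<..T}. sets (F s)) = sets (F t)"
    and null_sets_initial: "null_sets M \<subseteq> sets (F 0)"

definition adapted :: "(real \<Rightarrow> 'a measure) \<Rightarrow> real \<Rightarrow> (real \<Rightarrow> 'a \<Rightarrow> 'b::topological_space) \<Rightarrow> bool" where
  "adapted F T X \<longleftrightarrow> (\<forall>t\<in>{0..T}. strongly_measurable (F t) (X t))"

definition cadlag :: "'a measure \<Rightarrow> real \<Rightarrow> (real \<Rightarrow> 'a \<Rightarrow> 'b::topological_space) \<Rightarrow> bool" where
  "cadlag M T X \<longleftrightarrow> (\<forall>\<omega>\<in>space M.
    (\<forall>t\<in>{0..<T}. ((\<lambda>s. X s \<omega>) \<longlongrightarrow> X t \<omega>) (at_right t)) \<and>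
    (\<forall>t\<in>{0<..T}. \<exists>l. ((\<lambda>s. X s \<omega>) \<longlongrightarrow> l) (at_left t)))"

definition bounded_variation_on_interval :: "real \<Rightarrow> (real \<Rightarrow> 'b::real_normed_vector) \<Rightarrow> bool" where
  "bounded_variation_on_interval T f \<longleftrightarrow>
    (\<exists>C. \<forall>(n::nat) p. (\<forall>i\<le>n. p i \<in> {0..T}) \<and> (\<forall>i<n. p i \<le> p (Suc i)) \<longrightarrow>
      (\<Sum>i<n. norm (f (p (Suc i)) - f (p i))) \<le> C)"

text \<open>
  Stopping times take values in $[0,\infty]$; for this purpose the filtration is continued
  constantly after time $T$.
\<close>

definition stopping_time_upto :: "(real \<Rightarrow> 'a measure) \<Rightarrow> real \<Rightarrow> ('a \<Rightarrow> ennreal) \<Rightarrow> bool" where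
  "stopping_time_upto F T \<tau> \<longleftrightarrow>
    stopping_time (\<lambda>t::ennreal. F (enn2real (min t (ennreal T)))) \<tau>"

definition stopped :: "('a \<Rightarrow> ennreal) \<Rightarrow> (real \<Rightarrow> 'a \<Rightarrow> 'b) \<Rightarrow> real \<Rightarrow> 'a \<Rightarrow> 'b" where
  "stopped \<tau> X t \<omega> = X (enn2real (min (ennreal t) (\<tau> \<omega>))) \<omega>"

section \<open>Summability\<close>

definition predictable_rectangles ::
  "(real \<Rightarrow> 'a measure) \<Rightarrow> real \<Rightarrow> ('a \<times> real) set set" where
  "predictable_rectangles F T =
    {A \<times> {0} | A. A \<in> sets (F 0)} \<union>
    {A \<times> {s<..t} | A s t. 0 \<le> s \<and> s < t \<and> t \<le> T \<and> A \<in> sets (F s)}"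

definition predictable_sets ::
  "'a measure \<Rightarrow> (real \<Rightarrow> 'a measure) \<Rightarrow> real \<Rightarrow> ('a \<times> real) set set" where
  "predictable_sets M F T = sigma_sets (space M \<times> {0..T}) (predictable_rectangles F T)"

text \<open>
  An $L^1$-valued \<open>\<sigma>\<close>-additive measure on a \<open>\<sigma>\<close>-field: countable sums converge in the norm
  of $L^1$. This includes finite additivity and \<open>\<mu> {} = 0\<close> almost everywhere.
\<close>

definition L1_measure ::
  "'a measure \<Rightarrow> 'c set set \<Rightarrow> ('c set \<Rightarrow> 'a \<Rightarrow> 'e::real_normed_vector) \<Rightarrow> bool" where
  "L1_measure M \<P> \<mu> \<longleftrightarrow> (\<forall>A\<in>\<P>. in_L1 M (\<mu> A)) \<and>
    (\<forall>A::nat \<Rightarrow> 'c set. range A \<subseteq> \<P> \<longrightarrow> disjoint_family A \<longrightarrow>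
      (\<lambda>n. L1_norm M (\<lambda>\<omega>. \<mu> (\<Union>i. A i) \<omega> - (\<Sum>i<n. \<mu> (A i) \<omega>))) \<longlonglongrightarrow> 0)"

text \<open>
  An additive \<open>\<mu>\<close> extends $I_X$ from the ring generated by the predictable rectangles as soon as it
  agrees with $I_X$ on the rectangles, since these values determine $I_X$.
\<close>

definition extends_increments ::
  "'a measure \<Rightarrow> (real \<Rightarrow> 'a measure) \<Rightarrow> real \<Rightarrow> (real \<Rightarrow> 'a \<Rightarrow> 'e::real_vector)
    \<Rightarrow> (('a \<times> real) set \<Rightarrow> 'a \<Rightarrow> 'e) \<Rightarrow> bool" where
  "extends_increments M F T X \<mu> \<longleftrightarrow>
    (\<forall>A\<in>sets (F 0). AE \<omega> in M. \<mu> (A \<times> {0}) \<omega> = indicator A \<omega> *\<^sub>R X 0 \<omega>) \<and>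
    (\<forall>s t. 0 \<le> s \<longrightarrow> s < t \<longrightarrow> t \<le> T \<longrightarrow> (\<forall>A\<in>sets (F s).
      AE \<omega> in M. \<mu> (A \<times> {s<..t}) \<omega> = indicator A \<omega> *\<^sub>R (X t \<omega> - X s \<omega>)))"

definition semivariation ::
  "'a measure \<Rightarrow> 'c set set \<Rightarrow> ('e \<Rightarrow> 'f::real_normed_vector \<Rightarrow> 'g::real_normed_vector)
    \<Rightarrow> ('c set \<Rightarrow> 'a \<Rightarrow> 'e) \<Rightarrow> ennreal" where
  "semivariation M \<P> b \<mu> =
    (SUP (n, A, y) \<in> {(n::nat, A, y). (\<forall>i<n. A i \<in> \<P>) \<and> disjoint_family_on A {..<n} \<and>
        (\<forall>i<n. norm (y i) \<le> 1)}.
      L1_norm M (\<lambda>\<omega>. \<Sum>i<n. b (\<mu> (A i) \<omega>) (y i)))"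

definition summable_process ::
  "'a measure \<Rightarrow> (real \<Rightarrow> 'a measure) \<Rightarrow> real
    \<Rightarrow> ('e::real_normed_vector \<Rightarrow> 'f::real_normed_vector \<Rightarrow> 'g::real_normed_vector)
    \<Rightarrow> (real \<Rightarrow> 'a \<Rightarrow> 'e) \<Rightarrow> bool" where
  "summable_process M F T b X \<longleftrightarrow>
    cadlag M T X \<and> adapted F T X \<and> (\<forall>t\<in>{0..T}. in_L1 M (X t)) \<and>
    (\<exists>\<mu>. L1_measure M (predictable_sets M F T) \<mu> \<and> extends_increments M F T X \<mu> \<and>
      semivariation M (predictable_sets M F T) b \<mu> < \<infinity>)"

definition locally_summable ::
  "'a measure \<Rightarrow> (real \<Rightarrow> 'a measure) \<Rightarrow> real
    \<Rightarrow> ('e::real_normed_vector \<Rightarrow> 'f::real_normed_vector \<Rightarrow> 'g::real_normed_vector)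
    \<Rightarrow> (real \<Rightarrow> 'a \<Rightarrow> 'e) \<Rightarrow> bool" where
  "locally_summable M F T b X \<longleftrightarrow>
    cadlag M T X \<and> adapted F T X \<and>
    (\<exists>\<tau>::nat \<Rightarrow> 'a \<Rightarrow> ennreal.
      (\<forall>n. stopping_time_upto F T (\<tau> n)) \<and>
      (AE \<omega> in M. incseq (\<lambda>n. \<tau> n \<omega>) \<and> (\<lambda>n. \<tau> n \<omega>) \<longlonglongrightarrow> \<infinity>) \<and>
      (\<forall>n. summable_process M F T b (stopped (\<tau> n) X)))"

definition semilocally_summable ::
  "'a measure \<Rightarrow> (real \<Rightarrow> 'a measure) \<Rightarrow> real
    \<Rightarrow> ('e::real_normed_vector \<Rightarrow> 'f::real_normed_vector \<Rightarrow> 'g::real_normed_vector)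
    \<Rightarrow> (real \<Rightarrow> 'a \<Rightarrow> 'e) \<Rightarrow> bool" where
  "semilocally_summable M F T b X \<longleftrightarrow>
    (\<exists>Y V. locally_summable M F T b Y \<and> adapted F T V \<and>
      (\<forall>\<omega>\<in>space M. bounded_variation_on_interval T (\<lambda>t. V t \<omega>)) \<and>
      (\<forall>t\<in>{0..T}. \<forall>\<omega>\<in>space M. X t \<omega> = Y t \<omega> + V t \<omega>))"

section \<open>Tensor quadratic variation\<close>

definition extend_constantly :: "real \<Rightarrow> (real \<Rightarrow> 'a \<Rightarrow> 'b) \<Rightarrow> real \<Rightarrow> 'a \<Rightarrow> 'b" where
  "extend_constantly T X t = X (max 0 (min t T))"

definition tensor_increment ::
  "real \<Rightarrow> (real \<Rightarrow> 'a \<Rightarrow> 'b::real_normed_vector) \<Rightarrow> real \<Rightarrow> 'a \<Rightarrow> real \<Rightarrow> ('b, 'b) proj_tensor" where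
  "tensor_increment T X \<epsilon> \<omega> s =
    (let d = extend_constantly T X (s + \<epsilon>) \<omega> - extend_constantly T X s \<omega>
     in (1 / \<epsilon>) *\<^sub>R (d \<otimes>\<^sub>\<pi> d))"

text \<open>
  The event in question is that the supremum over \<open>t\<close> exceeds \<open>\<delta>\<close>. Its measurability has to be
  required explicitly, because \<^const>\<open>measure\<close> is \<open>0\<close> on non-measurable sets.
\<close>

definition converges_ucp ::
  "'a measure \<Rightarrow> real \<Rightarrow> (real \<Rightarrow> real \<Rightarrow> 'a \<Rightarrow> 'g::real_normed_vector)
    \<Rightarrow> (real \<Rightarrow> 'a \<Rightarrow> 'g) \<Rightarrow> bool" where
  "converges_ucp M T J Q \<longleftrightarrow> (\<forall>\<delta>>0.
    (\<forall>\<epsilon>>0. {\<omega>\<in>space M. \<exists>t\<in>{0..T}. \<delta> < norm (J \<epsilon> t \<omega> - Q t \<omega>)} \<in> sets M) \<and>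
    ((\<lambda>\<epsilon>. measure M {\<omega>\<in>space M. \<exists>t\<in>{0..T}. \<delta> < norm (J \<epsilon> t \<omega> - Q t \<omega>)}) \<longlongrightarrow> 0) (at_right 0))"

definition is_tensor_quadratic_variation ::
  "'a measure \<Rightarrow> real \<Rightarrow> (real \<Rightarrow> 'a \<Rightarrow> 'b::real_normed_vector)
    \<Rightarrow> (real \<Rightarrow> 'a \<Rightarrow> ('b, 'b) proj_tensor) \<Rightarrow> bool" where
  "is_tensor_quadratic_variation M T X Q \<longleftrightarrow>
    (\<forall>t\<in>{0..T}. strongly_measurable M (Q t)) \<and>
    (\<exists>J. (\<forall>\<epsilon>>0. \<forall>t\<in>{0..T}. \<forall>\<omega>\<in>space M.
        has_Bochner_integral (restrict_space lborel {0..t}) (tensor_increment T X \<epsilon> \<omega>) (J \<epsilon> t \<omega>)) \<and>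
      converges_ucp M T J Q)"

definition admits_tensor_quadratic_variation ::
  "'a measure \<Rightarrow> real \<Rightarrow> (real \<Rightarrow> 'a \<Rightarrow> 'b::real_normed_vector) \<Rightarrow> bool" where
  "admits_tensor_quadratic_variation M T X \<longleftrightarrow> (\<exists>Q. is_tensor_quadratic_variation M T X Q)"

end

theory Submission
  imports Defs
begin

text \<open>
The proof needs no stochastic integral. On a grid of mesh \<open>h\<close> let \<open>x\<^sub>j\<close> be the values of a path that starts
at \<open>0\<close>, write \<open>D\<^sub>j = x\<^sub>j\<^sub>+\<^sub>1 - x\<^sub>j\<close>, and let \<open>\<epsilon> = N h\<close>. The regularised quadratic variation is discretised by
\<open>1/N \<Sum>\<^sub>k\<^sub><\<^sub>m (x\<^sub>k\<^sub>+\<^sub>N - x\<^sub>k) \<otimes> (x\<^sub>k\<^sub>+\<^sub>N - x\<^sub>k)\<close>. Summation by parts shows that it differs from the ordinary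
discrete quadratic variation \<open>\<Sum>\<^sub>j\<^sub><\<^sub>m D\<^sub>j \<otimes> D\<^sub>j\<close> by
\<open>- \<Sum>\<^sub>j\<^sub><\<^sub>m D\<^sub>j \<otimes> (g\<^sub>j - x\<^sub>j) - \<Sum>\<^sub>j\<^sub><\<^sub>m (g\<^sub>j - x\<^sub>j) \<otimes> D\<^sub>j\<close>, up to boundary terms of the size (oscillation of the
path over time \<open>\<epsilon>\<close>) times (supremum of the path); here \<open>g\<^sub>j\<close> is the average of the last \<open>N\<close> values
(lemma \<open>norm_discrete_quadratic_variation_diff_le\<close>). The integrands \<open>g\<^sub>j - x\<^sub>j\<close> are adapted and bounded by
the oscillation of the path over time \<open>\<epsilon>\<close>, hence small for small \<open>\<epsilon>\<close>, whatever the mesh.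

Such sums with small adapted integrands are small, uniformly in \<open>m\<close> and in the mesh, outside an event of
small probability. For the bounded variation part of the process this holds path by path. For the
summable part, finite semivariation bounds the \<open>L\<^sup>1\<close> norm of an elementary integral by a constant times the
bound of the integrand; setting the integrand to \<open>0\<close> after the partial sums first exceed \<open>\<delta>\<close> turns this
into a weak type maximal inequality (lemma \<open>maximal_inequality\<close>). Each of the two summability hypotheses
controls one of the two sums above.

So for small \<open>\<epsilon>\<close> and \<open>\<epsilon>'\<close> both regularised quadratic variations are close to one and the same discrete
quadratic variation on an arbitrarily fine dyadic grid. Refining the grid with \<open>\<epsilon>\<close> and \<open>\<epsilon>'\<close> fixed shows
that they form a Cauchy family for uniform convergence in probability
(lemma \<open>regularised_qv_Cauchy_in_probability\<close>); a subsequence that converges fast enough converges uniformly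
almost surely, and its limit is the tensor quadratic variation. Smallness in probability is expressed
throughout by an exceptional event of small probability outside which the estimate holds, which avoids
measurability questions about suprema over the uncountable time interval.
\<close>

section \<open>Strong measurability\<close>

lemma strongly_measurable_simple: "simple_function M f \<Longrightarrow> strongly_measurable M f"
  unfolding strongly_measurable_def by (intro exI[of _ "\<lambda>_. f"] conjI allI ballI tendsto_const)

lemma strongly_measurable_const: "strongly_measurable M (\<lambda>_. c)"
  by (intro strongly_measurable_simple) simp

lemma strongly_measurable_compose2:
  assumes f: "strongly_measurable M f" and g: "strongly_measurable M g"
    and cont: "\<And>u v x y. u \<longlonglongrightarrow> x \<Longrightarrow> v \<longlonglongrightarrow> y \<Longrightarrow> (\<lambda>i::nat. h (u i) (v i)) \<longlonglongrightarrow> h x y"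
  shows "strongly_measurable M (\<lambda>\<omega>. h (f \<omega>) (g \<omega>))"
proof -
  obtain s where s: "\<And>i. simple_function M (s i)"
    "\<And>\<omega>. \<omega> \<in> space M \<Longrightarrow> (\<lambda>i::nat. s i \<omega>) \<longlonglongrightarrow> f \<omega>"
    using f unfolding strongly_measurable_def by blast
  obtain r where r: "\<And>i. simple_function M (r i)"
    "\<And>\<omega>. \<omega> \<in> space M \<Longrightarrow> (\<lambda>i::nat. r i \<omega>) \<longlonglongrightarrow> g \<omega>"
    using g unfolding strongly_measurable_def by blast
  have "simple_function M (\<lambda>\<omega>. h (s i \<omega>) (r i \<omega>))" for i
    by (rule simple_function_compose2[OF s(1) r(1)])
  moreover have "(\<lambda>i. h (s i \<omega>) (r i \<omega>)) \<longlonglongrightarrow> h (f \<omega>) (g \<omega>)" if "\<omega> \<in> space M" for \<omega>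
    by (rule cont[OF s(2)[OF that] r(2)[OF that]])
  ultimately show ?thesis
    unfolding strongly_measurable_def
    by (intro exI[of _ "\<lambda>i \<omega>. h (s i \<omega>) (r i \<omega>)"] conjI allI ballI)
qed

lemma strongly_measurable_add:
  fixes f g :: "'a \<Rightarrow> 'b::real_normed_vector"
  shows "strongly_measurable M f \<Longrightarrow> strongly_measurable M g \<Longrightarrow> strongly_measurable M (\<lambda>\<omega>. f \<omega> + g \<omega>)"
  by (erule (1) strongly_measurable_compose2[where h="(+)"]) (rule tendsto_add)

lemma strongly_measurable_diff:
  fixes f g :: "'a \<Rightarrow> 'b::real_normed_vector"
  shows "strongly_measurable M f \<Longrightarrow> strongly_measurable M g \<Longrightarrow> strongly_measurable M (\<lambda>\<omega>. f \<omega> - g \<omega>)"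
  by (erule (1) strongly_measurable_compose2[where h="(-)"]) (rule tendsto_diff)

lemma strongly_measurable_bilinear:
  "strongly_measurable M f \<Longrightarrow> strongly_measurable M g \<Longrightarrow> bounded_bilinear b
    \<Longrightarrow> strongly_measurable M (\<lambda>\<omega>. b (f \<omega>) (g \<omega>))"
  by (erule (1) strongly_measurable_compose2[where h=b]) (rule bounded_bilinear.tendsto)

lemma strongly_measurable_scaleR:
  fixes f :: "'a \<Rightarrow> 'b::real_normed_vector"
  shows "strongly_measurable M f \<Longrightarrow> strongly_measurable M (\<lambda>\<omega>. r *\<^sub>R f \<omega>)"
  by (rule strongly_measurable_bilinear[OF strongly_measurable_const _ bounded_bilinear_scaleR])

lemma strongly_measurable_sum:
  fixes f :: "'i \<Rightarrow> 'a \<Rightarrow> 'b::real_normed_vector"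
  shows "(\<And>i. i \<in> I \<Longrightarrow> strongly_measurable M (f i)) \<Longrightarrow> strongly_measurable M (\<lambda>\<omega>. \<Sum>i\<in>I. f i \<omega>)"
  by (induction I rule: infinite_finite_induct)
     (auto intro: strongly_measurable_add strongly_measurable_const)

lemma borel_measurable_norm_strongly_measurable:
  fixes f :: "'a \<Rightarrow> 'b::real_normed_vector"
  assumes "strongly_measurable M f"
  shows "(\<lambda>\<omega>. norm (f \<omega>)) \<in> borel_measurable M"
proof -
  obtain s where s: "\<And>i. simple_function M (s i)"
    "\<And>\<omega>. \<omega> \<in> space M \<Longrightarrow> (\<lambda>i::nat. s i \<omega>) \<longlonglongrightarrow> f \<omega>"
    using assms unfolding strongly_measurable_def by blast
  show ?thesis
  proof (rule borel_measurable_LIMSEQ_metric)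
    fix i
    have "simple_function M (\<lambda>\<omega>. norm (s i \<omega>))"
      using s(1) by (rule simple_function_compose1)
    then show "(\<lambda>\<omega>. norm (s i \<omega>)) \<in> borel_measurable M"
      by (rule borel_measurable_simple_function)
  qed (auto intro: tendsto_norm s)
qed

lemma strongly_measurable_if:
  assumes f: "strongly_measurable M f" and A: "A \<in> sets M"
  shows "strongly_measurable M (\<lambda>\<omega>. if \<omega> \<in> A then f \<omega> else c)"
proof -
  obtain s where s: "\<And>i. simple_function M (s i)"
    "\<And>\<omega>. \<omega> \<in> space M \<Longrightarrow> (\<lambda>i::nat. s i \<omega>) \<longlonglongrightarrow> f \<omega>"
    using f unfolding strongly_measurable_def by blast
  show ?thesis
    unfolding strongly_measurable_def
  proof (rule exI[of _ "\<lambda>i \<omega>. if \<omega> \<in> A then s i \<omega> else c"], intro conjI allI ballI)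
    fix i
    show "simple_function M (\<lambda>\<omega>. if \<omega> \<in> A then s i \<omega> else c)"
      using s(1) A by (intro simple_function_If_set) (auto simp: sets.Int_space_eq2)
  qed (auto intro: s)
qed

lemma strongly_measurable_subalgebra:
  assumes "subalgebra M N" "strongly_measurable N f"
  shows "strongly_measurable M f"
proof -
  have "simple_function N s \<Longrightarrow> simple_function M s" for s :: "'a \<Rightarrow> 'b"
    using assms(1) by (auto simp: simple_function_def subalgebra_def)
  with assms show ?thesis
    unfolding strongly_measurable_def subalgebra_def by blast
qed

text \<open>
Without separability of the target, Borel measurability does not give approximation by simple functions.
But all values of all the simple functions that approximate the \<open>f n\<close> form a countable set with \<open>g\<close> in its
closure; the element nearest to \<open>g \<omega>\<close> among the first \<open>n\<close> ones of that set is then a simple function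
of \<open>\<omega>\<close>, and it tends to \<open>g \<omega>\<close>.
\<close>

lemma strongly_measurable_limit:
  fixes f :: "nat \<Rightarrow> 'a \<Rightarrow> 'b::real_normed_vector"
  assumes f: "\<And>n. strongly_measurable M (f n)"
    and lim: "\<And>\<omega>. \<omega> \<in> space M \<Longrightarrow> (\<lambda>n. f n \<omega>) \<longlonglongrightarrow> g \<omega>"
  shows "strongly_measurable M g"
proof -
  obtain s where s: "\<And>n i. simple_function M (s n i)"
    "\<And>n \<omega>. \<omega> \<in> space M \<Longrightarrow> (\<lambda>i::nat. s n i \<omega>) \<longlonglongrightarrow> f n \<omega>"
  proof -
    have "\<forall>n. \<exists>s. (\<forall>i. simple_function M (s i)) \<and> (\<forall>x\<in>space M. (\<lambda>i::nat. s i x) \<longlonglongrightarrow> f n x)"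
      using f by (simp add: strongly_measurable_def)
    from choice[OF this] show thesis using that by blast
  qed
  define D where "D = insert 0 (\<Union>n i. s n i ` space M)"
  have cD: "countable D" unfolding D_def
    using s(1) by (intro countable_insert countable_UN countableI_type countable_finite)
      (simp add: simple_function_def)
  define d where "d = from_nat_into D"
  have d: "range d = D" unfolding d_def
    using cD by (intro range_from_nat_into) (auto simp: D_def)
  have dist: "(\<lambda>\<omega>. norm (g \<omega> - d k)) \<in> borel_measurable M" for k
  proof (rule borel_measurable_LIMSEQ_metric)
    show "(\<lambda>\<omega>. norm (f n \<omega> - d k)) \<in> borel_measurable M" for n
      by (intro borel_measurable_norm_strongly_measurable strongly_measurable_diff f
          strongly_measurable_const)
  qed (auto intro!: tendsto_intros lim)
  \<comment> \<open>the first index among \<open>0, \<dots>, n\<close> at which the distance to \<open>g \<omega>\<close> is least\<close>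
  define P where "P n \<omega> j \<longleftrightarrow> j \<le> n \<and> (\<forall>k\<le>n. norm (g \<omega> - d j) \<le> norm (g \<omega> - d k))" for n \<omega> j
  define J where "J n \<omega> = (LEAST j. P n \<omega> j)" for n \<omega>
  have ex: "\<exists>j. P n \<omega> j" for n \<omega>
  proof -
    obtain j where "is_arg_min (\<lambda>k. norm (g \<omega> - d k)) (\<lambda>k. k \<in> {..n}) j"
      using ex_is_arg_min_if_finite[of "{..n}"] by blast
    then show ?thesis by (auto simp: P_def is_arg_min_linorder intro!: exI[of _ j])
  qed
  have PJ: "P n \<omega> (J n \<omega>)" for n \<omega>
    unfolding J_def using ex by (rule LeastI_ex)
  have Pm: "Measurable.pred M (\<lambda>\<omega>. P n \<omega> j)" for n j
  proof -
    note dist[measurable]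
    show ?thesis unfolding P_def by measurable
  qed
  have Jm: "J n \<in> measurable M (count_space UNIV)" for n
    unfolding J_def using Pm by (rule measurable_Least)
  have "simple_function M (J n)" for n
  proof -
    have fin: "finite (J n ` space M)"
      by (rule finite_subset[of _ "{..n}"]) (use PJ in \<open>auto simp: P_def\<close>)
    show ?thesis
      unfolding simple_function_def using fin Jm[of n]
      by (auto intro!: measurable_sets[OF Jm])
  qed
  then have simple: "simple_function M (\<lambda>\<omega>. d (J n \<omega>))" for n
    by (rule simple_function_compose1)
  have conv: "(\<lambda>n. d (J n \<omega>)) \<longlonglongrightarrow> g \<omega>" if \<omega>: "\<omega> \<in> space M" for \<omega>
  proof (rule LIMSEQ_I)
    fix e :: real assume e: "0 < e"
    obtain n where n: "norm (f n \<omega> - g \<omega>) < e / 2"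
      using LIMSEQ_D[OF lim[OF \<omega>], of "e / 2"] e by auto
    obtain i where i: "norm (s n i \<omega> - f n \<omega>) < e / 2"
      using LIMSEQ_D[OF s(2)[OF \<omega>], of "e / 2" n] e by auto
    have "s n i \<omega> \<in> range d" using \<omega> by (auto simp: d D_def)
    then obtain k where k: "d k = s n i \<omega>" by auto
    have "norm (g \<omega> - d k) < e"
      using norm_triangle_ineq[of "s n i \<omega> - f n \<omega>" "f n \<omega> - g \<omega>"] n i
      by (simp add: k norm_minus_commute)
    then have "norm (d (J m \<omega>) - g \<omega>) < e" if "m \<ge> k" for m
      proof -
      have "norm (g \<omega> - d (J m \<omega>)) \<le> norm (g \<omega> - d k)"
        using PJ[of m \<omega>] that unfolding P_def by blast
      with \<open>norm (g \<omega> - d k) < e\<close> show ?thesis by (simp add: norm_minus_commute)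
    qed
    then show "\<exists>no. \<forall>m\<ge>no. norm (d (J m \<omega>) - g \<omega>) < e" by blast
  qed
  show ?thesis
    unfolding strongly_measurable_def by (rule exI[of _ "\<lambda>n \<omega>. d (J n \<omega>)"]) (auto simp: simple conv)
qed

section \<open>Integrals of continuous paths\<close>

text \<open>
Integrals of continuous paths are taken as Henstock-Kurzweil integrals, whose calculus is available for all
Banach spaces. This lemma is the bridge to the Bochner integral.
\<close>

lemma simple_function_has_integral:
  fixes s :: "real \<Rightarrow> 'b::real_normed_vector"
  assumes s: "simple_function (restrict_space lborel {0..t}) s"
  shows "(s has_integral Bochner_Integration.simple_bochner_integral (restrict_space lborel {0..t}) s) {0..t}"
proof -
  let ?R = "restrict_space lborel {0..t}" and ?S = "\<lambda>y. {x\<in>{0..t}. s x = y}"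
  have sp: "space ?R = {0..t}" by (simp add: space_restrict_space)
  have fin: "finite (s ` {0..t})" using s by (simp add: simple_function_def sp)
  have *: "((\<lambda>x. indicator (?S y) x *\<^sub>R y) has_integral (measure ?R (?S y) *\<^sub>R y)) {0..t}"
    if y: "y \<in> s ` {0..t}" for y
  proof -
    have "s -` {y} \<inter> space ?R \<in> sets ?R"
      using s y by (auto simp: simple_function_def sp)
    then have R: "?S y \<in> sets ?R" by (simp add: sp vimage_def Int_def conj_commute)
    then have L: "?S y \<in> sets borel"
      by (auto simp: sets_restrict_space_iff)
    have m: "measure ?R (?S y) = measure lborel (?S y)"
      by (rule measure_restrict_space) auto
    have "emeasure lborel (?S y) \<le> emeasure lborel {0..t}"
      by (rule emeasure_mono) auto
    then have "emeasure lborel (?S y) < \<infinity>"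
      by (rule le_less_trans) (simp add: emeasure_lborel_Icc_eq)
    from has_integral_measure_lborel[OF L this]
    have "((\<lambda>x. 1::real) has_integral measure lborel (?S y)) (?S y)" .
    then have "((\<lambda>x. if x \<in> ?S y then 1::real else 0) has_integral measure lborel (?S y)) {0..t}"
      by (subst has_integral_restrict) auto
    then have "((\<lambda>x. (if x \<in> ?S y then 1::real else 0) *\<^sub>R y) has_integral measure lborel (?S y) *\<^sub>R y) {0..t}"
      by (rule has_integral_scaleR_left)
    then show ?thesis unfolding m
      by (rule has_integral_eq[rotated]) (simp add: indicator_def)
  qed
  have "((\<lambda>x. \<Sum>y\<in>s ` {0..t}. indicator (?S y) x *\<^sub>R y) has_integral
      (\<Sum>y\<in>s ` {0..t}. measure ?R (?S y) *\<^sub>R y)) {0..t}"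
    using fin * by (rule has_integral_sum)
  moreover have "(\<Sum>y\<in>s ` {0..t}. indicator (?S y) x *\<^sub>R y) = s x" if "x \<in> {0..t}" for x
  proof -
    have "(\<Sum>y\<in>s ` {0..t}. indicator (?S y) x *\<^sub>R y) = (\<Sum>y\<in>s ` {0..t}. if y = s x then y else 0)"
      using that by (intro sum.cong) (auto simp: indicator_def)
    also have "\<dots> = s x" using fin that by simp
    finally show ?thesis .
  qed
  ultimately show ?thesis
    unfolding Bochner_Integration.simple_bochner_integral_def sp
    by (rule has_integral_eq[rotated]) simp
qed

lemma has_Bochner_integral_continuous:
  fixes f :: "real \<Rightarrow> 'b::banach"
  assumes cont: "continuous_on {0..t} f" and t: "0 \<le> t"
  shows "has_Bochner_integral (restrict_space lborel {0..t}) f (integral {0..t} f)"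
proof -
  let ?R = "restrict_space lborel {0..t}"
  have sp: "space ?R = {0..t}" by (simp add: space_restrict_space)
  \<comment> \<open>rounding down to a multiple of \<open>1 / (n + 1)\<close>; \<open>f \<circ> q n\<close> is a uniform simple approximation of \<open>f\<close>\<close>
  define q where "q n x = \<lfloor>real (Suc n) * x\<rfloor> / real (Suc n)" for n and x :: real
  have q: "q n x \<le> x" "x - 1 / real (Suc n) \<le> q n x" for n x
  proof -
    have "\<lfloor>real (Suc n) * x\<rfloor> \<le> real (Suc n) * x" by linarith
    then show "q n x \<le> x" by (simp add: q_def field_simps del: of_nat_Suc)
    have "(real (Suc n) * x - 1) / real (Suc n) \<le> q n x"
      unfolding q_def by (intro divide_right_mono) linarith+
    then show "x - 1 / real (Suc n) \<le> q n x" by (simp add: diff_divide_distrib del: of_nat_Suc)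
  qed
  have q0: "0 \<le> q n x" if "0 \<le> x" for n x
    using that by (simp add: q_def)
  have qt: "q n x \<in> {0..t}" if "x \<in> {0..t}" for n x
    using q(1)[where n=n and x=x] q0[where n=n and x=x] that by auto
  have simple: "simple_function ?R (\<lambda>x. f (q n x))" for n
  proof (rule simple_function_compose1[of _ "q n"], rule simple_function_borel_measurable)
    show "q n \<in> borel_measurable ?R"
      unfolding q_def by (intro measurable_restrict_space1) measurable
    have "q n ` space ?R \<subseteq> (\<lambda>k::int. k / real (Suc n)) ` {0..\<lfloor>real (Suc n) * t\<rfloor>}"
      unfolding q_def sp by (auto intro!: imageI floor_mono mult_left_mono)
    then show "finite (q n ` space ?R)" by (rule finite_subset) auto
  qed
  have uc: "uniformly_continuous_on {0..t} f"
    using cont by (intro compact_uniformly_continuous) auto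
  have close: "\<exists>n0. \<forall>n\<ge>n0. \<forall>x\<in>{0..t}. norm (f x - f (q n x)) < e" if e: "0 < e" for e
  proof -
    obtain d where d: "0 < d" "\<And>x y. x \<in> {0..t} \<Longrightarrow> y \<in> {0..t} \<Longrightarrow> dist y x < d \<Longrightarrow> dist (f y) (f x) < e"
      using uc e unfolding uniformly_continuous_on_def by metis
    obtain n0 where n0: "inverse (real (Suc n0)) < d" using reals_Archimedean[OF d(1)] by auto
    have "norm (f x - f (q n x)) < e" if "n \<ge> n0" "x \<in> {0..t}" for n x
    proof -
      have "1 / real (Suc n) \<le> inverse (real (Suc n0))"
        using that by (simp add: field_simps)
      then have "dist x (q n x) < d"
        using q[where n=n and x=x] n0 by (simp add: dist_real_def)
      then show ?thesis
        using d(2)[OF qt[OF that(2)] that(2)] by (simp add: dist_norm)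
    qed
    then show ?thesis by blast
  qed
  have emt: "emeasure ?R {0..t} = ennreal t"
    using t by (subst emeasure_restrict_space) auto
  have sbi: "Bochner_Integration.simple_bochner_integrable ?R (\<lambda>x. f (q n x))" for n
  proof (rule Bochner_Integration.simple_bochner_integrable.intros[OF simple])
    have "emeasure ?R {y \<in> space ?R. f (q n y) \<noteq> 0} \<le> emeasure ?R (space ?R)"
      by (rule emeasure_space)
    also have "\<dots> < \<infinity>" by (simp add: sp emt)
    finally show "emeasure ?R {y \<in> space ?R. f (q n y) \<noteq> 0} \<noteq> \<infinity>" by simp
  qed
  have int: "f integrable_on {0..t}" using cont by (rule integrable_continuous_real)
  have L: "(\<lambda>n. \<integral>\<^sup>+ y. ennreal (norm (f y - f (q n y))) \<partial>?R) \<longlonglongrightarrow> 0"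
  proof (rule order_tendstoI)
    fix a :: ennreal assume a: "0 < a"
    obtain e where e: "0 < e" "ennreal e * ennreal t < a"
    proof (cases "a = \<infinity>")
      case True then show ?thesis using that[of 1] by (simp add: ennreal_mult'[symmetric] less_top[symmetric])
    next
      case False
      then obtain r where r: "a = ennreal r" "0 < r" using a by (cases a) auto
      have "r / (t + 1) * t < r" using r t by (simp add: field_simps)
      then show ?thesis using that[of "r / (t + 1)"] r t
        by (simp add: ennreal_mult'[symmetric] ennreal_less_iff)
    qed
    obtain n0 where n0: "\<forall>n\<ge>n0. \<forall>x\<in>{0..t}. norm (f x - f (q n x)) < e" using close e(1) by blast
    have "(\<integral>\<^sup>+ y. ennreal (norm (f y - f (q n y))) \<partial>?R) < a" if "n \<ge> n0" for n
    proof -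
      have "(\<integral>\<^sup>+ y. ennreal (norm (f y - f (q n y))) \<partial>?R) \<le> (\<integral>\<^sup>+ y. ennreal e \<partial>?R)"
        using n0 that by (intro nn_integral_mono ennreal_leI) (auto simp: sp intro: less_imp_le)
      also have "\<dots> = ennreal e * ennreal t" by (simp add: sp emt)
      finally show ?thesis using e(2) by simp
    qed
    then show "\<forall>\<^sub>F n in sequentially. (\<integral>\<^sup>+ y. ennreal (norm (f y - f (q n y))) \<partial>?R) < a"
      unfolding eventually_sequentially by blast
  qed simp
  have I: "(\<lambda>n. Bochner_Integration.simple_bochner_integral ?R (\<lambda>x. f (q n x))) \<longlonglongrightarrow> integral {0..t} f"
  proof (rule LIMSEQ_I)
    fix e :: real assume e: "0 < e"
    then have "0 < e / (t + 1)" using t by simp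
    then obtain n0 where n0: "\<forall>n\<ge>n0. \<forall>x\<in>{0..t}. norm (f x - f (q n x)) < e / (t + 1)" using close by blast
    have "norm (Bochner_Integration.simple_bochner_integral ?R (\<lambda>x. f (q n x)) - integral {0..t} f) < e"
      if "n \<ge> n0" for n
    proof -
      have "((\<lambda>x. f (q n x) - f x) has_integral
          (Bochner_Integration.simple_bochner_integral ?R (\<lambda>x. f (q n x)) - integral {0..t} f)) (cbox 0 t)"
        using has_integral_diff[OF simple_function_has_integral[OF simple] integrable_integral[OF int]]
        by simp
      then have "norm (Bochner_Integration.simple_bochner_integral ?R (\<lambda>x. f (q n x)) - integral {0..t} f)
          \<le> e / (t + 1) * measure lborel (cbox 0 t)"
        by (rule has_integral_bound[rotated])
           (use n0 that e t in \<open>auto simp: norm_minus_commute intro: less_imp_le\<close>)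
      also have "\<dots> < e" using e t by (simp add: field_simps)
      finally show ?thesis .
    qed
    then show "\<exists>no. \<forall>n\<ge>no. norm (Bochner_Integration.simple_bochner_integral ?R (\<lambda>x. f (q n x))
        - integral {0..t} f) < e" by blast
  qed
  have pw: "(\<lambda>n. f (q n x)) \<longlonglongrightarrow> f x" if "x \<in> {0..t}" for x
    proof (rule LIMSEQ_I)
    fix e :: real assume "0 < e"
    from close[OF this] obtain n0 where "\<forall>n\<ge>n0. \<forall>x\<in>{0..t}. norm (f x - f (q n x)) < e" by blast
    with that show "\<exists>no. \<forall>n\<ge>no. norm (f (q n x) - f x) < e"
      by (intro exI[of _ n0]) (simp add: norm_minus_commute)
  qed
  have "strongly_measurable ?R f"
    unfolding strongly_measurable_def
    by (intro exI[of _ "\<lambda>n x. f (q n x)"]) (auto simp: simple sp pw)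
  with L I sbi show ?thesis
    unfolding has_Bochner_integral_def by (intro conjI exI[of _ "\<lambda>n x. f (q n x)"]) auto
qed

section \<open>A maximal inequality for summable processes\<close>

lemma increasing_grid_mono:
  fixes t :: "nat \<Rightarrow> real"
  assumes "\<And>j. j < m \<Longrightarrow> t j < t (Suc j)" "i \<le> j" "j \<le> m"
  shows "t i \<le> t j"
  using assms(2,3)
proof (induction j rule: dec_induct)
  case (step k)
  then show ?case using assms(1)[of k] by simp
qed simp

text \<open>
An elementary integral with simple integrands is one of the sums in the definition of the semivariation:
the predictable sets are the rectangles \<open>{H j = y} \<times> (t j, t (j + 1)]\<close>, and they are disjoint.
\<close>

lemma L1_norm_simple_integral_le_semivariation:
  fixes Y :: "real \<Rightarrow> 'a \<Rightarrow> 'e::real_normed_vector"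
    and b :: "'e \<Rightarrow> 'f::real_normed_vector \<Rightarrow> 'g::real_normed_vector"
  assumes filt: "usual_filtration M F T" and b: "bounded_bilinear b"
    and ext: "extends_increments M F T Y \<mu>"
    and range: "\<And>j. j \<le> m \<Longrightarrow> t j \<in> {0..T}" and step: "\<And>j. j < m \<Longrightarrow> t j < t (Suc j)"
    and H: "\<And>j. j < m \<Longrightarrow> simple_function (F (t j)) (H j)"
    and bound: "\<And>j \<omega>. j < m \<Longrightarrow> \<omega> \<in> space M \<Longrightarrow> norm (H j \<omega>) \<le> 1"
  shows "L1_norm M (\<lambda>\<omega>. \<Sum>j<m. b (Y (t (Suc j)) \<omega> - Y (t j) \<omega>) (H j \<omega>))
    \<le> semivariation M (predictable_sets M F T) b \<mu>"
proof -
  interpret usual_filtration M F T by fact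
  have sp: "space (F (t j)) = space M" if "j \<le> m" for j
    using subalg range[OF that] by (auto simp: subalgebra_def)
  define I where "I = Sigma {..<m} (\<lambda>j. H j ` space M)"
  define R where "R p = {\<omega>\<in>space M. H (fst p) \<omega> = snd p} \<times> {t (fst p)<..t (Suc (fst p))}" for p
  have finH: "finite (H j ` space M)" if "j < m" for j
    using H[OF that] that by (simp add: simple_function_def sp)
  then have finI: "finite I" unfolding I_def by auto
  obtain f where f: "bij_betw f {..<card I} I"
    using ex_bij_betw_nat_finite[OF finI] by (auto simp: atLeast0LessThan)
  have fI: "f i \<in> I" if "i < card I" for i using f that by (auto simp: bij_betw_def)
  have A: "{\<omega>\<in>space M. H j \<omega> = y} \<in> sets (F (t j))" if "j < m" for j y
  proof -
    have "H j -` {y} \<inter> space (F (t j)) \<in> sets (F (t j))"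
    proof (cases "y \<in> H j ` space (F (t j))")
      case False
      then have "H j -` {y} \<inter> space (F (t j)) = {}" by auto
      then show ?thesis by simp
    qed (use H[OF that] in \<open>auto simp: simple_function_def\<close>)
    moreover have "H j -` {y} \<inter> space (F (t j)) = {\<omega>\<in>space M. H j \<omega> = y}"
      using that by (auto simp: sp)
    ultimately show ?thesis by simp
  qed
  have pred: "R p \<in> predictable_sets M F T" if "p \<in> I" for p
  proof -
    have j: "fst p < m" using that by (auto simp: I_def)
    have "0 \<le> t (fst p)" "t (Suc (fst p)) \<le> T" using range[of "fst p"] range[of "Suc (fst p)"] j by auto
    then have "\<exists>A s u. R p = A \<times> {s<..u} \<and> 0 \<le> s \<and> s < u \<and> u \<le> T \<and> A \<in> sets (F s)"
      unfolding R_def using A[OF j] step[OF j]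
      by (intro exI[of _ "t (fst p)"] exI[of _ "t (Suc (fst p))"]
          exI[of _ "{\<omega>\<in>space M. H (fst p) \<omega> = snd p}"] conjI refl) auto
    then have "R p \<in> predictable_rectangles F T"
      unfolding predictable_rectangles_def by (intro UnI2 CollectI)
    then show ?thesis by (simp add: predictable_sets_def sigma_sets.Basic)
  qed
  have disj: "R p \<inter> R q = {}" if "p \<in> I" "q \<in> I" "p \<noteq> q" for p q
  proof -
    have *: "{t i<..t (Suc i)} \<inter> {t j<..t (Suc j)} = {}" if "i < j" "j < m" for i j
      using increasing_grid_mono[of m t "Suc i" j] step that by auto
    show ?thesis
    proof (cases "fst p = fst q")
      case True
      then show ?thesis using that by (auto simp: R_def prod_eq_iff)
    next
      case False
      then have "fst p < fst q \<or> fst q < fst p" by auto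
      then show ?thesis
        using *[of "fst p" "fst q"] *[of "fst q" "fst p"] that by (auto simp: R_def I_def)
    qed
  qed
  have "L1_norm M (\<lambda>\<omega>. \<Sum>i<card I. b (\<mu> (R (f i)) \<omega>) (snd (f i)))
    \<le> semivariation M (predictable_sets M F T) b \<mu>"
  proof -
    have "(card I, R \<circ> f, snd \<circ> f) \<in> {(n::nat, A, y). (\<forall>i<n. A i \<in> predictable_sets M F T)
        \<and> disjoint_family_on A {..<n} \<and> (\<forall>i<n. norm (y i) \<le> 1)}"
    proof (clarsimp, intro conjI allI impI)
      fix i assume i: "i < card I"
      show "R (f i) \<in> predictable_sets M F T" by (intro pred fI i)
      obtain j \<omega> where "j < m" "\<omega> \<in> space M" "f i = (j, H j \<omega>)" using fI[OF i] by (auto simp: I_def)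
      then show "norm (snd (f i)) \<le> 1" using bound by simp
    next
      have "f i \<noteq> f j" if "i < card I" "j < card I" "i \<noteq> j" for i j
        using f that by (auto simp: bij_betw_def inj_on_def)
      then show "disjoint_family_on (R \<circ> f) {..<card I}"
        unfolding disjoint_family_on_def o_def
        by (intro ballI impI disj fI) (simp_all only: lessThan_iff)
    qed
    then show ?thesis unfolding semivariation_def by (rule SUP_upper2) simp
  qed
  also have "L1_norm M (\<lambda>\<omega>. \<Sum>i<card I. b (\<mu> (R (f i)) \<omega>) (snd (f i)))
    = L1_norm M (\<lambda>\<omega>. \<Sum>j<m. b (Y (t (Suc j)) \<omega> - Y (t j) \<omega>) (H j \<omega>))"
    unfolding L1_norm_def
  proof (rule nn_integral_cong_AE)
    have "AE \<omega> in M. \<forall>p\<in>I. \<mu> (R p) \<omega> = indicator {\<omega>\<in>space M. H (fst p) \<omega> = snd p} \<omega> *\<^sub>R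
        (Y (t (Suc (fst p))) \<omega> - Y (t (fst p)) \<omega>)"
    proof (rule AE_finite_allI[OF finI])
      fix p assume "p \<in> I"
      then have j: "fst p < m" by (auto simp: I_def)
      then show "AE \<omega> in M. \<mu> (R p) \<omega> = indicator {\<omega>\<in>space M. H (fst p) \<omega> = snd p} \<omega> *\<^sub>R
        (Y (t (Suc (fst p))) \<omega> - Y (t (fst p)) \<omega>)"
        unfolding R_def
        using ext A[OF j] range[of "fst p"] range[of "Suc (fst p)"] step[OF j]
        by (auto simp: extends_increments_def)
    qed
    moreover have "AE \<omega> in M. \<omega> \<in> space M" by simp
    ultimately show "AE \<omega> in M. ennreal (norm (\<Sum>i<card I. b (\<mu> (R (f i)) \<omega>) (snd (f i))))
      = ennreal (norm (\<Sum>j<m. b (Y (t (Suc j)) \<omega> - Y (t j) \<omega>) (H j \<omega>)))"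
    proof eventually_elim
      case (elim \<omega>)
      let ?D = "\<lambda>j. Y (t (Suc j)) \<omega> - Y (t j) \<omega>"
      have "(\<Sum>i<card I. b (\<mu> (R (f i)) \<omega>) (snd (f i))) = (\<Sum>p\<in>I. b (\<mu> (R p) \<omega>) (snd p))"
        by (rule sum.reindex_bij_betw[OF f])
      also have "\<dots> = (\<Sum>p\<in>I. if H (fst p) \<omega> = snd p then b (?D (fst p)) (snd p) else 0)"
        using elim by (intro sum.cong) (auto simp: indicator_def bounded_bilinear.zero_left[OF b])
      also have "\<dots> = (\<Sum>j<m. \<Sum>y\<in>H j ` space M. if H j \<omega> = y then b (?D j) y else 0)"
        unfolding I_def using finH by (subst sum.Sigma) (auto simp: split_beta)
      also have "\<dots> = (\<Sum>j<m. b (?D j) (H j \<omega>))"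
        using finH elim by (intro sum.cong) auto
      finally show ?case by simp
    qed
  qed
  finally show ?thesis .
qed

text \<open>
Approximation by simple integrands and Fatou's lemma.
\<close>

lemma L1_norm_integral_le_semivariation:
  fixes Y :: "real \<Rightarrow> 'a \<Rightarrow> 'e::real_normed_vector"
    and b :: "'e \<Rightarrow> 'f::real_normed_vector \<Rightarrow> 'g::real_normed_vector"
  assumes filt: "usual_filtration M F T" and b: "bounded_bilinear b"
    and ext: "extends_increments M F T Y \<mu>" and Y: "adapted F T Y"
    and range: "\<And>j. j \<le> m \<Longrightarrow> t j \<in> {0..T}" and step: "\<And>j. j < m \<Longrightarrow> t j < t (Suc j)"
    and H: "\<And>j. j < m \<Longrightarrow> strongly_measurable (F (t j)) (H j)"
    and bound: "\<And>j \<omega>. j < m \<Longrightarrow> \<omega> \<in> space M \<Longrightarrow> norm (H j \<omega>) \<le> 1"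
  shows "L1_norm M (\<lambda>\<omega>. \<Sum>j<m. b (Y (t (Suc j)) \<omega> - Y (t j) \<omega>) (H j \<omega>))
    \<le> semivariation M (predictable_sets M F T) b \<mu>"
proof -
  interpret usual_filtration M F T by fact
  have sub: "subalgebra M (F (t j))" if "j \<le> m" for j
    using subalg range[OF that] by auto
  have "\<exists>s. j < m \<longrightarrow> (\<forall>i. simple_function (F (t j)) (s i)) \<and>
      (\<forall>x\<in>space M. (\<lambda>i::nat. s i x) \<longlonglongrightarrow> H j x)" for j
    using H[of j] sub[of j] by (auto simp: strongly_measurable_def subalgebra_def)
  then obtain s where s: "\<And>j i. j < m \<Longrightarrow> simple_function (F (t j)) (s j i)"
    "\<And>j x. j < m \<Longrightarrow> x \<in> space M \<Longrightarrow> (\<lambda>i::nat. s j i x) \<longlonglongrightarrow> H j x"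
    by metis
  \<comment> \<open>radial retraction to the unit ball, so that the approximating integrands obey the same bound\<close>
  define r where "r j i x = (1 / max 1 (norm (s j i x))) *\<^sub>R s j i x" for j i x
  have r_simple: "simple_function (F (t j)) (r j i)" if "j < m" for i j
    unfolding r_def by (rule simple_function_compose1[OF s(1)[OF that], of "\<lambda>y. (1 / max 1 (norm y)) *\<^sub>R y"])
  have r_bound: "norm (r j i x) \<le> 1" for j i x
    by (simp add: r_def field_simps)
  have r_lim: "(\<lambda>i. r j i x) \<longlonglongrightarrow> H j x" if "j < m" "x \<in> space M" for j x
  proof -
    have "(\<lambda>i. r j i x) \<longlonglongrightarrow> (1 / max 1 (norm (H j x))) *\<^sub>R H j x"
      unfolding r_def by (intro tendsto_intros s(2) that) auto
    then show ?thesis using bound[OF that] by (simp add: max_def split: if_splits)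
  qed
  have Ym: "strongly_measurable M (Y (t j))" if "j \<le> m" for j
    by (rule strongly_measurable_subalgebra[OF sub[OF that]])
       (use Y range[OF that] in \<open>auto simp: adapted_def\<close>)
  let ?S = "\<lambda>i \<omega>. \<Sum>j<m. b (Y (t (Suc j)) \<omega> - Y (t j) \<omega>) (r j i \<omega>)"
  let ?L = "\<lambda>\<omega>. \<Sum>j<m. b (Y (t (Suc j)) \<omega> - Y (t j) \<omega>) (H j \<omega>)"
  have meas: "(\<lambda>\<omega>. ennreal (norm (?S i \<omega>))) \<in> borel_measurable M" for i
  proof (intro measurable_compose[OF borel_measurable_norm_strongly_measurable measurable_ennreal]
      strongly_measurable_sum strongly_measurable_bilinear[OF _ _ b] strongly_measurable_diff Ym)
    fix j assume "j \<in> {..<m}"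
    then have j: "j < m" by simp
    show "strongly_measurable M (r j i)"
      by (rule strongly_measurable_subalgebra[OF sub strongly_measurable_simple[OF r_simple]]) (use j in auto)
  qed auto
  have lim: "(\<lambda>i. ennreal (norm (?S i \<omega>))) \<longlonglongrightarrow> ennreal (norm (?L \<omega>))" if "\<omega> \<in> space M" for \<omega>
  proof (intro tendsto_ennrealI tendsto_norm tendsto_sum)
    fix j assume "j \<in> {..<m}"
    then have "(\<lambda>i. r j i \<omega>) \<longlonglongrightarrow> H j \<omega>" using that by (intro r_lim) auto
    from bounded_bilinear.tendsto[OF b tendsto_const this]
    show "(\<lambda>i. b (Y (t (Suc j)) \<omega> - Y (t j) \<omega>) (r j i \<omega>)) \<longlonglongrightarrow>
      b (Y (t (Suc j)) \<omega> - Y (t j) \<omega>) (H j \<omega>)" .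
  qed
  have "L1_norm M ?L = (\<integral>\<^sup>+\<omega>. liminf (\<lambda>i. ennreal (norm (?S i \<omega>))) \<partial>M)"
    unfolding L1_norm_def
    by (intro nn_integral_cong lim_imp_Liminf[symmetric] lim) auto
  also have "\<dots> \<le> liminf (\<lambda>i. \<integral>\<^sup>+\<omega>. ennreal (norm (?S i \<omega>)) \<partial>M)"
    by (rule nn_integral_liminf) (rule meas)
  also have "\<dots> \<le> semivariation M (predictable_sets M F T) b \<mu>"
  proof (rule Liminf_le)
    have "L1_norm M (?S i) \<le> semivariation M (predictable_sets M F T) b \<mu>" for i
      by (rule L1_norm_simple_integral_le_semivariation[where H="\<lambda>j. r j i" and t=t, OF filt b ext])
         (erule range, erule step, erule r_simple, rule r_bound)
    then show "\<forall>\<^sub>F i in sequentially. (\<integral>\<^sup>+\<omega>. ennreal (norm (?S i \<omega>)) \<partial>M)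
        \<le> semivariation M (predictable_sets M F T) b \<mu>"
      by (simp add: L1_norm_def)
  qed simp
  finally show ?thesis .
qed

text \<open>
Let the integrand vanish from the first time on at which a partial sum exceeds \<open>\<delta>\<close>. The resulting sum is
an elementary integral of an integrand with the same bound, and its norm exceeds \<open>\<delta>\<close> on the event in
question. So the estimate follows from Markov's inequality and the \<open>L\<^sup>1\<close> bound.
\<close>

lemma maximal_inequality:
  fixes Y :: "real \<Rightarrow> 'a \<Rightarrow> 'e::real_normed_vector"
    and b :: "'e \<Rightarrow> 'f::real_normed_vector \<Rightarrow> 'g::real_normed_vector"
  assumes filt: "usual_filtration M F T" and b: "bounded_bilinear b"
    and ext: "extends_increments M F T Y \<mu>" and Y: "adapted F T Y"
    and C: "semivariation M (predictable_sets M F T) b \<mu> \<le> ennreal C" "0 \<le> C"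
    and range: "\<And>j. j \<le> m \<Longrightarrow> t j \<in> {0..T}" and step: "\<And>j. j < m \<Longrightarrow> t j < t (Suc j)"
    and H: "\<And>j. j < m \<Longrightarrow> strongly_measurable (F (t j)) (H j)"
    and bound: "\<And>j \<omega>. j < m \<Longrightarrow> \<omega> \<in> space M \<Longrightarrow> norm (H j \<omega>) \<le> w"
    and w: "0 < w" and \<delta>: "0 < \<delta>"
  shows "\<exists>E\<in>sets M. measure M E \<le> C * w / \<delta> \<and> (\<forall>\<omega>\<in>space M - E. \<forall>n\<le>m.
    norm (\<Sum>j<n. b (Y (t (Suc j)) \<omega> - Y (t j) \<omega>) (H j \<omega>)) \<le> \<delta>)"
proof -
  interpret usual_filtration M F T by fact
  define S where "S n \<omega> = (\<Sum>j<n. b (Y (t (Suc j)) \<omega> - Y (t j) \<omega>) (H j \<omega>))" for n \<omega>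
  have sub: "subalgebra (F (t j)) (F (t i))" if "i \<le> j" "j \<le> m" for i j
    using subalg[of "t i"] subalg[of "t j"] filtration_mono[of "t i" "t j"]
      range[of i] range[of j] that increasing_grid_mono[of m t i j] step
    by (auto simp: subalgebra_def)
  have subM: "subalgebra M (F (t j))" if "j \<le> m" for j
    using subalg range[OF that] by auto
  have Ym: "strongly_measurable (F (t j)) (Y (t i))" if "i \<le> j" "j \<le> m" for i j
    by (rule strongly_measurable_subalgebra[OF sub[OF that]])
       (use Y range[of i] that in \<open>auto simp: adapted_def\<close>)
  have Sm: "strongly_measurable (F (t j)) (S n)" if "n \<le> j" "j \<le> m" for n j
    unfolding S_def
  proof (intro strongly_measurable_sum strongly_measurable_bilinear[OF _ _ b] strongly_measurable_diff Ym)
    fix i assume "i \<in> {..<n}"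
    then show "strongly_measurable (F (t j)) (H i)"
      using that strongly_measurable_subalgebra[OF sub[of i j] H[of i]] by auto
  qed (use that in auto)
  let ?E = "{\<omega>\<in>space M. \<exists>n\<le>m. \<delta> < norm (S n \<omega>)}"
  \<comment> \<open>the event that the threshold has not been passed by time \<open>t j\<close>; it belongs to \<open>F (t j)\<close>\<close>
  define G where "G j = {\<omega>\<in>space M. \<forall>n\<le>j. norm (S n \<omega>) \<le> \<delta>}" for j
  have G: "G j \<in> sets (F (t j))" if "j \<le> m" for j
  proof -
    have "G j = {\<omega>\<in>space (F (t j)). \<forall>n\<in>{..j}. norm (S n \<omega>) \<le> \<delta>}"
      using subM[OF that] by (auto simp: G_def subalgebra_def)
    also have "\<dots> \<in> sets (F (t j))"
    proof (rule sets.sets_Collect_finite_All)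
      fix n assume "n \<in> {..j}"
      then have [measurable]: "(\<lambda>\<omega>. norm (S n \<omega>)) \<in> borel_measurable (F (t j))"
        using that by (intro borel_measurable_norm_strongly_measurable Sm) auto
      show "{\<omega>\<in>space (F (t j)). norm (S n \<omega>) \<le> \<delta>} \<in> sets (F (t j))" by measurable
    qed simp
    finally show ?thesis .
  qed
  have "?E = space M - G m" by (auto simp: G_def not_le)
  moreover have "G m \<in> sets M" using G[of m] subM[of m] by (auto simp: subalgebra_def)
  ultimately have E: "?E \<in> sets M" by auto
  define K where "K j \<omega> = (1 / w) *\<^sub>R (if \<omega> \<in> G j then H j \<omega> else 0)" for j \<omega>
  have K: "strongly_measurable (F (t j)) (K j)" if "j < m" for j
    unfolding K_def using that
    by (intro strongly_measurable_scaleR strongly_measurable_if H G) auto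
  have Kb: "norm (K j \<omega>) \<le> 1" if "j < m" "\<omega> \<in> space M" for j \<omega>
    using bound[OF that] w by (auto simp: K_def)
  let ?Z = "\<lambda>\<omega>. \<Sum>j<m. b (Y (t (Suc j)) \<omega> - Y (t j) \<omega>) (K j \<omega>)"
  have stop: "\<delta> / w \<le> norm (?Z \<omega>)" if \<omega>: "\<omega> \<in> ?E" for \<omega>
  proof -
    let ?P = "\<lambda>n. n \<le> m \<and> \<delta> < norm (S n \<omega>)"
    define n where "n = (LEAST n. ?P n)"
    have "\<exists>n. ?P n" using \<omega> by auto
    then have n: "n \<le> m" "\<delta> < norm (S n \<omega>)" using LeastI_ex[of ?P] by (auto simp: n_def)
    have le: "norm (S i \<omega>) \<le> \<delta>" if "i < n" for i
      using not_less_Least[of i ?P] that n(1) by (force simp: n_def)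
    have "\<omega> \<in> G j \<longleftrightarrow> j < n" for j
    proof (cases "j < n")
      case False
      then have "\<not> (\<forall>n\<le>j. norm (S n \<omega>) \<le> \<delta>)" using n(2) by (auto simp: not_le intro!: exI[of _ n])
      with False show ?thesis by (simp add: G_def)
    qed (use le \<omega> in \<open>auto simp: G_def\<close>)
    then have "?Z \<omega> = (\<Sum>j<m. if j < n then (1 / w) *\<^sub>R b (Y (t (Suc j)) \<omega> - Y (t j) \<omega>) (H j \<omega>) else 0)"
      by (intro sum.cong)
        (auto simp: K_def bounded_bilinear.zero_right[OF b] bounded_bilinear.scaleR_right[OF b])
    also have "\<dots> = (\<Sum>j\<in>{..<m} \<inter> {..<n}. (1 / w) *\<^sub>R b (Y (t (Suc j)) \<omega> - Y (t j) \<omega>) (H j \<omega>))"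
      by (subst sum.inter_restrict) auto
    also have "{..<m} \<inter> {..<n} = {..<n}" using n(1) by auto
    finally have "?Z \<omega> = (1 / w) *\<^sub>R S n \<omega>" by (simp add: S_def scaleR_sum_right)
    then show ?thesis using n(2) w by (simp add: field_simps)
  qed
  have "ennreal (\<delta> / w * measure M ?E) = ennreal (\<delta> / w) * emeasure M ?E"
    using w \<delta> by (subst ennreal_mult) (simp_all add: emeasure_eq_measure)
  also have "\<dots> = (\<integral>\<^sup>+\<omega>. ennreal (\<delta> / w) * indicator ?E \<omega> \<partial>M)"
    using E by (rule nn_integral_cmult_indicator[symmetric])
  also have "\<dots> \<le> L1_norm M ?Z"
    unfolding L1_norm_def
  proof (rule nn_integral_mono)
    fix \<omega> assume "\<omega> \<in> space M"
    show "ennreal (\<delta> / w) * indicator ?E \<omega> \<le> ennreal (norm (?Z \<omega>))"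
    proof (cases "\<omega> \<in> ?E")
      case True
      with stop[OF True] show ?thesis by (simp only: indicator_simps mult_1_right ennreal_leI)
    qed (simp only: indicator_simps mult_zero_right zero_le simp_thms)
  qed
  also have "\<dots> \<le> semivariation M (predictable_sets M F T) b \<mu>"
    by (rule L1_norm_integral_le_semivariation[where H=K and t=t, OF filt b ext Y])
       (erule range, erule step, erule K, erule (1) Kb)
  also note C(1)
  finally have "\<delta> / w * measure M ?E \<le> C" using C(2) by simp
  then have "measure M ?E \<le> C * w / \<delta>" using w \<delta> by (simp add: field_simps)
  moreover have "\<forall>\<omega>\<in>space M - ?E. \<forall>n\<le>m. norm (S n \<omega>) \<le> \<delta>" by (auto simp: not_less)
  ultimately show ?thesis unfolding S_def[symmetric] using E by blast
qed

section \<open>Discrete quadratic variations of a sequence\<close>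

lemma norm_ptensor_le: "norm (a \<otimes>\<^sub>\<pi> d) \<le> norm a * norm d"
  by (simp add: ptensor_def norm_proj_embed proj_norm_elem)

text \<open>
Truncated subtraction extends the sequence by \<open>x 0\<close> to negative indices. Since \<open>x 0 = 0\<close>, the windows that
reach beyond the start of the sequence need no correction term.
\<close>

lemma sum_truncated_window:
  fixes x :: "nat \<Rightarrow> 'b::real_vector"
  assumes "x 0 = 0" "j < m"
  shows "(\<Sum>k<m. if k \<le> j \<and> j < k + N then x k else 0) = (\<Sum>i<N. x (j - i))"
proof -
  have "(\<Sum>i<N. x (j - i)) = (\<Sum>i\<in>{i. i < N \<and> i \<le> j}. x (j - i))"
  proof (rule sum.mono_neutral_right)
    show "\<forall>i\<in>{..<N} - {i. i < N \<and> i \<le> j}. x (j - i) = 0"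
    proof
      fix i assume "i \<in> {..<N} - {i. i < N \<and> i \<le> j}"
      then have "j - i = 0" by auto
      then show "x (j - i) = 0" using assms(1) by (simp only:)
    qed
  qed auto
  also have "\<dots> = (\<Sum>k\<in>{k. k < m \<and> k \<le> j \<and> j < k + N}. x k)"
    by (rule sum.reindex_bij_witness[of _ "\<lambda>k. j - k" "\<lambda>i. j - i"]) (use assms(2) in auto)
  also have "\<dots> = (\<Sum>k<m. if k \<le> j \<and> j < k + N then x k else 0)"
    by (rule sum.mono_neutral_cong_left) auto
  finally show ?thesis by simp
qed

text \<open>
Write \<open>x (k + N) - x k\<close> as a sum of increments and exchange the order of summation: the increment at \<open>j\<close> is
paired with the average \<open>g j\<close> of the preceding values. Only the increments from index \<open>m\<close> on are left
over; they occur for at most \<open>N\<close> values of \<open>k\<close>, which the factor \<open>1 / N\<close> compensates.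
\<close>

lemma norm_forward_sum_diff_le:
  fixes x :: "nat \<Rightarrow> 'b::real_normed_vector" and b :: "'b \<Rightarrow> 'b \<Rightarrow> 'g::real_normed_vector"
  assumes b: "bounded_bilinear b" and b1: "\<And>a c. norm (b a c) \<le> norm a * norm c"
    and N: "1 \<le> N" and x0: "x 0 = 0"
    and w: "\<And>k i. i \<le> N \<Longrightarrow> norm (x (k + i) - x k) \<le> w" and c: "\<And>k. norm (x k) \<le> c"
  defines "g \<equiv> \<lambda>j. (1 / real N) *\<^sub>R (\<Sum>i<N. x (j - i))"
  shows "norm ((1 / real N) *\<^sub>R (\<Sum>k<m. b (x (k + N) - x k) (x k))
    - (\<Sum>j<m. b (x (Suc j) - x j) (g j))) \<le> w * c"
proof -
  interpret b: bounded_bilinear b by fact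
  have w0: "0 \<le> w" using w[of 0 0] by simp
  have c0: "0 \<le> c" using c[of 0] by (rule order_trans[OF norm_ge_zero])
  let ?D = "\<lambda>j. x (Suc j) - x j"
  define r where "r k = x (k + N) - x (min (k + N) m)" for k
  have split: "x (k + N) - x k = (\<Sum>j<m. if k \<le> j \<and> j < k + N then ?D j else 0) + r k" if "k < m" for k
  proof -
    have "(\<Sum>j<m. if k \<le> j \<and> j < k + N then ?D j else 0) = (\<Sum>j=k..<min (k + N) m. ?D j)"
      using that by (intro sum.mono_neutral_cong_right) auto
    also have "\<dots> = x (min (k + N) m) - x k"
      using that by (intro sum_Suc_diff') auto
    finally show ?thesis by (simp add: r_def)
  qed
  have "(\<Sum>k<m. b (x (k + N) - x k) (x k))
      = (\<Sum>k<m. (\<Sum>j<m. if k \<le> j \<and> j < k + N then b (?D j) (x k) else 0) + b (r k) (x k))"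
  \<comment> \<open>the short name \<open>refl\<close> denotes a rule of \<open>tensor_eq\<close>\<close>
  proof (rule sum.cong[OF HOL.refl])
    fix k assume "k \<in> {..<m}"
    then have "b (x (k + N) - x k) (x k)
      = b ((\<Sum>j<m. if k \<le> j \<and> j < k + N then ?D j else 0) + r k) (x k)"
      by (simp only: split lessThan_iff)
    also have "\<dots> = (\<Sum>j<m. b (if k \<le> j \<and> j < k + N then ?D j else 0) (x k)) + b (r k) (x k)"
      by (simp only: b.add_left b.sum_left)
    finally show "b (x (k + N) - x k) (x k)
      = (\<Sum>j<m. if k \<le> j \<and> j < k + N then b (?D j) (x k) else 0) + b (r k) (x k)"
      by (simp only: if_distrib[of "\<lambda>d. b d (x k)"] b.zero_left)
  qed
  also have "\<dots> = (\<Sum>j<m. \<Sum>k<m. if k \<le> j \<and> j < k + N then b (?D j) (x k) else 0) + (\<Sum>k<m. b (r k) (x k))"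
    by (simp only: sum.distrib) (subst sum.swap, rule HOL.refl)
  also have "(\<Sum>j<m. \<Sum>k<m. if k \<le> j \<and> j < k + N then b (?D j) (x k) else 0)
      = (\<Sum>j<m. b (?D j) (\<Sum>i<N. x (j - i)))"
  proof (rule sum.cong[OF HOL.refl])
    fix j assume "j \<in> {..<m}"
    then have "b (?D j) (\<Sum>i<N. x (j - i)) = b (?D j) (\<Sum>k<m. if k \<le> j \<and> j < k + N then x k else 0)"
      using sum_truncated_window[where x=x and j=j and m=m and N=N] x0 by simp
    then show "(\<Sum>k<m. if k \<le> j \<and> j < k + N then b (?D j) (x k) else 0) = b (?D j) (\<Sum>i<N. x (j - i))"
      by (simp only: b.sum_right if_distrib[of "b (?D j)"] b.zero_right)
  qed
  finally have "(1 / real N) *\<^sub>R (\<Sum>k<m. b (x (k + N) - x k) (x k)) - (\<Sum>j<m. b (?D j) (g j))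
      = (1 / real N) *\<^sub>R (\<Sum>k<m. b (r k) (x k))"
    by (simp add: g_def b.scaleR_right scaleR_add_right flip: scaleR_sum_right)
  then have le: "norm ((1 / real N) *\<^sub>R (\<Sum>k<m. b (x (k + N) - x k) (x k)) - (\<Sum>j<m. b (?D j) (g j)))
      \<le> (1 / real N) * (\<Sum>k<m. norm (b (r k) (x k)))"
    by (simp add: divide_right_mono norm_sum)
  have "(\<Sum>k<m. norm (b (r k) (x k))) = (\<Sum>k\<in>{m - N..<m}. norm (b (r k) (x k)))"
  proof (rule sum.mono_neutral_right)
    show "\<forall>k\<in>{..<m} - {m - N..<m}. norm (b (r k) (x k)) = 0"
    proof
      fix k assume "k \<in> {..<m} - {m - N..<m}"
      then have "k + N \<le> m" by auto
      then show "norm (b (r k) (x k)) = 0" by (simp add: r_def b.zero_left)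
    qed
  qed auto
  also have "(\<Sum>k\<in>{m - N..<m}. norm (b (r k) (x k))) \<le> real (card {m - N..<m}) * (w * c)"
  proof (rule sum_bounded_above)
    fix k assume k: "k \<in> {m - N..<m}"
    have "norm (r k) \<le> w"
      using w[of "k + N - m" m] k by (simp add: r_def min_def) (use w0 in auto)
    then have "norm (r k) * norm (x k) \<le> w * c" using c w0 by (intro mult_mono) auto
    then show "norm (b (r k) (x k)) \<le> w * c" using b1 order_trans by blast
  qed
  also have "\<dots> \<le> real N * (w * c)"
    using w0 c0 by (intro mult_right_mono) auto
  finally have "(\<Sum>k<m. norm (b (r k) (x k))) \<le> real N * (w * c)" .
  then have "(1 / real N) * (\<Sum>k<m. norm (b (r k) (x k))) \<le> (1 / real N) * (real N * (w * c))"
    by (intro mult_left_mono) auto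
  with le show ?thesis using N by simp
qed

lemma sum_shifted_differences:
  fixes z :: "nat \<Rightarrow> 'b::ab_group_add"
  shows "(\<Sum>k<m. z (k + N) - z k) = (\<Sum>i<N. z (m + i) - z i)"
proof (induction m)
  case (Suc m)
  have "(\<Sum>i<N. z (Suc m + i) - z i) = (\<Sum>i<N. (z (Suc (m + i)) - z (m + i)) + (z (m + i) - z i))"
    by (intro sum.cong) auto
  also have "\<dots> = (z (m + N) - z m) + (\<Sum>i<N. z (m + i) - z i)"
    using sum_lessThan_telescope[of "\<lambda>i. z (m + i)" N] by (simp only: sum.distrib) simp
  finally show ?case using Suc by (simp add: add.commute)
qed simp

text \<open>
Both quadratic variations are reduced to forward sums by
\<open>(u - v) \<otimes> (u - v) = (u \<otimes> u - v \<otimes> v) - (u - v) \<otimes> v - v \<otimes> (u - v)\<close>. The differences of the squares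
telescope, and \<open>norm_forward_sum_diff_le\<close> compares the forward sums, once for each order of the factors.
\<close>

lemma norm_discrete_quadratic_variation_diff_le:
  fixes x :: "nat \<Rightarrow> 'b::real_normed_vector"
  assumes N: "1 \<le> N" and x0: "x 0 = 0"
    and w: "\<And>k i. i \<le> N \<Longrightarrow> norm (x (k + i) - x k) \<le> w" and c: "\<And>k. norm (x k) \<le> c"
  defines "g \<equiv> \<lambda>j. (1 / real N) *\<^sub>R (\<Sum>i<N. x (j - i))"
  shows "norm ((1 / real N) *\<^sub>R (\<Sum>k<m. (x (k + N) - x k) \<otimes>\<^sub>\<pi> (x (k + N) - x k))
      - (\<Sum>j<m. (x (Suc j) - x j) \<otimes>\<^sub>\<pi> (x (Suc j) - x j)))
    \<le> 6 * w * c + norm (\<Sum>j<m. (x (Suc j) - x j) \<otimes>\<^sub>\<pi> (g j - x j))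
      + norm (\<Sum>j<m. (g j - x j) \<otimes>\<^sub>\<pi> (x (Suc j) - x j))"
proof -
  interpret p: bounded_bilinear "(\<otimes>\<^sub>\<pi>) :: 'b \<Rightarrow> 'b \<Rightarrow> _" by (rule bounded_bilinear_ptensor)
  have w0: "0 \<le> w" using w[of 0 0] by simp
  define z where "z k = x k \<otimes>\<^sub>\<pi> x k" for k
  let ?D = "\<lambda>j. x (Suc j) - x j" and ?I = "\<lambda>k. x (k + N) - x k"
  have sq: "(u - v) \<otimes>\<^sub>\<pi> (u - v) = (u \<otimes>\<^sub>\<pi> u - v \<otimes>\<^sub>\<pi> v) - (u - v) \<otimes>\<^sub>\<pi> v - v \<otimes>\<^sub>\<pi> (u - v)" for u v :: 'b
    by (simp add: p.diff_left p.diff_right)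
  have osc_z: "norm (z (k + i) - z k) \<le> 2 * w * c" if "i \<le> N" for k i
  proof -
    have "z (k + i) - z k = (x (k + i) - x k) \<otimes>\<^sub>\<pi> x (k + i) + x k \<otimes>\<^sub>\<pi> (x (k + i) - x k)"
      by (simp add: z_def p.diff_left p.diff_right)
    also have "norm \<dots> \<le> norm (x (k + i) - x k) * norm (x (k + i)) + norm (x k) * norm (x (k + i) - x k)"
      by (intro norm_triangle_le add_mono norm_ptensor_le)
    also have "\<dots> \<le> w * c + c * w"
      using w[OF that] c w0 order_trans[OF norm_ge_zero c]
      by (intro add_mono mult_mono) auto
    finally show ?thesis by (simp add: ac_simps)
  qed
  define A where "A = (1 / real N) *\<^sub>R (\<Sum>k<m. z (k + N) - z k)"
  have A: "norm (A - (z m - z 0)) \<le> 4 * w * c"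
  proof -
    have "A - (z m - z 0) = (1 / real N) *\<^sub>R (\<Sum>i<N. (z (m + i) - z m) - (z (0 + i) - z 0))"
    proof -
      have "(\<Sum>i<N. (z (m + i) - z m) - (z (0 + i) - z 0)) = (\<Sum>i<N. (z (m + i) - z i) - (z m - z 0))"
        by (intro sum.cong) (auto simp: algebra_simps)
      also have "\<dots> = (\<Sum>i<N. z (m + i) - z i) - real N *\<^sub>R (z m - z 0)"
        by (simp only: sum_subtractf sum_constant_scaleR card_lessThan scaleR_diff_right)
      finally show ?thesis
        unfolding A_def sum_shifted_differences using N by (simp add: scaleR_diff_right)
    qed
    also have "norm \<dots> \<le> (1 / real N) * (\<Sum>i<N. norm ((z (m + i) - z m) - (z (0 + i) - z 0)))"
      by (simp add: divide_right_mono norm_sum)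
    also have "\<dots> \<le> (1 / real N) * (real (card {..<N}) * (2 * w * c + 2 * w * c))"
      by (intro mult_left_mono sum_bounded_above order_trans[OF norm_triangle_ineq4] add_mono osc_z) auto
    also have "\<dots> = 4 * w * c" using N by simp
    finally show ?thesis .
  qed
  have Q: "(\<Sum>j<m. ?D j \<otimes>\<^sub>\<pi> ?D j) = (z m - z 0) - (\<Sum>j<m. ?D j \<otimes>\<^sub>\<pi> x j) - (\<Sum>j<m. x j \<otimes>\<^sub>\<pi> ?D j)"
    unfolding sq[of "x (Suc _)" "x _"]
    using sum_lessThan_telescope[of z m] by (simp add: z_def sum_subtractf)
  define S1 where "S1 = (1 / real N) *\<^sub>R (\<Sum>k<m. ?I k \<otimes>\<^sub>\<pi> x k)"
  define S2 where "S2 = (1 / real N) *\<^sub>R (\<Sum>k<m. x k \<otimes>\<^sub>\<pi> ?I k)"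
  have R: "(1 / real N) *\<^sub>R (\<Sum>k<m. ?I k \<otimes>\<^sub>\<pi> ?I k) = A - S1 - S2"
    unfolding sq[of "x (_ + N)" "x _"]
    by (simp only: A_def S1_def S2_def z_def sum_subtractf scaleR_diff_right)
  have S1: "norm (S1 - (\<Sum>j<m. ?D j \<otimes>\<^sub>\<pi> g j)) \<le> w * c"
    unfolding S1_def g_def
    by (rule norm_forward_sum_diff_le[where b="(\<otimes>\<^sub>\<pi>)"]) (use N in \<open>auto intro: bounded_bilinear_ptensor norm_ptensor_le x0 w c\<close>)
  have S2: "norm (S2 - (\<Sum>j<m. g j \<otimes>\<^sub>\<pi> ?D j)) \<le> w * c"
    unfolding S2_def g_def
    by (rule norm_forward_sum_diff_le[where b="\<lambda>a d. d \<otimes>\<^sub>\<pi> a"])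
       (use N in \<open>auto intro: p.flip x0 w c order_trans[OF norm_ptensor_le] simp: mult.commute\<close>)
  have E1: "(\<Sum>j<m. ?D j \<otimes>\<^sub>\<pi> (g j - x j)) = (\<Sum>j<m. ?D j \<otimes>\<^sub>\<pi> g j) - (\<Sum>j<m. ?D j \<otimes>\<^sub>\<pi> x j)"
    by (simp only: p.diff_right sum_subtractf)
  have E2: "(\<Sum>j<m. (g j - x j) \<otimes>\<^sub>\<pi> ?D j) = (\<Sum>j<m. g j \<otimes>\<^sub>\<pi> ?D j) - (\<Sum>j<m. x j \<otimes>\<^sub>\<pi> ?D j)"
    by (simp only: p.diff_left sum_subtractf)
  let ?a = "A - (z m - z 0)" and ?s1 = "S1 - (\<Sum>j<m. ?D j \<otimes>\<^sub>\<pi> g j)" and ?s2 = "S2 - (\<Sum>j<m. g j \<otimes>\<^sub>\<pi> ?D j)"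
    and ?e1 = "\<Sum>j<m. ?D j \<otimes>\<^sub>\<pi> (g j - x j)" and ?e2 = "\<Sum>j<m. (g j - x j) \<otimes>\<^sub>\<pi> ?D j"
  have "(1 / real N) *\<^sub>R (\<Sum>k<m. ?I k \<otimes>\<^sub>\<pi> ?I k) - (\<Sum>j<m. ?D j \<otimes>\<^sub>\<pi> ?D j) = ?a - ?s1 - ?s2 - ?e1 - ?e2"
    unfolding R Q E1 E2 by simp
  moreover have "norm (?a - ?s1 - ?s2 - ?e1 - ?e2) \<le> norm ?a + norm ?s1 + norm ?s2 + norm ?e1 + norm ?e2"
    by (intro order_trans[OF norm_triangle_ineq4] add_mono order_refl)
  ultimately show ?thesis using A S1 S2 by simp
qed

section \<open>Stochastic sums along dyadic grids\<close>

definition dyadic :: "real \<Rightarrow> nat \<Rightarrow> nat \<Rightarrow> real" where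
  "dyadic T M k = T * real k / 2 ^ M"

text \<open>
Continuity from above of the probability, in the form in which it supplies the constants of the
estimates: a level, a modulus of continuity or a localising stopping time.
\<close>

lemma (in prob_space) decreasing_events_small:
  assumes A: "\<And>n::nat. A n \<in> events" "decseq A" and null: "AE \<omega> in M. \<exists>n. \<omega> \<notin> A n"
    and \<eta>: "0 < \<eta>"
  shows "\<exists>n. prob (A n) \<le> \<eta>"
proof -
  have "(\<Inter>n. A n) \<in> null_sets M"
  proof -
    have "AE \<omega> in M. \<omega> \<notin> (\<Inter>n. A n)" using null by eventually_elim auto
    then show ?thesis using A(1) by (subst AE_iff_null_sets) auto
  qed
  then have "prob (\<Inter>n. A n) = 0" by (simp add: measure_eq_0_null_sets)
  moreover have "(\<lambda>n. prob (A n)) \<longlonglongrightarrow> prob (\<Inter>n. A n)"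
    using A by (intro finite_Lim_measure_decseq) auto
  ultimately have "(\<lambda>n. prob (A n)) \<longlonglongrightarrow> 0" by simp
  then have "\<forall>\<^sub>F n in sequentially. prob (A n) < \<eta>" using \<eta> by (rule order_tendstoD)
  then show ?thesis by (auto simp: eventually_sequentially intro: less_imp_le)
qed

lemma (in prob_space) eventually_avoided_events_small:
  assumes A: "\<And>n::nat. A n \<in> events" and ev: "AE \<omega> in M. \<forall>\<^sub>F n in sequentially. \<omega> \<notin> A n"
    and \<eta>: "0 < \<eta>"
  shows "\<exists>n. prob (A n) \<le> \<eta>"
proof -
  have "\<exists>n. prob (\<Union>i\<in>{n..}. A i) \<le> \<eta>"
  proof (rule decreasing_events_small)
    show "decseq (\<lambda>n. \<Union>i\<in>{n..}. A i)" by (rule decseq_SucI) (auto intro: Suc_leD)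
    show "AE \<omega> in M. \<exists>n. \<omega> \<notin> (\<Union>i\<in>{n..}. A i)"
      using ev by eventually_elim (auto simp: eventually_sequentially)
  qed (use A \<eta> in auto)
  then obtain n where n: "prob (\<Union>i\<in>{n..}. A i) \<le> \<eta>" by blast
  have "prob (A n) \<le> prob (\<Union>i\<in>{n..}. A i)"
    using A by (intro finite_measure_mono) auto
  with n show ?thesis by (intro exI[of _ n]) simp
qed

context usual_filtration
begin

lemma dyadic_in_range: "k \<le> 2 ^ m \<Longrightarrow> dyadic T m k \<in> {0..T}"
  using T_pos of_nat_mono[of k "2 ^ m", where 'a=real]
  by (auto simp: dyadic_def field_simps)

lemma dyadic_less: "dyadic T m k < dyadic T m (Suc k)"
  using T_pos by (simp add: dyadic_def divide_strict_right_mono)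

lemma strongly_measurable_adapted:
  "adapted F T X \<Longrightarrow> t \<in> {0..T} \<Longrightarrow> strongly_measurable M (X t)"
  by (rule strongly_measurable_subalgebra[OF subalg]) (auto simp: adapted_def)

lemma strongly_measurable_adapted_later:
  assumes "adapted F T X" "0 \<le> s" "s \<le> t" "t \<le> T"
  shows "strongly_measurable (F t) (X s)"
proof (rule strongly_measurable_subalgebra)
  show "subalgebra (F t) (F s)"
    using subalg[of s] subalg[of t] filtration_mono[of s t] assms by (auto simp: subalgebra_def)
qed (use assms in \<open>auto simp: adapted_def\<close>)

lemma stopping_time_early_event:
  assumes "stopping_time_upto F T \<tau>"
  shows "{\<omega>\<in>space M. \<tau> \<omega> \<le> ennreal T} \<in> events"
proof -
  have "Measurable.pred (F (enn2real (min (ennreal T) (ennreal T)))) (\<lambda>\<omega>. \<tau> \<omega> \<le> ennreal T)"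
    using assms unfolding stopping_time_upto_def by (rule stopping_timeD)
  then have "{\<omega>\<in>space (F T). \<tau> \<omega> \<le> ennreal T} \<in> sets (F T)"
    using T_pos by (simp add: pred_def)
  then show ?thesis using subalg[of T] T_pos by (auto simp: subalgebra_def)
qed

lemma stopped_eq:
  assumes "\<not> \<tau> \<omega> \<le> ennreal T" "t \<in> {0..T}"
  shows "stopped \<tau> Y t \<omega> = Y t \<omega>"
proof -
  have "ennreal t \<le> ennreal T" using assms(2) by (intro ennreal_leI) auto
  then have "min (ennreal t) (\<tau> \<omega>) = ennreal t" using assms(1) by (auto simp: min_def)
  then show ?thesis using assms(2) by (simp add: stopped_def)
qed

text \<open>
The bound \<open>w\<close> on the integrands must not depend on the grid. It is chosen after a stopping time \<open>\<tau> k\<close> that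
exceeds \<open>T\<close> except on a small event, which fixes the semivariation \<open>C\<close> of the stopped process, and after
a bound for the total variation of the bounded variation part that fails only on a small event.
\<close>

lemma semilocally_summable_integral_small:
  fixes X :: "real \<Rightarrow> 'a \<Rightarrow> 'e::real_normed_vector"
    and b :: "'e \<Rightarrow> 'f::real_normed_vector \<Rightarrow> 'g::real_normed_vector"
  assumes b: "bounded_bilinear b" and b1: "\<And>x y. norm (b x y) \<le> norm x * norm y"
    and X: "semilocally_summable M F T b X" and \<delta>: "0 < \<delta>" and \<eta>: "0 < \<eta>"
  shows "\<exists>w>0. \<forall>m H. (\<forall>j<2 ^ m. strongly_measurable (F (dyadic T m j)) (H j)) \<longrightarrow>
    (\<exists>E\<in>events. prob E \<le> \<eta> \<and> (\<forall>\<omega>\<in>space M - E. (\<forall>j<2 ^ m. norm (H j \<omega>) \<le> w) \<longrightarrow>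
      (\<forall>n\<le>2 ^ m. norm (\<Sum>j<n. b (X (dyadic T m (Suc j)) \<omega> - X (dyadic T m j) \<omega>) (H j \<omega>)) \<le> \<delta>)))"
proof -
  interpret b: bounded_bilinear b by fact
  obtain Y V where Y: "locally_summable M F T b Y" and V: "adapted F T V"
    and bv: "\<And>\<omega>. \<omega> \<in> space M \<Longrightarrow> bounded_variation_on_interval T (\<lambda>t. V t \<omega>)"
    and XYV: "\<And>t \<omega>. t \<in> {0..T} \<Longrightarrow> \<omega> \<in> space M \<Longrightarrow> X t \<omega> = Y t \<omega> + V t \<omega>"
    using X unfolding semilocally_summable_def by blast
  obtain \<tau> :: "nat \<Rightarrow> 'a \<Rightarrow> ennreal" where \<tau>: "\<And>k. stopping_time_upto F T (\<tau> k)"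
    and lim: "AE \<omega> in M. (\<lambda>k. \<tau> k \<omega>) \<longlonglongrightarrow> \<infinity>"
    and sum: "\<And>k. summable_process M F T b (stopped (\<tau> k) Y)"
    using Y unfolding locally_summable_def by (auto elim: eventually_mono)
  have \<eta>3: "0 < \<eta> / 3" using \<eta> by simp
  have "\<exists>k. prob {\<omega>\<in>space M. \<tau> k \<omega> \<le> ennreal T} \<le> \<eta> / 3"
  proof (rule eventually_avoided_events_small[OF stopping_time_early_event[OF \<tau>] _ \<eta>3])
    show "AE \<omega> in M. \<forall>\<^sub>F k in sequentially. \<omega> \<notin> {\<omega>\<in>space M. \<tau> k \<omega> \<le> ennreal T}"
      using lim
    proof eventually_elim
      case (elim \<omega>)
      then have "\<forall>\<^sub>F k in sequentially. ennreal T < \<tau> k \<omega>" by (rule order_tendstoD) simp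
      then show ?case by eventually_elim auto
    qed
  qed
  then obtain k where k: "prob {\<omega>\<in>space M. \<tau> k \<omega> \<le> ennreal T} \<le> \<eta> / 3" by blast
  let ?Z = "stopped (\<tau> k) Y" and ?E1 = "{\<omega>\<in>space M. \<tau> k \<omega> \<le> ennreal T}"
  obtain \<mu> where Z: "adapted F T ?Z" and ext: "extends_increments M F T ?Z \<mu>"
    and sv: "semivariation M (predictable_sets M F T) b \<mu> < \<infinity>"
    using sum[of k] unfolding summable_process_def by blast
  define C where "C = enn2real (semivariation M (predictable_sets M F T) b \<mu>)"
  have C: "semivariation M (predictable_sets M F T) b \<mu> \<le> ennreal C" "0 \<le> C"
    using sv by (auto simp: C_def)
  define var where "var m \<omega> = (\<Sum>j<2 ^ m. norm (V (dyadic T m (Suc j)) \<omega> - V (dyadic T m j) \<omega>))" for m \<omega>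
  let ?B = "\<lambda>a. {\<omega>\<in>space M. \<exists>m. a < var m \<omega>}"
  have B: "?B a \<in> events" for a
  proof -
    have [measurable]: "var m \<in> borel_measurable M" for m
      unfolding var_def
      by (intro borel_measurable_sum borel_measurable_norm_strongly_measurable strongly_measurable_diff
          strongly_measurable_adapted[OF V] dyadic_in_range) auto
    show ?thesis by measurable
  qed
  have "\<exists>n. prob (?B (real n)) \<le> \<eta> / 3"
  proof (rule decreasing_events_small[OF B _ _ \<eta>3])
    show "decseq (\<lambda>n. ?B (real n))" 
      by (rule decseq_SucI, clarsimp) (rule exI, erule less_trans[rotated], simp)
    show "AE \<omega> in M. \<exists>n. \<omega> \<notin> ?B (real n)"
    proof (rule AE_I2)
      fix \<omega> assume "\<omega> \<in> space M"
      from bv[OF this] obtain c where c: "\<And>n p. (\<forall>i\<le>n. p i \<in> {0..T}) \<and> (\<forall>i<n. p i \<le> p (Suc i)) \<Longrightarrow>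
          (\<Sum>i<n. norm (V (p (Suc i)) \<omega> - V (p i) \<omega>)) \<le> c"
        unfolding bounded_variation_on_interval_def by blast
      have "var m \<omega> \<le> c" for m
        unfolding var_def by (rule c) (auto simp: dyadic_in_range less_imp_le[OF dyadic_less] simp del: atLeastAtMost_iff)
      moreover obtain n where "c \<le> real n" using real_arch_simple by blast
      ultimately show "\<exists>n. \<omega> \<notin> ?B (real n)"
        by (intro exI[of _ n]) (auto simp: not_less intro: order_trans)
    qed
  qed
  then obtain n0 where n0: "prob (?B (real n0)) \<le> \<eta> / 3" by blast
  \<comment> \<open>the first bound makes the maximal inequality at level \<open>\<delta> / 2\<close> give probability at most \<open>\<eta> / 3\<close>,
    the second one makes the bounded variation part contribute at most \<open>\<delta> / 2\<close>\<close>
  define w where "w = min (\<delta> * \<eta> / (6 * (C + 1))) (\<delta> / (2 * (real n0 + 1)))"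
  have w: "0 < w" using \<delta> \<eta> C(2) by (simp add: w_def)
  have wC: "C * w / (\<delta> / 2) \<le> \<eta> / 3"
  proof -
    have "C * w \<le> (C + 1) * (\<delta> * \<eta> / (6 * (C + 1)))"
      using C(2) w by (intro mult_mono) (auto simp: w_def)
    also have "\<dots> = \<delta> * \<eta> / 6" using C(2) by (simp add: field_simps)
    finally show ?thesis using \<delta> by (simp add: field_simps)
  qed
  have wn: "real n0 * w \<le> \<delta> / 2"
  proof -
    have "real n0 * w \<le> (real n0 + 1) * (\<delta> / (2 * (real n0 + 1)))"
      using w by (intro mult_mono) (auto simp: w_def)
    also have "\<dots> = \<delta> / 2" by (simp add: field_simps)
    finally show ?thesis .
  qed
  show ?thesis
  proof (intro exI[of _ w] conjI w allI impI)
    fix m and H :: "nat \<Rightarrow> 'a \<Rightarrow> 'f"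
    assume H: "\<forall>j<2 ^ m. strongly_measurable (F (dyadic T m j)) (H j)"
    let ?t = "dyadic T m"
    \<comment> \<open>\<open>H\<close> is bounded by \<open>w\<close> only for some \<open>\<omega>\<close>; cutting off where the bound fails keeps it adapted and changes nothing
      for the \<open>\<omega>\<close> of interest\<close>
    define K where "K j \<omega> = (if \<omega> \<in> {\<omega>\<in>space M. norm (H j \<omega>) \<le> w} then H j \<omega> else 0)" for j \<omega>
    have K: "strongly_measurable (F (?t j)) (K j)" if j: "j < 2 ^ m" for j
    proof -
      have [measurable]: "(\<lambda>\<omega>. norm (H j \<omega>)) \<in> borel_measurable (F (?t j))"
        using H j by (intro borel_measurable_norm_strongly_measurable) auto
      have "space (F (?t j)) = space M"
        using subalg dyadic_in_range[of j m] j by (auto simp: subalgebra_def)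
      moreover have "{\<omega>\<in>space (F (?t j)). norm (H j \<omega>) \<le> w} \<in> sets (F (?t j))" by measurable
      ultimately show ?thesis
        unfolding K_def using H j by (intro strongly_measurable_if) auto
    qed
    have Kw: "norm (K j \<omega>) \<le> w" for j \<omega> using w by (auto simp: K_def)
    have "\<exists>E\<in>events. prob E \<le> C * w / (\<delta> / 2) \<and> (\<forall>\<omega>\<in>space M - E. \<forall>n\<le>2 ^ m.
        norm (\<Sum>j<n. b (?Z (?t (Suc j)) \<omega> - ?Z (?t j) \<omega>) (K j \<omega>)) \<le> \<delta> / 2)"
      by (rule maximal_inequality[OF usual_filtration_axioms b ext Z C])
         (use \<delta> in \<open>auto intro: dyadic_in_range dyadic_less K Kw w simp del: atLeastAtMost_iff\<close>)
    then obtain E where E: "E \<in> events" "prob E \<le> C * w / (\<delta> / 2)"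
      and small: "\<And>\<omega> n. \<omega> \<in> space M - E \<Longrightarrow> n \<le> 2 ^ m \<Longrightarrow>
        norm (\<Sum>j<n. b (?Z (?t (Suc j)) \<omega> - ?Z (?t j) \<omega>) (K j \<omega>)) \<le> \<delta> / 2"
      by blast
    let ?E = "E \<union> ?E1 \<union> ?B (real n0)"
    have E1: "?E1 \<in> events" by (rule stopping_time_early_event[OF \<tau>])
    show "\<exists>E\<in>events. prob E \<le> \<eta> \<and> (\<forall>\<omega>\<in>space M - E. (\<forall>j<2 ^ m. norm (H j \<omega>) \<le> w) \<longrightarrow>
      (\<forall>n\<le>2 ^ m. norm (\<Sum>j<n. b (X (?t (Suc j)) \<omega> - X (?t j) \<omega>) (H j \<omega>)) \<le> \<delta>))"
    proof (intro bexI[of _ ?E] conjI ballI impI allI)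
      show "?E \<in> events" using E(1) E1 B by auto
      have "prob ?E \<le> prob E + prob ?E1 + prob (?B (real n0))"
        by (intro order_trans[OF measure_Un_le] add_mono order_refl) (use E(1) E1 B in auto)
      then show "prob ?E \<le> \<eta>" using E(2) wC k n0 by linarith
    next
      fix \<omega> and n :: nat assume \<omega>: "\<omega> \<in> space M - ?E" and Hw: "\<forall>j<2 ^ m. norm (H j \<omega>) \<le> w" and n: "n \<le> 2 ^ m"
      let ?D = "\<lambda>U j. U (?t (Suc j)) \<omega> - U (?t j) \<omega>"
      have "(\<Sum>j<n. b (?D X j) (H j \<omega>)) = (\<Sum>j<n. b (?D ?Z j) (K j \<omega>) + b (?D V j) (H j \<omega>))"
      proof (rule sum.cong[OF HOL.refl])
        fix j assume "j \<in> {..<n}"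
        then have j: "?t j \<in> {0..T}" "?t (Suc j) \<in> {0..T}" and Kj: "K j \<omega> = H j \<omega>"
          using n Hw \<omega> by (auto intro!: dyadic_in_range simp: K_def simp del: atLeastAtMost_iff)
        have late: "\<not> \<tau> k \<omega> \<le> ennreal T" and \<omega>M: "\<omega> \<in> space M" using \<omega> by auto
        have "?D X j = ?D ?Z j + ?D V j"
          using XYV[OF j(1) \<omega>M] XYV[OF j(2) \<omega>M]
            stopped_eq[where Y=Y and \<tau>="\<tau> k" and \<omega>=\<omega>, OF late j(1)]
            stopped_eq[where Y=Y and \<tau>="\<tau> k" and \<omega>=\<omega>, OF late j(2)] by simp
        then show "b (?D X j) (H j \<omega>) = b (?D ?Z j) (K j \<omega>) + b (?D V j) (H j \<omega>)"
          by (simp only: b.add_left Kj)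
      qed
      also have "\<dots> = (\<Sum>j<n. b (?D ?Z j) (K j \<omega>)) + (\<Sum>j<n. b (?D V j) (H j \<omega>))"
        by (rule sum.distrib)
      finally have eq: "(\<Sum>j<n. b (?D X j) (H j \<omega>)) = \<dots>" .
      have "norm (\<Sum>j<n. b (?D V j) (H j \<omega>)) \<le> (\<Sum>j<n. norm (?D V j) * w)"
      proof (rule order_trans[OF norm_sum sum_mono])
        fix j assume "j \<in> {..<n}"
        then have "norm (?D V j) * norm (H j \<omega>) \<le> norm (?D V j) * w"
          using Hw n by (intro mult_left_mono) auto
        then show "norm (b (?D V j) (H j \<omega>)) \<le> norm (?D V j) * w" using b1 order_trans by blast
      qed
      also have "\<dots> \<le> var m \<omega> * w"
        unfolding sum_distrib_right[symmetric] var_def using n w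
        by (intro mult_right_mono sum_mono2) auto
      also have "\<dots> \<le> real n0 * w" using \<omega> w by (intro mult_right_mono) (auto simp: not_less)
      finally have "norm (\<Sum>j<n. b (?D V j) (H j \<omega>)) \<le> \<delta> / 2" using wn by simp
      moreover have "norm (\<Sum>j<n. b (?D ?Z j) (K j \<omega>)) \<le> \<delta> / 2" using \<omega> n by (intro small) auto
      ultimately show "norm (\<Sum>j<n. b (?D X j) (H j \<omega>)) \<le> \<delta>"
        unfolding eq by (intro norm_triangle_le) simp
    qed
  qed
qed

lemma extended_path_uniformly_continuous:
  assumes "continuous_on {0..T} (\<lambda>t. X t \<omega>)" "0 < e"
  shows "\<exists>d>0. \<forall>s t. \<bar>s - t\<bar> < d \<longrightarrow>
    norm (extend_constantly T X s \<omega> - extend_constantly T X t \<omega>) < e"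
proof -
  have "uniformly_continuous_on {0..T} (\<lambda>t. X t \<omega>)"
    using assms(1) by (intro compact_uniformly_continuous) auto
  then obtain d where d: "0 < d" "\<And>s t. s \<in> {0..T} \<Longrightarrow> t \<in> {0..T} \<Longrightarrow> dist s t < d \<Longrightarrow>
      dist (X s \<omega>) (X t \<omega>) < e"
    using assms(2) unfolding uniformly_continuous_on_def by metis
  show ?thesis
  proof (intro exI[of _ d] conjI d(1) allI impI)
    fix s t :: real assume "\<bar>s - t\<bar> < d"
    then have "dist (max 0 (min s T)) (max 0 (min t T)) < d" by (auto simp: dist_real_def)
    then show "norm (extend_constantly T X s \<omega> - extend_constantly T X t \<omega>) < e"
      using d(2)[of "max 0 (min s T)" "max 0 (min t T)"] T_pos
      by (auto simp: extend_constantly_def dist_norm)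
  qed
qed

lemma extended_path_bounded:
  assumes "continuous_on {0..T} (\<lambda>t. X t \<omega>)"
  shows "\<exists>c. \<forall>s. norm (extend_constantly T X s \<omega>) \<le> c"
proof -
  have "bounded ((\<lambda>t. X t \<omega>) ` {0..T})"
    using assms by (intro compact_imp_bounded compact_continuous_image) auto
  then obtain c where "\<forall>t\<in>{0..T}. norm (X t \<omega>) \<le> c" by (auto simp: bounded_iff)
  then show ?thesis
    using T_pos by (intro exI[of _ c] allI) (auto simp: extend_constantly_def)
qed

lemma strongly_measurable_extended:
  "adapted F T X \<Longrightarrow> strongly_measurable M (extend_constantly T X t)"
  using T_pos strongly_measurable_adapted[of X "max 0 (min t T)"]
  by (simp add: extend_constantly_def)

lemma extend_constantly_dyadic:
  "k \<le> 2 ^ m \<Longrightarrow> extend_constantly T X (dyadic T m k) = X (dyadic T m k)"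
  using dyadic_in_range[of k m] by (simp add: extend_constantly_def)

lemma dyadic_add: "dyadic T m (k + i) = dyadic T m k + dyadic T m i"
  by (simp add: dyadic_def field_simps)

lemma dyadic_mono: "i \<le> k \<Longrightarrow> dyadic T m i \<le> dyadic T m k"
  using T_pos by (simp add: dyadic_def divide_right_mono)

text \<open>
Here \<open>\<kappa>\<close> depends on neither the grid nor \<open>N\<close>: it is a time lag over which the paths oscillate by at
most \<open>w\<close>, except on a small event, and \<open>dyadic T m N\<close> is the lag of \<open>N\<close> grid steps.
\<close>

lemma discrete_quadratic_variation_close:
  fixes X :: "real \<Rightarrow> 'a \<Rightarrow> 'b::banach"
  assumes cont: "\<And>\<omega>. \<omega> \<in> space M \<Longrightarrow> continuous_on {0..T} (\<lambda>t. X t \<omega>)" and X: "adapted F T X"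
    and sum1: "semilocally_summable M F T (\<lambda>(a::'b) (b::'b). a \<otimes>\<^sub>\<pi> b) X"
    and sum2: "semilocally_summable M F T (\<lambda>(a::'b) (b::'b). b \<otimes>\<^sub>\<pi> a) X"
    and \<delta>: "0 < \<delta>" and \<eta>: "0 < \<eta>"
  defines "x \<equiv> \<lambda>m \<omega> k. extend_constantly T X (dyadic T m k) \<omega>"
  shows "\<exists>\<kappa>>0. \<forall>m N. 1 \<le> N \<longrightarrow> dyadic T m N \<le> \<kappa> \<longrightarrow>
    (\<exists>E\<in>events. prob E \<le> \<eta> \<and> (\<forall>\<omega>\<in>space M - E. \<forall>n\<le>2 ^ m.
      norm ((1 / real N) *\<^sub>R (\<Sum>k<n. (x m \<omega> (k + N) - x m \<omega> k) \<otimes>\<^sub>\<pi> (x m \<omega> (k + N) - x m \<omega> k))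
        - (\<Sum>j<n. (x m \<omega> (Suc j) - x m \<omega> j) \<otimes>\<^sub>\<pi> (x m \<omega> (Suc j) - x m \<omega> j))) \<le> \<delta>))"
proof -
  have \<eta>4: "0 < \<eta> / 4" and \<delta>3: "0 < \<delta> / 3" using \<eta> \<delta> by auto
  have norm_p': "norm (d \<otimes>\<^sub>\<pi> a) \<le> norm a * norm d" for a d :: 'b
    using norm_ptensor_le[of d a] by (simp add: mult.commute)
  obtain w1 where w1: "0 < w1" and small1: "\<forall>m (H :: nat \<Rightarrow> 'a \<Rightarrow> 'b). (\<forall>j<2 ^ m. strongly_measurable (F (dyadic T m j)) (H j)) \<longrightarrow>
    (\<exists>E\<in>events. prob E \<le> \<eta> / 4 \<and> (\<forall>\<omega>\<in>space M - E. (\<forall>j<2 ^ m. norm (H j \<omega>) \<le> w1) \<longrightarrow>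
      (\<forall>n\<le>2 ^ m. norm (\<Sum>j<n. (X (dyadic T m (Suc j)) \<omega> - X (dyadic T m j) \<omega>) \<otimes>\<^sub>\<pi> H j \<omega>) \<le> \<delta> / 3)))"
    using semilocally_summable_integral_small[OF bounded_bilinear_ptensor norm_ptensor_le sum1 \<delta>3 \<eta>4]
    by (elim exE conjE) (rule that)
  obtain w2 where w2: "0 < w2" and small2: "\<forall>m (H :: nat \<Rightarrow> 'a \<Rightarrow> 'b). (\<forall>j<2 ^ m. strongly_measurable (F (dyadic T m j)) (H j)) \<longrightarrow>
    (\<exists>E\<in>events. prob E \<le> \<eta> / 4 \<and> (\<forall>\<omega>\<in>space M - E. (\<forall>j<2 ^ m. norm (H j \<omega>) \<le> w2) \<longrightarrow>
      (\<forall>n\<le>2 ^ m. norm (\<Sum>j<n. H j \<omega> \<otimes>\<^sub>\<pi> (X (dyadic T m (Suc j)) \<omega> - X (dyadic T m j) \<omega>)) \<le> \<delta> / 3)))"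
    using semilocally_summable_integral_small[OF bounded_bilinear.flip[OF bounded_bilinear_ptensor]
        norm_p' sum2 \<delta>3 \<eta>4]
    by (elim exE conjE) (rule that)
  \<comment> \<open>subtracting the initial value leaves all increments unchanged and makes the sequence start at \<open>0\<close>\<close>
  define u where "u m \<omega> k = x m \<omega> k - X 0 \<omega>" for m \<omega> k
  have u_diff: "u m \<omega> k - u m \<omega> l = x m \<omega> k - x m \<omega> l" for m \<omega> k l by (simp add: u_def)
  have u_0: "u m \<omega> 0 = 0" for m \<omega>
    using T_pos by (simp add: u_def x_def dyadic_def extend_constantly_def)
  have xm: "strongly_measurable M (\<lambda>\<omega>. x m \<omega> k)" for m k
    unfolding x_def using strongly_measurable_extended[OF X] by simp
  have um: "strongly_measurable M (\<lambda>\<omega>. u m \<omega> k)" for m k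
    unfolding u_def using T_pos
    by (intro strongly_measurable_diff xm strongly_measurable_adapted[OF X]) auto
  let ?B = "\<lambda>a. {\<omega>\<in>space M. \<exists>m k. a < norm (u m \<omega> k)}"
  have B: "?B a \<in> events" for a
  proof -
    have [measurable]: "(\<lambda>\<omega>. norm (u m \<omega> k)) \<in> borel_measurable M" for m k
      by (rule borel_measurable_norm_strongly_measurable[OF um])
    show ?thesis by measurable
  qed
  have "\<exists>n. prob (?B (real n)) \<le> \<eta> / 4"
  proof (rule decreasing_events_small[OF B _ _ \<eta>4])
    show "decseq (\<lambda>n. ?B (real n))"
      by (rule decseq_SucI, clarsimp) (rule exI, rule exI, erule less_trans[rotated], simp)
    show "AE \<omega> in M. \<exists>n. \<omega> \<notin> ?B (real n)"
    proof (rule AE_I2)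
      fix \<omega> assume "\<omega> \<in> space M"
      from extended_path_bounded[of X, OF cont[OF this]]
      obtain c where c: "\<And>s. norm (extend_constantly T X s \<omega>) \<le> c" by blast
      obtain n where n: "c + norm (X 0 \<omega>) \<le> real n" using real_arch_simple by blast
      have "norm (u m \<omega> k) \<le> real n" for m k
        unfolding u_def x_def by (rule order_trans[OF norm_triangle_ineq4 order_trans[OF add_right_mono[OF c] n]])
      then show "\<exists>n. \<omega> \<notin> ?B (real n)" by (auto simp: not_less intro!: exI[of _ n])
    qed
  qed
  then obtain n0 where n0: "prob (?B (real n0)) \<le> \<eta> / 4" by blast
  \<comment> \<open>the last bound keeps the boundary terms \<open>6 * w * real n0\<close> below \<open>\<delta> / 3\<close>\<close>
  define w where "w = min (min w1 w2) (\<delta> / (18 * (real n0 + 1)))"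
  have w: "0 < w" "w \<le> w1" "w \<le> w2" using w1 w2 \<delta> by (auto simp: w_def)
  have wn: "6 * w * real n0 \<le> \<delta> / 3"
  proof -
    have "w * real n0 \<le> (\<delta> / (18 * (real n0 + 1))) * (real n0 + 1)"
      using w by (intro mult_mono) (auto simp: w_def)
    also have "\<dots> = \<delta> / 18" by (simp add: field_simps)
    finally show ?thesis by simp
  qed
  let ?O = "\<lambda>\<kappa>. {\<omega>\<in>space M. \<exists>m k i. dyadic T m i \<le> \<kappa> \<and> w < norm (u m \<omega> (k + i) - u m \<omega> k)}"
  have O: "?O \<kappa> \<in> events" for \<kappa>
  proof -
    have [measurable]: "(\<lambda>\<omega>. norm (u m \<omega> (k + i) - u m \<omega> k)) \<in> borel_measurable M" for m k i
      by (intro borel_measurable_norm_strongly_measurable strongly_measurable_diff um)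
    show ?thesis by measurable
  qed
  have "\<exists>n. prob (?O (1 / real (Suc n))) \<le> \<eta> / 4"
  proof (rule decreasing_events_small[OF O _ _ \<eta>4])
    show "decseq (\<lambda>n. ?O (1 / real (Suc n)))"
    proof (rule decseq_SucI)
      fix n
      have "1 / real (Suc (Suc n)) \<le> 1 / real (Suc n)" by (simp add: field_simps)
      then show "?O (1 / real (Suc (Suc n))) \<subseteq> ?O (1 / real (Suc n))"
        by (blast intro: order_trans)
    qed
    show "AE \<omega> in M. \<exists>n. \<omega> \<notin> ?O (1 / real (Suc n))"
    proof (rule AE_I2)
      fix \<omega> assume "\<omega> \<in> space M"
      from extended_path_uniformly_continuous[of X, OF cont[OF this] w(1)]
      obtain d where d: "0 < d" "\<And>s t. \<bar>s - t\<bar> < d \<Longrightarrow>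
        norm (extend_constantly T X s \<omega> - extend_constantly T X t \<omega>) < w" by blast
      obtain n where n: "1 / real (Suc n) < d"
        using reals_Archimedean[OF d(1)] by (auto simp: inverse_eq_divide)
      have "norm (u m \<omega> (k + i) - u m \<omega> k) \<le> w" if "dyadic T m i \<le> 1 / real (Suc n)" for m k i
        unfolding u_diff x_def
      proof (rule less_imp_le[OF d(2)])
        have "0 \<le> dyadic T m i" using T_pos by (simp add: dyadic_def)
        then show "\<bar>dyadic T m (k + i) - dyadic T m k\<bar> < d" using that n by (simp add: dyadic_add)
      qed
      then have "\<omega> \<notin> ?O (1 / real (Suc n))" by (auto simp: not_less)
      then show "\<exists>n. \<omega> \<notin> ?O (1 / real (Suc n))" by blast
    qed
  qed
  then obtain n1 where n1: "prob (?O (1 / real (Suc n1))) \<le> \<eta> / 4" by blast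
  define \<kappa> where "\<kappa> = 1 / real (Suc n1)"
  show ?thesis
  proof (intro exI[of _ \<kappa>] conjI allI impI)
    show "0 < \<kappa>" by (simp add: \<kappa>_def)
    fix m N assume N: "1 \<le> N" and N\<kappa>: "dyadic T m N \<le> \<kappa>"
    define g where "g \<omega> j = (1 / real N) *\<^sub>R (\<Sum>i<N. u m \<omega> (j - i))" for \<omega> j
    define H where "H j \<omega> = g \<omega> j - u m \<omega> j" for j \<omega>
    have H: "\<forall>j<2 ^ m. strongly_measurable (F (dyadic T m j)) (H j)"
    proof (intro allI impI)
      fix j :: nat assume j: "j < 2 ^ m"
      have "strongly_measurable (F (dyadic T m j)) (\<lambda>\<omega>. u m \<omega> (j - i))" for i
      proof -
        have "j - i \<le> 2 ^ m" using j by simp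
        then show ?thesis
          unfolding u_def x_def extend_constantly_dyadic[OF \<open>j - i \<le> 2 ^ m\<close>]
          using dyadic_in_range[of j m] dyadic_in_range[of "j - i" m] dyadic_mono[of "j - i" j m] j
          by (intro strongly_measurable_diff strongly_measurable_adapted_later[OF X]) auto
      qed
      from this this[of 0] show "strongly_measurable (F (dyadic T m j)) (H j)"
        unfolding H_def g_def
        by (intro strongly_measurable_diff strongly_measurable_scaleR strongly_measurable_sum) auto
    qed
    from small1[THEN spec, THEN spec, THEN mp, OF H] obtain E1 where E1: "E1 \<in> events" "prob E1 \<le> \<eta> / 4"
      and E1': "\<And>\<omega> n. \<omega> \<in> space M - E1 \<Longrightarrow> \<forall>j<2 ^ m. norm (H j \<omega>) \<le> w1 \<Longrightarrow> n \<le> 2 ^ m \<Longrightarrow>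
        norm (\<Sum>j<n. (X (dyadic T m (Suc j)) \<omega> - X (dyadic T m j) \<omega>) \<otimes>\<^sub>\<pi> H j \<omega>) \<le> \<delta> / 3"
      by blast
    from small2[THEN spec, THEN spec, THEN mp, OF H] obtain E2 where E2: "E2 \<in> events" "prob E2 \<le> \<eta> / 4"
      and E2': "\<And>\<omega> n. \<omega> \<in> space M - E2 \<Longrightarrow> \<forall>j<2 ^ m. norm (H j \<omega>) \<le> w2 \<Longrightarrow> n \<le> 2 ^ m \<Longrightarrow>
        norm (\<Sum>j<n. H j \<omega> \<otimes>\<^sub>\<pi> (X (dyadic T m (Suc j)) \<omega> - X (dyadic T m j) \<omega>)) \<le> \<delta> / 3"
      by blast
    let ?E = "E1 \<union> E2 \<union> ?B (real n0) \<union> ?O \<kappa>"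
    show "\<exists>E\<in>events. prob E \<le> \<eta> \<and> (\<forall>\<omega>\<in>space M - E. \<forall>n\<le>2 ^ m.
      norm ((1 / real N) *\<^sub>R (\<Sum>k<n. (x m \<omega> (k + N) - x m \<omega> k) \<otimes>\<^sub>\<pi> (x m \<omega> (k + N) - x m \<omega> k))
        - (\<Sum>j<n. (x m \<omega> (Suc j) - x m \<omega> j) \<otimes>\<^sub>\<pi> (x m \<omega> (Suc j) - x m \<omega> j))) \<le> \<delta>)"
    proof (intro bexI[of _ ?E] conjI ballI allI impI)
      show "?E \<in> events" by (intro sets.Un E1(1) E2(1) B O)
      have "prob ?E \<le> prob E1 + prob E2 + prob (?B (real n0)) + prob (?O \<kappa>)"
        by (intro order_trans[OF measure_Un_le] add_mono order_refl sets.Un E1(1) E2(1) B O)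
      then show "prob ?E \<le> \<eta>" using E1(2) E2(2) n0 n1 by (simp add: \<kappa>_def)
    next
      fix \<omega> and n :: nat assume \<omega>: "\<omega> \<in> space M - ?E" and n: "n \<le> 2 ^ m"
      have osc: "norm (u m \<omega> (k + i) - u m \<omega> k) \<le> w" if "i \<le> N" for k i
      proof (rule ccontr)
        assume "\<not> ?thesis"
        moreover have "dyadic T m i \<le> \<kappa>" using dyadic_mono[OF that, of m] N\<kappa> by simp
        ultimately have "\<omega> \<in> ?O \<kappa>" using \<omega> by (auto simp: not_le)
        then show False using \<omega> by blast
      qed
      have c: "norm (u m \<omega> k) \<le> real n0" for k
        using \<omega> by (auto simp: not_less)
      have Hw: "norm (H j \<omega>) \<le> w" for j
      proof -
        have "H j \<omega> = (1 / real N) *\<^sub>R (\<Sum>i<N. u m \<omega> (j - i) - u m \<omega> j)"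
          using N by (simp add: H_def g_def sum_subtractf sum_constant_scaleR scaleR_diff_right)
        also have "norm \<dots> \<le> (1 / real N) * (\<Sum>i<N. norm (u m \<omega> (j - i) - u m \<omega> j))"
          by (simp add: divide_right_mono norm_sum)
        also have "\<dots> \<le> (1 / real N) * (real (card {..<N}) * w)"
        proof (intro mult_left_mono sum_bounded_above)
          fix i assume "i \<in> {..<N}"
          then have "norm (u m \<omega> ((j - i) + min i j) - u m \<omega> (j - i)) \<le> w" by (intro osc) auto
          moreover have "(j - i) + min i j = j" by auto
          ultimately show "norm (u m \<omega> (j - i) - u m \<omega> j) \<le> w" by (simp only: norm_minus_commute)
        qed auto
        also have "\<dots> = w" using N by simp
        finally show ?thesis .
      qed
      have incr: "X (dyadic T m (Suc j)) \<omega> - X (dyadic T m j) \<omega> = u m \<omega> (Suc j) - u m \<omega> j" if "j < n" for j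
        using that n by (simp add: u_diff x_def extend_constantly_dyadic)
      have "norm ((1 / real N) *\<^sub>R (\<Sum>k<n. (u m \<omega> (k + N) - u m \<omega> k) \<otimes>\<^sub>\<pi> (u m \<omega> (k + N) - u m \<omega> k))
        - (\<Sum>j<n. (u m \<omega> (Suc j) - u m \<omega> j) \<otimes>\<^sub>\<pi> (u m \<omega> (Suc j) - u m \<omega> j)))
        \<le> 6 * w * real n0 + norm (\<Sum>j<n. (u m \<omega> (Suc j) - u m \<omega> j) \<otimes>\<^sub>\<pi> H j \<omega>)
          + norm (\<Sum>j<n. H j \<omega> \<otimes>\<^sub>\<pi> (u m \<omega> (Suc j) - u m \<omega> j))"
        unfolding H_def g_def
        by (rule norm_discrete_quadratic_variation_diff_le[OF N u_0 osc c])
      also have "(\<Sum>j<n. (u m \<omega> (Suc j) - u m \<omega> j) \<otimes>\<^sub>\<pi> H j \<omega>)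
          = (\<Sum>j<n. (X (dyadic T m (Suc j)) \<omega> - X (dyadic T m j) \<omega>) \<otimes>\<^sub>\<pi> H j \<omega>)"
        using incr by (intro sum.cong) auto
      also have "(\<Sum>j<n. H j \<omega> \<otimes>\<^sub>\<pi> (u m \<omega> (Suc j) - u m \<omega> j))
          = (\<Sum>j<n. H j \<omega> \<otimes>\<^sub>\<pi> (X (dyadic T m (Suc j)) \<omega> - X (dyadic T m j) \<omega>))"
        using incr by (intro sum.cong) auto
      also have "6 * w * real n0 + norm (\<Sum>j<n. (X (dyadic T m (Suc j)) \<omega> - X (dyadic T m j) \<omega>) \<otimes>\<^sub>\<pi> H j \<omega>)
          + norm (\<Sum>j<n. H j \<omega> \<otimes>\<^sub>\<pi> (X (dyadic T m (Suc j)) \<omega> - X (dyadic T m j) \<omega>)) \<le> \<delta> / 3 + \<delta> / 3 + \<delta> / 3"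
        using Hw w \<omega> n by (intro add_mono wn E1' E2') (auto intro: order_trans)
      finally show "norm ((1 / real N) *\<^sub>R (\<Sum>k<n. (x m \<omega> (k + N) - x m \<omega> k) \<otimes>\<^sub>\<pi> (x m \<omega> (k + N) - x m \<omega> k))
        - (\<Sum>j<n. (x m \<omega> (Suc j) - x m \<omega> j) \<otimes>\<^sub>\<pi> (x m \<omega> (Suc j) - x m \<omega> j))) \<le> \<delta>"
        by (simp add: u_diff)
    qed
  qed
qed

end

section \<open>Riemann sums of the regularised quadratic variation\<close>

lemma norm_left_Riemann_sum_diff_le:
  fixes f :: "real \<Rightarrow> 'b::banach"
  assumes f: "continuous_on UNIV f" and h: "0 \<le> h"
    and close: "\<And>k s. k < n \<Longrightarrow> s \<in> {real k * h..real (Suc k) * h} \<Longrightarrow> norm (\<phi> k - f s) \<le> e"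
  shows "norm (h *\<^sub>R (\<Sum>k<n. \<phi> k) - integral {0..real n * h} f) \<le> real n * h * e"
  using close
proof (induction n)
  case (Suc n)
  have int: "f integrable_on {a..b}" for a b
    by (rule integrable_continuous_real) (rule continuous_on_subset[OF f], simp)
  let ?a = "real n * h" and ?b = "real (Suc n) * h"
  have ab: "?a \<le> ?b" "?b - ?a = h" using h by (auto simp: algebra_simps)
  have "integral {0..?a} f + integral {?a..?b} f = integral {0..?b} f"
    using h by (intro Henstock_Kurzweil_Integration.integral_combine int) (auto simp: algebra_simps)
  moreover have "norm (h *\<^sub>R \<phi> n - integral {?a..?b} f) \<le> h * e"
  proof -
    have "((\<lambda>s. \<phi> n - f s) has_integral (h *\<^sub>R \<phi> n - integral {?a..?b} f)) (cbox ?a ?b)"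
      using has_integral_diff[OF has_integral_const_real[of "\<phi> n" ?a ?b] integrable_integral[OF int]] ab h
      by simp
    moreover have "norm (\<phi> n - f s) \<le> e" if "s \<in> cbox ?a ?b" for s using Suc.prems[of n s] that by simp
    moreover have "0 \<le> e" using Suc.prems[of n ?a] ab(1) by (auto intro: order_trans[OF norm_ge_zero])
    ultimately have "norm (h *\<^sub>R \<phi> n - integral {?a..?b} f) \<le> e * measure lborel (cbox ?a ?b)"
      by (intro has_integral_bound) auto
    then show ?thesis using ab h by (simp add: mult.commute)
  qed
  moreover have "norm (h *\<^sub>R (\<Sum>k<n. \<phi> k) - integral {0..?a} f) \<le> ?a * e"
    using Suc.prems by (intro Suc.IH) auto
  ultimately have "norm ((h *\<^sub>R (\<Sum>k<n. \<phi> k) - integral {0..?a} f) + (h *\<^sub>R \<phi> n - integral {?a..?b} f))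
      \<le> ?a * e + h * e"
    by (intro norm_triangle_mono)
  also have "?a * e + h * e = ?b * e" by (simp add: algebra_simps)
  also have "(h *\<^sub>R (\<Sum>k<n. \<phi> k) - integral {0..?a} f) + (h *\<^sub>R \<phi> n - integral {?a..?b} f)
    = h *\<^sub>R (\<Sum>k<Suc n. \<phi> k) - integral {0..?b} f"
    using \<open>integral {0..?a} f + integral {?a..?b} f = integral {0..?b} f\<close>[symmetric]
    by (simp add: scaleR_add_right)
  finally show ?case .
qed simp

text \<open>
Up to the factor \<open>h = T / 2 ^ m\<close> the left-hand sum is a Riemann sum, in which the lag \<open>\<epsilon>\<close> is replaced by the
multiple \<open>N m * h\<close> of the mesh; that multiple lies between \<open>\<epsilon>\<close> and \<open>\<epsilon> + h\<close>. Uniform continuity controls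
the change of the increments, and the boundedness of \<open>p\<close> controls the change of the factor \<open>1 / \<epsilon>\<close>.
\<close>

lemma dyadic_sum_approximates_integral:
  fixes p :: "real \<Rightarrow> 'b::real_normed_vector"
  assumes T: "0 < T" and \<epsilon>: "0 < \<epsilon>" and e: "0 < e"
    and uc: "\<And>e. 0 < e \<Longrightarrow> \<exists>d>0. \<forall>s t. \<bar>s - t\<bar> < d \<longrightarrow> norm (p s - p t) < e"
    and bd: "\<And>s. norm (p s) \<le> c"
  defines "N \<equiv> \<lambda>m. nat \<lceil>\<epsilon> * 2 ^ m / T\<rceil>" and "x \<equiv> \<lambda>m k. p (dyadic T m k)"
  shows "\<exists>m0. \<forall>m\<ge>m0. \<forall>t\<in>{0..T}.
    norm ((1 / real (N m)) *\<^sub>R (\<Sum>k<nat \<lfloor>t * 2 ^ m / T\<rfloor>. (x m (k + N m) - x m k) \<otimes>\<^sub>\<pi> (x m (k + N m) - x m k))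
      - integral {0..t} (\<lambda>s. (1 / \<epsilon>) *\<^sub>R ((p (s + \<epsilon>) - p s) \<otimes>\<^sub>\<pi> (p (s + \<epsilon>) - p s)))) \<le> e"
proof -
  interpret P: bounded_bilinear "(\<otimes>\<^sub>\<pi>) :: 'b \<Rightarrow> 'b \<Rightarrow> _" by (rule bounded_bilinear_ptensor)
  have c0: "0 \<le> c" using bd[of 0] by (rule order_trans[OF norm_ge_zero])
  define f where "f s = (1 / \<epsilon>) *\<^sub>R ((p (s + \<epsilon>) - p s) \<otimes>\<^sub>\<pi> (p (s + \<epsilon>) - p s))" for s
  have f_fun: "(\<lambda>s. (1 / \<epsilon>) *\<^sub>R ((p (s + \<epsilon>) - p s) \<otimes>\<^sub>\<pi> (p (s + \<epsilon>) - p s))) = f"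
    by (simp add: f_def fun_eq_iff)
  have contp: "continuous_on UNIV p"
    unfolding continuous_on_iff dist_norm using uc by (metis norm_minus_commute real_norm_def)
  have contf: "continuous_on UNIV f"
    unfolding f_def
    by (intro continuous_intros P.continuous_on continuous_on_compose2[OF contp]) auto
  \<comment> \<open>chosen so that the error \<open>8 * w * c / \<epsilon>\<close> of the integrand, integrated over \<open>{0..T}\<close>, is at most \<open>e / 2\<close>\<close>
  define w where "w = e * \<epsilon> / (16 * (c + 1) * T)"
  have w: "0 < w" using e \<epsilon> c0 T by (simp add: w_def)
  obtain d where d: "0 < d" "\<And>s t. \<bar>s - t\<bar> < d \<Longrightarrow> norm (p s - p t) < w" using uc[OF w] by blast
  \<comment> \<open>all the other errors add up to at most \<open>h * A\<close>\<close>
  define A where "A = 4 * c\<^sup>2 * (T / \<epsilon>\<^sup>2 + 1 / \<epsilon>)"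
  have A: "0 \<le> A" using T \<epsilon> by (simp add: A_def)
  have lim: "(\<lambda>m. T / 2 ^ m) \<longlonglongrightarrow> 0"
    using LIMSEQ_divide_realpow_zero[of 2 T] by simp
  have "\<forall>\<^sub>F m in sequentially. T / 2 ^ m < min (d / 2) (e / (2 * (A + 1)))"
    using d e A by (intro order_tendstoD(2)[OF lim]) auto
  then obtain m0 where m0: "\<And>m. m \<ge> m0 \<Longrightarrow> T / 2 ^ m < d / 2 \<and> T / 2 ^ m < e / (2 * (A + 1))"
    by (auto simp: eventually_sequentially)
  show ?thesis
  proof (intro exI[of _ m0] allI impI ballI)
    fix m t assume m: "m0 \<le> m" and t: "t \<in> {0..T}"
    define h where "h = T / 2 ^ m"
    have "0 < h" "h < d / 2" using T m0[OF m] unfolding h_def by auto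
    then have h: "0 < h" "2 * h < d" by simp_all
    have hA: "h * A \<le> e / 2"
    proof -
      have "h * A \<le> e / (2 * (A + 1)) * (A + 1)"
        using m0[OF m] h A e by (intro mult_mono) (auto simp: h_def)
      also have "\<dots> = e / 2" using A by (simp add: field_simps)
      finally show ?thesis .
    qed
    have dy: "dyadic T m k = real k * h" for k by (simp add: dyadic_def h_def)
    have quot: "\<epsilon> * 2 ^ m / T = \<epsilon> / h" "t * 2 ^ m / T = t / h" using T by (auto simp: h_def)
    have pos: "0 < \<epsilon> / h" using h \<epsilon> by simp
    have N: "\<epsilon> / h \<le> real (N m)" "real (N m) < \<epsilon> / h + 1"
      unfolding N_def quot using pos by linarith+
    have "0 < real (N m)" using N(1) pos by linarith
    moreover have "\<epsilon> \<le> real (N m) * h" "real (N m) * h < \<epsilon> + h"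
      using N h by (auto simp: field_simps)
    ultimately have Nh: "\<epsilon> \<le> real (N m) * h" "real (N m) * h < \<epsilon> + h" "0 < real (N m)" by auto
    define n where "n = nat \<lfloor>t / h\<rfloor>"
    have "0 \<le> t / h" using t h by simp
    then have "real n \<le> t / h" "t / h < real n + 1" unfolding n_def by linarith+
    then have nh: "real n * h \<le> t" "t \<le> real n * h + h" using h by (auto simp: field_simps)
    let ?D = "\<lambda>k. x m (k + N m) - x m k" and ?D' = "\<lambda>s. p (s + \<epsilon>) - p s"
    let ?\<epsilon> = "real (N m) * h"
    define \<phi> where "\<phi> k = (1 / ?\<epsilon>) *\<^sub>R (?D k \<otimes>\<^sub>\<pi> ?D k)" for k
    have bD: "norm (?D k) \<le> 2 * c" "norm (?D' s) \<le> 2 * c" for k s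
      unfolding x_def by (rule order_trans[OF norm_triangle_ineq4], use bd in \<open>smt (verit)\<close>)+
    have bDD: "norm (?D' s \<otimes>\<^sub>\<pi> ?D' s) \<le> 4 * c\<^sup>2" for s
    proof -
      have "norm (?D' s \<otimes>\<^sub>\<pi> ?D' s) \<le> (2 * c) * (2 * c)"
        using c0 by (intro order_trans[OF norm_ptensor_le] mult_mono bD) auto
      then show ?thesis by (simp add: power2_eq_square)
    qed
    define e' where "e' = 8 * w * c / \<epsilon> + 4 * c\<^sup>2 * h / \<epsilon>\<^sup>2"
    have e'0: "0 \<le> e'" using w c0 \<epsilon> h by (simp add: e'_def)
    have close: "norm (\<phi> k - f s) \<le> e'" if s: "s \<in> {real k * h..real (Suc k) * h}" for k s
    proof -
      have s': "real k * h \<le> s" "s \<le> real k * h + h" using s by (auto simp: algebra_simps)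
      have "norm (p (real k * h + ?\<epsilon>) - p (s + \<epsilon>)) < w" "norm (p s - p (real k * h)) < w"
        using s' Nh h by (intro d(2); simp)+
      then have "norm (?D k - ?D' s) \<le> w + w"
        using norm_triangle_ineq[of "p (real k * h + ?\<epsilon>) - p (s + \<epsilon>)" "p s - p (real k * h)"]
        by (simp add: x_def dy algebra_simps)
      then have DD: "norm (?D k - ?D' s) \<le> 2 * w" by simp
      have "?D k \<otimes>\<^sub>\<pi> ?D k - ?D' s \<otimes>\<^sub>\<pi> ?D' s = (?D k - ?D' s) \<otimes>\<^sub>\<pi> ?D k + ?D' s \<otimes>\<^sub>\<pi> (?D k - ?D' s)"
        by (simp only: P.diff_left P.diff_right) simp
      also have "norm \<dots> \<le> (2 * w) * (2 * c) + (2 * c) * (2 * w)"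
        using w c0 by (intro norm_triangle_mono order_trans[OF norm_ptensor_le] mult_mono bD DD) auto
      finally have 1: "norm (?D k \<otimes>\<^sub>\<pi> ?D k - ?D' s \<otimes>\<^sub>\<pi> ?D' s) \<le> 8 * w * c" by (simp add: ac_simps)
      have "\<bar>1 / ?\<epsilon> - 1 / \<epsilon>\<bar> = (?\<epsilon> - \<epsilon>) / (\<epsilon> * ?\<epsilon>)"
        using Nh \<epsilon> h by (simp add: abs_if field_simps)
      also have "\<dots> \<le> h / (\<epsilon> * \<epsilon>)"
        using Nh \<epsilon> h by (intro frac_le mult_left_mono) auto
      finally have 2: "\<bar>1 / ?\<epsilon> - 1 / \<epsilon>\<bar> \<le> h / \<epsilon>\<^sup>2" by (simp add: power2_eq_square)
      have "\<phi> k - f s = (1 / ?\<epsilon>) *\<^sub>R (?D k \<otimes>\<^sub>\<pi> ?D k - ?D' s \<otimes>\<^sub>\<pi> ?D' s)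
          + (1 / ?\<epsilon> - 1 / \<epsilon>) *\<^sub>R (?D' s \<otimes>\<^sub>\<pi> ?D' s)"
        by (simp only: \<phi>_def f_def scaleR_diff_right scaleR_diff_left) simp
      also have "norm \<dots> \<le> (1 / \<epsilon>) * (8 * w * c) + h / \<epsilon>\<^sup>2 * (4 * c\<^sup>2)"
      proof (rule norm_triangle_mono)
        have "1 / ?\<epsilon> \<le> 1 / \<epsilon>" using Nh \<epsilon> by (intro frac_le) auto
        then show "norm ((1 / ?\<epsilon>) *\<^sub>R (?D k \<otimes>\<^sub>\<pi> ?D k - ?D' s \<otimes>\<^sub>\<pi> ?D' s)) \<le> (1 / \<epsilon>) * (8 * w * c)"
          unfolding norm_scaleR using 1 h \<epsilon> by (intro mult_mono) auto
        show "norm ((1 / ?\<epsilon> - 1 / \<epsilon>) *\<^sub>R (?D' s \<otimes>\<^sub>\<pi> ?D' s)) \<le> h / \<epsilon>\<^sup>2 * (4 * c\<^sup>2)"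
          unfolding norm_scaleR using 2 bDD h by (intro mult_mono) auto
      qed
      also have "\<dots> = e'" by (simp add: e'_def)
      finally show ?thesis .
    qed
    have R: "(1 / real (N m)) *\<^sub>R (\<Sum>k<n. ?D k \<otimes>\<^sub>\<pi> ?D k) = h *\<^sub>R (\<Sum>k<n. \<phi> k)"
      using h by (simp add: \<phi>_def flip: scaleR_sum_right)
    have int: "f integrable_on {a..b}" for a b
      by (rule integrable_continuous_real) (rule continuous_on_subset[OF contf], simp)
    have comb: "integral {0..real n * h} f + integral {real n * h..t} f = integral {0..t} f"
      using nh h by (intro Henstock_Kurzweil_Integration.integral_combine int) auto
    have "norm (h *\<^sub>R (\<Sum>k<n. \<phi> k) - integral {0..real n * h} f) \<le> real n * h * e'"
      using h by (intro norm_left_Riemann_sum_diff_le contf close) auto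
    also have "\<dots> \<le> T * e'" using nh t e'0 by (intro mult_right_mono) auto
    finally have 1: "norm (h *\<^sub>R (\<Sum>k<n. \<phi> k) - integral {0..real n * h} f) \<le> T * e'" .
    have "norm (f s) \<le> 4 * c\<^sup>2 / \<epsilon>" for s
      unfolding f_def using bDD[of s] \<epsilon> by (simp add: divide_right_mono)
    then have "norm (integral (cbox (real n * h) t) f) \<le> 4 * c\<^sup>2 / \<epsilon> * measure lborel (cbox (real n * h) t)"
      using \<epsilon> by (intro has_integral_bound[OF _ integrable_integral]) (auto simp: int)
    also have "\<dots> \<le> 4 * c\<^sup>2 / \<epsilon> * h" using nh \<epsilon> by (intro mult_left_mono) auto
    finally have 2: "norm (integral {real n * h..t} f) \<le> 4 * c\<^sup>2 / \<epsilon> * h" by simp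
    have "norm (h *\<^sub>R (\<Sum>k<n. \<phi> k) - integral {0..t} f)
      = norm ((h *\<^sub>R (\<Sum>k<n. \<phi> k) - integral {0..real n * h} f) - integral {real n * h..t} f)"
      by (simp only: comb[symmetric] diff_diff_eq)
    also have "\<dots> \<le> T * e' + 4 * c\<^sup>2 / \<epsilon> * h"
      by (intro order_trans[OF norm_triangle_ineq4] add_mono 1 2)
    also have "\<dots> = 8 * w * c * T / \<epsilon> + h * A"
      using \<epsilon> by (simp add: e'_def A_def field_simps power2_eq_square)
    also have "\<dots> \<le> e / 2 + e / 2"
    proof (rule add_mono[OF _ hA])
      have "8 * w * c * T \<le> 8 * w * (c + 1) * T"
        using w T by (intro mult_right_mono mult_left_mono) auto
      also have "\<dots> = e / 2 * \<epsilon>" 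
      proof -
        have "8 * (e * \<epsilon> / (16 * C * T)) * C * T = e / 2 * \<epsilon>" if "0 < C" for C
          using T that by (simp add: field_simps)
        from this[of "c + 1"] show ?thesis using c0 by (simp add: w_def del: distrib_left_numeral)
      qed
      finally show "8 * w * c * T / \<epsilon> \<le> e / 2" using \<epsilon> by (simp add: pos_divide_le_eq)
    qed
    finally show "norm ((1 / real (N m)) *\<^sub>R (\<Sum>k<nat \<lfloor>t * 2 ^ m / T\<rfloor>. ?D k \<otimes>\<^sub>\<pi> ?D k)
      - integral {0..t} (\<lambda>s. (1 / \<epsilon>) *\<^sub>R (?D' s \<otimes>\<^sub>\<pi> ?D' s))) \<le> e"
      unfolding quot n_def[symmetric] R f_fun by simp
  qed
qed

lemma (in prob_space) prob_liminf_le: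
  assumes A: "\<And>n::nat. A n \<in> events" "\<And>n. prob (A n) \<le> \<eta>"
  shows "prob (\<Union>n. \<Inter>m\<in>{n..}. A m) \<le> \<eta>"
proof (rule LIMSEQ_le_const2)
  show "(\<lambda>n. prob (\<Inter>m\<in>{n..}. A m)) \<longlonglongrightarrow> prob (\<Union>n. \<Inter>m\<in>{n..}. A m)"
    using A(1) by (intro finite_Lim_measure_incseq) (auto intro!: incseq_SucI)
  have "prob (\<Inter>m\<in>{n..}. A m) \<le> prob (A n)" for n
    using A(1) by (intro finite_measure_mono) auto
  then show "\<exists>N. \<forall>n\<ge>N. prob (\<Inter>m\<in>{n..}. A m) \<le> \<eta>" using A(2) order_trans by blast
qed

section \<open>Existence of the tensor quadratic variation\<close>

definition regularised_qv ::
  "real \<Rightarrow> (real \<Rightarrow> 'a \<Rightarrow> 'b::real_normed_vector) \<Rightarrow> real \<Rightarrow> real \<Rightarrow> 'a \<Rightarrow> ('b, 'b) proj_tensor" where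
  "regularised_qv T X \<epsilon> t \<omega> = integral {0..t} (tensor_increment T X \<epsilon> \<omega>)"

text \<open>
The estimate with the explicit rate turns the convergence of a subsequence into uniform convergence in \<open>t\<close>.
\<close>

lemma geometric_Cauchy_limit:
  fixes a :: "nat \<Rightarrow> 'b::banach"
  assumes a: "\<And>m. n \<le> m \<Longrightarrow> norm (a m - a (Suc m)) \<le> (1 / 2) ^ m"
  shows "convergent a" and "n \<le> m \<Longrightarrow> norm (a m - lim a) \<le> 2 * (1 / 2) ^ m"
proof -
  have le: "norm (a m - a (m + j)) \<le> 2 * (1 / 2) ^ m" if "n \<le> m" for m j
  proof -
    have "norm (a m - a (m + j)) \<le> 2 * (1 / 2) ^ m - 2 * (1 / 2) ^ (m + j)"
    proof (induction j)
      case (Suc j)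
      have "norm (a m - a (m + Suc j)) \<le> norm (a m - a (m + j)) + norm (a (m + j) - a (Suc (m + j)))"
        using norm_triangle_ineq[of "a m - a (m + j)" "a (m + j) - a (Suc (m + j))"] by simp
      also have "\<dots> \<le> (2 * (1 / 2) ^ m - 2 * (1 / 2) ^ (m + j)) + (1 / 2) ^ (m + j)"
        using Suc a[of "m + j"] that by (intro add_mono) auto
      finally show ?case by simp
    qed simp
    then show ?thesis by (rule order_trans) simp
  qed
  have pow: "(\<lambda>m. 4 * (1 / 2 :: real) ^ m) \<longlonglongrightarrow> 0"
    using tendsto_mult_right_zero[OF LIMSEQ_power_zero[of "1 / 2 :: real"], of 4] by simp
  have "Cauchy a"
  proof (rule CauchyI)
    fix e :: real assume "0 < e"
    then have "\<forall>\<^sub>F m in sequentially. 4 * (1 / 2 :: real) ^ m < e" using order_tendstoD(2)[OF pow] by blast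
    then have "\<forall>\<^sub>F m in sequentially. n \<le> m \<and> 4 * (1 / 2 :: real) ^ m < e"
      using eventually_ge_at_top[of n] by eventually_elim auto
    then obtain m where m: "n \<le> m" "4 * (1 / 2 :: real) ^ m < e" by (auto simp: eventually_sequentially)
    have "norm (a i - a j) < e" if "m \<le> i" "m \<le> j" for i j
      using le[OF m(1), of "i - m"] le[OF m(1), of "j - m"] that m(2)
        norm_triangle_ineq4[of "a m - a j" "a m - a i"] by simp
    then show "\<exists>M. \<forall>i\<ge>M. \<forall>j\<ge>M. norm (a i - a j) < e" by blast
  qed
  then show conv: "convergent a" by (rule Cauchy_convergent)
  assume m: "n \<le> m"
  have "(\<lambda>j. norm (a m - a (j + m))) \<longlonglongrightarrow> norm (a m - lim a)"
    using conv by (intro tendsto_norm tendsto_diff tendsto_const LIMSEQ_ignore_initial_segment)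
      (simp add: convergent_LIMSEQ_iff)
  then show "norm (a m - lim a) \<le> 2 * (1 / 2) ^ m"
    by (rule LIMSEQ_le_const2) (use le[OF m] in \<open>auto simp: add.commute\<close>)
qed

context usual_filtration
begin

lemma tensor_increment_continuous:
  fixes X :: "real \<Rightarrow> 'a \<Rightarrow> 'b::real_normed_vector"
  assumes "continuous_on {0..T} (\<lambda>t. X t \<omega>)"
  shows "continuous_on A (tensor_increment T X \<epsilon> \<omega>)"
proof -
  interpret P: bounded_bilinear "(\<otimes>\<^sub>\<pi>) :: 'b \<Rightarrow> 'b \<Rightarrow> _" by (rule bounded_bilinear_ptensor)
  have "continuous_on UNIV (\<lambda>s. extend_constantly T X s \<omega>)"
    unfolding continuous_on_iff dist_norm
    using extended_path_uniformly_continuous[of X, OF assms] by (metis norm_minus_commute real_norm_def)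
  then have "continuous_on A (\<lambda>s. extend_constantly T X (g s) \<omega>)" if "continuous_on A g" for g
    using that by (rule continuous_on_compose2) simp
  note comp = this
  have d: "continuous_on A (\<lambda>s. extend_constantly T X (s + \<epsilon>) \<omega> - extend_constantly T X s \<omega>)"
    by (intro continuous_on_diff comp continuous_on_add continuous_on_const continuous_on_id)
  show ?thesis
    unfolding tensor_increment_def Let_def
    by (intro continuous_on_scaleR continuous_on_const P.continuous_on d)
qed

lemma regularised_qv_continuous:
  fixes X :: "real \<Rightarrow> 'a \<Rightarrow> 'b::real_normed_vector"
  assumes "continuous_on {0..T} (\<lambda>t. X t \<omega>)"
  shows "continuous_on {0..T} (\<lambda>t. regularised_qv T X \<epsilon> t \<omega>)"
  unfolding regularised_qv_def
  by (intro indefinite_integral_continuous_1 integrable_continuous_real tensor_increment_continuous assms)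

lemma dyadic_sum_approximates_regularised_qv:
  fixes X :: "real \<Rightarrow> 'a \<Rightarrow> 'b::real_normed_vector"
  assumes X: "continuous_on {0..T} (\<lambda>t. X t \<omega>)" and \<epsilon>: "0 < \<epsilon>" and e: "0 < e"
  defines "N \<equiv> \<lambda>m. nat \<lceil>\<epsilon> * 2 ^ m / T\<rceil>" and "x \<equiv> \<lambda>m k. extend_constantly T X (dyadic T m k) \<omega>"
  shows "\<exists>m0. \<forall>m\<ge>m0. \<forall>t\<in>{0..T}.
    norm ((1 / real (N m)) *\<^sub>R (\<Sum>k<nat \<lfloor>t * 2 ^ m / T\<rfloor>. (x m (k + N m) - x m k) \<otimes>\<^sub>\<pi> (x m (k + N m) - x m k))
      - regularised_qv T X \<epsilon> t \<omega>) \<le> e"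
proof -
  obtain c where c: "\<And>s. norm (extend_constantly T X s \<omega>) \<le> c"
    using extended_path_bounded[of X, OF X] by blast
  show ?thesis
    unfolding regularised_qv_def tensor_increment_def Let_def N_def x_def
    by (rule dyadic_sum_approximates_integral[where p="\<lambda>s. extend_constantly T X s \<omega>" and c=c])
       (use T_pos \<epsilon> e c extended_path_uniformly_continuous[of X, OF X] in auto)
qed

lemma regularised_qv_strongly_measurable:
  fixes X :: "real \<Rightarrow> 'a \<Rightarrow> 'b::real_normed_vector"
  assumes cont: "\<And>\<omega>. \<omega> \<in> space M \<Longrightarrow> continuous_on {0..T} (\<lambda>t. X t \<omega>)" and X: "adapted F T X"
    and \<epsilon>: "0 < \<epsilon>" and t: "t \<in> {0..T}"
  shows "strongly_measurable M (regularised_qv T X \<epsilon> t)"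
proof (rule strongly_measurable_limit)
  let ?N = "\<lambda>m. nat \<lceil>\<epsilon> * 2 ^ m / T\<rceil>"
  let ?x = "\<lambda>\<omega> m k. extend_constantly T X (dyadic T m k) \<omega>"
  let ?R = "\<lambda>m \<omega>. (1 / real (?N m)) *\<^sub>R (\<Sum>k<nat \<lfloor>t * 2 ^ m / T\<rfloor>.
    (?x \<omega> m (k + ?N m) - ?x \<omega> m k) \<otimes>\<^sub>\<pi> (?x \<omega> m (k + ?N m) - ?x \<omega> m k))"
  have x: "strongly_measurable M (\<lambda>\<omega>. ?x \<omega> m k)" for m k
    using strongly_measurable_extended[OF X] by simp
  show "strongly_measurable M (?R m)" for m
    by (intro strongly_measurable_scaleR strongly_measurable_sum
        strongly_measurable_bilinear[OF _ _ bounded_bilinear_ptensor] strongly_measurable_diff x)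
  fix \<omega> assume "\<omega> \<in> space M"
  note approx = dyadic_sum_approximates_regularised_qv[of X, OF cont[OF this] \<epsilon>]
  show "(\<lambda>m. ?R m \<omega>) \<longlonglongrightarrow> regularised_qv T X \<epsilon> t \<omega>"
  proof (rule LIMSEQ_I)
    fix e :: real assume e: "0 < e"
    then have "0 < e / 2" by simp
    from approx[OF this] t obtain m0 where
      "\<And>m. m0 \<le> m \<Longrightarrow> norm (?R m \<omega> - regularised_qv T X \<epsilon> t \<omega>) \<le> e / 2" by blast
    with e show "\<exists>m0. \<forall>m\<ge>m0. norm (?R m \<omega> - regularised_qv T X \<epsilon> t \<omega>) < e"
      by (intro exI[of _ m0] allI impI) (rule le_less_trans[of _ "e / 2"], auto)
  qed
qed

text \<open>
For each fine grid there is an exceptional event of probability at most \<open>\<eta>\<close> outside which the discretised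
quadratic variations for \<open>\<epsilon>\<close> and \<open>\<epsilon>'\<close> are close, because both are close to the same discrete quadratic
variation. A path for which the integrals themselves are not close must lie in the exceptional events of
all sufficiently fine grids, and the lower limit of these events still has probability at most \<open>\<eta>\<close>.
\<close>

lemma regularised_qv_Cauchy_in_probability:
  fixes X :: "real \<Rightarrow> 'a \<Rightarrow> 'b::banach"
  assumes cont: "\<And>\<omega>. \<omega> \<in> space M \<Longrightarrow> continuous_on {0..T} (\<lambda>t. X t \<omega>)" and X: "adapted F T X"
    and sum1: "semilocally_summable M F T (\<lambda>(a::'b) (b::'b). a \<otimes>\<^sub>\<pi> b) X"
    and sum2: "semilocally_summable M F T (\<lambda>(a::'b) (b::'b). b \<otimes>\<^sub>\<pi> a) X"
    and \<delta>: "0 < \<delta>" and \<eta>: "0 < \<eta>"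
  shows "\<exists>\<kappa>>0. \<forall>\<epsilon> \<epsilon>'. 0 < \<epsilon> \<longrightarrow> \<epsilon> < \<kappa> \<longrightarrow> 0 < \<epsilon>' \<longrightarrow> \<epsilon>' < \<kappa> \<longrightarrow> (\<exists>E\<in>events. prob E \<le> \<eta> \<and>
    (\<forall>\<omega>\<in>space M - E. \<forall>t\<in>{0..T}. norm (regularised_qv T X \<epsilon> t \<omega> - regularised_qv T X \<epsilon>' t \<omega>) \<le> \<delta>))"
proof -
  define x where "x m \<omega> k = extend_constantly T X (dyadic T m k) \<omega>" for m \<omega> k
  define N where "N \<epsilon> m = nat \<lceil>\<epsilon> * 2 ^ m / T\<rceil>" for \<epsilon> :: real and m
  define R where "R m n \<omega> i = (1 / real n) *\<^sub>R (\<Sum>k<i. (x m \<omega> (k + n) - x m \<omega> k) \<otimes>\<^sub>\<pi> (x m \<omega> (k + n) - x m \<omega> k))"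
    for m n \<omega> i
  define S where "S m \<omega> i = (\<Sum>j<i. (x m \<omega> (Suc j) - x m \<omega> j) \<otimes>\<^sub>\<pi> (x m \<omega> (Suc j) - x m \<omega> j))" for m \<omega> i
  have \<delta>4: "0 < \<delta> / 4" and \<eta>2: "0 < \<eta> / 2" using \<delta> \<eta> by auto
  from discrete_quadratic_variation_close[OF cont X sum1 sum2 \<delta>4 \<eta>2, folded x_def, folded R_def S_def]
  obtain \<kappa> where \<kappa>: "0 < \<kappa>" and close: "\<And>m n. 1 \<le> n \<Longrightarrow> dyadic T m n \<le> \<kappa> \<Longrightarrow>
    \<exists>E\<in>events. prob E \<le> \<eta> / 2 \<and> (\<forall>\<omega>\<in>space M - E. \<forall>i\<le>2 ^ m. norm (R m n \<omega> i - S m \<omega> i) \<le> \<delta> / 4)"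
    by blast
  have "(\<lambda>m. T / 2 ^ m) \<longlonglongrightarrow> 0" using LIMSEQ_divide_realpow_zero[of 2 T] by simp
  then have "\<forall>\<^sub>F m in sequentially. T / 2 ^ m < \<kappa> / 2"
    using \<kappa> by (intro order_tendstoD(2)) auto
  then obtain m1 where m1: "\<And>m. m1 \<le> m \<Longrightarrow> T / 2 ^ m < \<kappa> / 2" by (auto simp: eventually_sequentially)
  have close': "\<exists>E\<in>events. prob E \<le> \<eta> / 2 \<and>
      (\<forall>\<omega>\<in>space M - E. \<forall>i\<le>2 ^ m. norm (R m (N \<epsilon> m) \<omega> i - S m \<omega> i) \<le> \<delta> / 4)"
    if "0 < \<epsilon>" "\<epsilon> < \<kappa> / 2" "m1 \<le> m" for \<epsilon> m
  proof (rule close)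
    have pos: "0 < \<epsilon> * 2 ^ m / T" using that T_pos by simp
    then show "1 \<le> N \<epsilon> m" unfolding N_def by linarith
    have "real (N \<epsilon> m) \<le> \<epsilon> * 2 ^ m / T + 1" unfolding N_def using pos by linarith
    then have "dyadic T m (N \<epsilon> m) \<le> T * (\<epsilon> * 2 ^ m / T + 1) / 2 ^ m"
      unfolding dyadic_def using T_pos by (intro divide_right_mono mult_left_mono) auto
    also have "\<dots> = \<epsilon> + T / 2 ^ m" using T_pos by (simp add: field_simps)
    also have "\<dots> \<le> \<kappa>" using that(2) m1[OF that(3)] by linarith
    finally show "dyadic T m (N \<epsilon> m) \<le> \<kappa>" .
  qed
  show ?thesis
  proof (intro exI[of _ "\<kappa> / 2"] conjI allI impI)
    show "0 < \<kappa> / 2" using \<kappa> by simp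
    fix \<epsilon> \<epsilon>' :: real assume \<epsilon>: "0 < \<epsilon>" "\<epsilon> < \<kappa> / 2" and \<epsilon>': "0 < \<epsilon>'" "\<epsilon>' < \<kappa> / 2"
    have "\<exists>E\<in>events. prob E \<le> \<eta> \<and> (\<forall>\<omega>\<in>space M - E. \<forall>i\<le>2 ^ (m + m1).
        norm (R (m + m1) (N \<epsilon> (m + m1)) \<omega> i - R (m + m1) (N \<epsilon>' (m + m1)) \<omega> i) \<le> \<delta> / 2)" for m
    proof -
      obtain E1 where E1: "E1 \<in> events" "prob E1 \<le> \<eta> / 2"
        "\<And>\<omega> i. \<omega> \<in> space M - E1 \<Longrightarrow> i \<le> 2 ^ (m + m1) \<Longrightarrow>
          norm (R (m + m1) (N \<epsilon> (m + m1)) \<omega> i - S (m + m1) \<omega> i) \<le> \<delta> / 4"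
        using close'[OF \<epsilon>, of "m + m1"] by auto
      obtain E2 where E2: "E2 \<in> events" "prob E2 \<le> \<eta> / 2"
        "\<And>\<omega> i. \<omega> \<in> space M - E2 \<Longrightarrow> i \<le> 2 ^ (m + m1) \<Longrightarrow>
          norm (R (m + m1) (N \<epsilon>' (m + m1)) \<omega> i - S (m + m1) \<omega> i) \<le> \<delta> / 4"
        using close'[OF \<epsilon>', of "m + m1"] by auto
      show ?thesis
      proof (intro bexI[of _ "E1 \<union> E2"] conjI ballI allI impI)
        show "E1 \<union> E2 \<in> events" using E1 E2 by auto
        show "prob (E1 \<union> E2) \<le> \<eta>" using measure_Un_le[OF E1(1) E2(1)] E1(2) E2(2) by simp
        fix \<omega> and i :: nat assume \<omega>: "\<omega> \<in> space M - (E1 \<union> E2)" "i \<le> 2 ^ (m + m1)"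
        let ?a = "R (m + m1) (N \<epsilon> (m + m1)) \<omega> i - S (m + m1) \<omega> i"
          and ?b = "R (m + m1) (N \<epsilon>' (m + m1)) \<omega> i - S (m + m1) \<omega> i"
        have "norm ?a \<le> \<delta> / 4" "norm ?b \<le> \<delta> / 4" 
          using E1(3)[of \<omega> i] E2(3)[of \<omega> i] \<omega> by auto
        then have "norm (?a - ?b) \<le> \<delta> / 2" using norm_triangle_ineq4[of ?a ?b] by simp
        then show "norm (R (m + m1) (N \<epsilon> (m + m1)) \<omega> i - R (m + m1) (N \<epsilon>' (m + m1)) \<omega> i) \<le> \<delta> / 2"
          by simp
      qed
    qed
    then have "\<forall>m. \<exists>E. E \<in> events \<and> prob E \<le> \<eta> \<and> (\<forall>\<omega>\<in>space M - E. \<forall>i\<le>2 ^ (m + m1).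
        norm (R (m + m1) (N \<epsilon> (m + m1)) \<omega> i - R (m + m1) (N \<epsilon>' (m + m1)) \<omega> i) \<le> \<delta> / 2)" by blast
    from choice[OF this] obtain E where E: "\<And>m. E m \<in> events" "\<And>m. prob (E m) \<le> \<eta>"
      and RR: "\<And>m \<omega> i. \<omega> \<in> space M - E m \<Longrightarrow> i \<le> 2 ^ (m + m1) \<Longrightarrow>
        norm (R (m + m1) (N \<epsilon> (m + m1)) \<omega> i - R (m + m1) (N \<epsilon>' (m + m1)) \<omega> i) \<le> \<delta> / 2" by blast
    let ?E = "\<Union>n. \<Inter>m\<in>{n..}. E m"
    show "\<exists>E\<in>events. prob E \<le> \<eta> \<and> (\<forall>\<omega>\<in>space M - E. \<forall>t\<in>{0..T}.
      norm (regularised_qv T X \<epsilon> t \<omega> - regularised_qv T X \<epsilon>' t \<omega>) \<le> \<delta>)"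
    proof (intro bexI[of _ ?E] conjI ballI)
      show "?E \<in> events" using E(1) by auto
      show "prob ?E \<le> \<eta>" using E by (rule prob_liminf_le)
      fix \<omega> t assume \<omega>: "\<omega> \<in> space M - ?E" and t: "t \<in> {0..T}"
      have \<omega>M: "\<omega> \<in> space M" using \<omega> by blast
      note approx = dyadic_sum_approximates_regularised_qv[of X, OF cont[OF \<omega>M] _ \<delta>4,
          folded x_def N_def, folded R_def]
      obtain m2 where m2: "\<And>m. m2 \<le> m \<Longrightarrow>
          norm (R m (N \<epsilon> m) \<omega> (nat \<lfloor>t * 2 ^ m / T\<rfloor>) - regularised_qv T X \<epsilon> t \<omega>) \<le> \<delta> / 4"
        using approx[OF \<epsilon>(1)] t by blast
      obtain m3 where m3: "\<And>m. m3 \<le> m \<Longrightarrow>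
          norm (R m (N \<epsilon>' m) \<omega> (nat \<lfloor>t * 2 ^ m / T\<rfloor>) - regularised_qv T X \<epsilon>' t \<omega>) \<le> \<delta> / 4"
        using approx[OF \<epsilon>'(1)] t by blast
      have "\<omega> \<notin> (\<Inter>m\<in>{max m2 m3..}. E m)" using \<omega> by blast
      then obtain m where m: "max m2 m3 \<le> m" "\<omega> \<notin> E m" by auto
      let ?i = "nat \<lfloor>t * 2 ^ (m + m1) / T\<rfloor>"
      have "t * 2 ^ (m + m1) / T \<le> 2 ^ (m + m1)" using t T_pos by (simp add: field_simps)
      moreover have "real ?i \<le> t * 2 ^ (m + m1) / T" using t T_pos by (intro of_nat_floor) auto
      ultimately have "real ?i \<le> 2 ^ (m + m1)" by linarith
      then have "real ?i \<le> real (2 ^ (m + m1))" by (simp only: of_nat_power of_nat_numeral)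
      then have "?i \<le> 2 ^ (m + m1)" by (simp only: of_nat_le_iff)
      from RR[OF _ this, of \<omega>] m(2) \<omega>M
      have 1: "norm (R (m + m1) (N \<epsilon> (m + m1)) \<omega> ?i - R (m + m1) (N \<epsilon>' (m + m1)) \<omega> ?i) \<le> \<delta> / 2" by simp
      let ?a = "R (m + m1) (N \<epsilon> (m + m1)) \<omega> ?i" and ?b = "R (m + m1) (N \<epsilon>' (m + m1)) \<omega> ?i"
      let ?u = "?a - regularised_qv T X \<epsilon> t \<omega>" and ?v = "?b - regularised_qv T X \<epsilon>' t \<omega>"
      have "norm ?u \<le> \<delta> / 4" "norm ?v \<le> \<delta> / 4" using m2[of "m + m1"] m3[of "m + m1"] m(1) by simp_all
      moreover have "norm ((?a - ?b) - ?u + ?v) \<le> norm (?a - ?b) + norm ?u + norm ?v"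
        by (intro order_trans[OF norm_triangle_ineq] add_mono norm_triangle_ineq4 order_refl)
      ultimately have "norm ((?a - ?b) - ?u + ?v) \<le> \<delta>" using 1 by linarith
      then show "norm (regularised_qv T X \<epsilon> t \<omega> - regularised_qv T X \<epsilon>' t \<omega>) \<le> \<delta>" by simp
    qed
  qed
qed

text \<open>
By continuity the supremum over \<open>{0..T}\<close> is the supremum over the dyadic grid points.
\<close>

lemma sup_event_measurable:
  fixes Z :: "real \<Rightarrow> 'a \<Rightarrow> 'g::real_normed_vector"
  assumes Z: "\<And>t. t \<in> {0..T} \<Longrightarrow> strongly_measurable M (Z t)"
    and cont: "\<And>\<omega>. \<omega> \<in> space M \<Longrightarrow> continuous_on {0..T} (\<lambda>t. Z t \<omega>)"
  shows "{\<omega>\<in>space M. \<exists>t\<in>{0..T}. \<delta> < norm (Z t \<omega>)} \<in> events"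
proof -
  have dense: "(\<exists>t\<in>{0..T}. \<delta> < norm (Z t \<omega>)) \<longleftrightarrow> (\<exists>m. \<exists>k\<in>{..2 ^ m}. \<delta> < norm (Z (dyadic T m k) \<omega>))"
    if \<omega>: "\<omega> \<in> space M" for \<omega>
  proof
    assume "\<exists>t\<in>{0..T}. \<delta> < norm (Z t \<omega>)"
    then obtain t where t: "t \<in> {0..T}" "\<delta> < norm (Z t \<omega>)" by blast
    define k where "k m = nat \<lfloor>t * 2 ^ m / T\<rfloor>" for m
    have k: "real (k m) \<le> t * 2 ^ m / T" "t * 2 ^ m / T - 1 \<le> real (k m)" for m
      unfolding k_def using t(1) T_pos by (auto intro: of_nat_floor)
    have kle: "k m \<le> 2 ^ m" for m
    proof -
      have "t * 2 ^ m / T \<le> 2 ^ m" using t(1) T_pos by (simp add: field_simps)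
      with k(1)[of m] have "real (k m) \<le> 2 ^ m" by linarith
      then have "real (k m) \<le> real (2 ^ m)" by (simp only: of_nat_power of_nat_numeral)
      then show ?thesis by (simp only: of_nat_le_iff)
    qed
    have "dyadic T m (k m) \<le> t" "t - T / 2 ^ m \<le> dyadic T m (k m)" for m
    proof -
      have "dyadic T m (k m) \<le> T * (t * 2 ^ m / T) / 2 ^ m"
        unfolding dyadic_def using T_pos by (intro divide_right_mono mult_left_mono k) auto
      also have "\<dots> = t" using T_pos by simp
      finally show "dyadic T m (k m) \<le> t" .
      have "t - T / 2 ^ m = T * (t * 2 ^ m / T - 1) / 2 ^ m" using T_pos by (simp add: field_simps)
      also have "\<dots> \<le> dyadic T m (k m)"
        unfolding dyadic_def using T_pos by (intro divide_right_mono mult_left_mono k) auto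
      finally show "t - T / 2 ^ m \<le> dyadic T m (k m)" .
    qed
    note bounds = this
    have "(\<lambda>m. dyadic T m (k m)) \<longlonglongrightarrow> t"
    proof (rule tendsto_sandwich)
      show "(\<lambda>m. t - T / 2 ^ m) \<longlonglongrightarrow> t"
        using tendsto_diff[OF tendsto_const LIMSEQ_divide_realpow_zero[of 2 T], of t] by simp
      show "\<forall>\<^sub>F m in sequentially. t - T / 2 ^ m \<le> dyadic T m (k m)" using bounds by simp
      show "\<forall>\<^sub>F m in sequentially. dyadic T m (k m) \<le> t" using bounds by simp
    qed (rule tendsto_const)
    then have "(\<lambda>m. norm (Z (dyadic T m (k m)) \<omega>)) \<longlonglongrightarrow> norm (Z t \<omega>)"
      by (intro tendsto_norm continuous_on_tendsto_compose[OF cont[OF \<omega>]])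
         (auto intro!: always_eventually dyadic_in_range kle t(1) simp del: atLeastAtMost_iff)
    from order_tendstoD(1)[OF this t(2)] obtain m where "\<delta> < norm (Z (dyadic T m (k m)) \<omega>)"
      by (auto simp: eventually_sequentially)
    then show "\<exists>m. \<exists>k\<in>{..2 ^ m}. \<delta> < norm (Z (dyadic T m k) \<omega>)" using kle by blast
  next
    assume "\<exists>m. \<exists>k\<in>{..2 ^ m}. \<delta> < norm (Z (dyadic T m k) \<omega>)"
    then show "\<exists>t\<in>{0..T}. \<delta> < norm (Z t \<omega>)"
      by (meson atMost_iff dyadic_in_range)
  qed
  have "{\<omega>\<in>space M. \<exists>m. \<exists>k\<in>{..2 ^ m}. \<delta> < norm (Z (dyadic T m k) \<omega>)} \<in> events"
  proof (intro sets.sets_Collect_countable_Ex sets.sets_Collect_finite_Ex)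
    fix m k :: nat assume "k \<in> {..2 ^ m}"
    then have [measurable]: "(\<lambda>\<omega>. norm (Z (dyadic T m k) \<omega>)) \<in> borel_measurable M"
      by (intro borel_measurable_norm_strongly_measurable Z dyadic_in_range) simp
    show "{\<omega>\<in>space M. \<delta> < norm (Z (dyadic T m k) \<omega>)} \<in> events" by measurable
  qed simp
  then show ?thesis using dense by (simp cong: conj_cong)
qed

lemma prob_tail_Un_le:
  assumes E: "\<And>i::nat. E i \<in> events" "\<And>i. prob (E i) \<le> (1 / 2) ^ i"
  shows "prob (\<Union>i\<in>{n..}. E i) \<le> 2 * (1 / 2) ^ n"
proof -
  have geo: "(\<lambda>i. (1 / 2 :: real) ^ (i + n)) sums (2 * (1 / 2) ^ n)"
    using sums_mult2[OF geometric_sums[of "1 / 2 :: real"], of "(1 / 2) ^ n"] by (simp add: power_add)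
  have sm: "summable (\<lambda>i. prob (E (i + n)))"
    by (rule summable_comparison_test'[OF sums_summable[OF geo], of 0]) (use E(2) in auto)
  have "(\<Union>i\<in>{n..}. E i) = (\<Union>i. E (i + n))"
  proof (intro equalityI subsetI)
    fix x assume "x \<in> (\<Union>i\<in>{n..}. E i)"
    then obtain i where "n \<le> i" "x \<in> E i" by auto
    then show "x \<in> (\<Union>i. E (i + n))" by (intro UN_I[of "i - n"]) auto
  qed auto
  then have "prob (\<Union>i\<in>{n..}. E i) \<le> (\<Sum>i. prob (E (i + n)))"
    using E(1) sm by (auto intro!: finite_measure_subadditive_countably)
  also have "\<dots> \<le> (\<Sum>i. (1 / 2 :: real) ^ (i + n))"
    by (rule suminf_le[OF _ sm sums_summable[OF geo]]) (rule E(2))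
  also have "\<dots> = 2 * (1 / 2) ^ n" using geo by (simp add: sums_iff)
  finally show ?thesis .
qed

text \<open>
A sequence \<open>e n\<close> of lags is chosen such that consecutive regularised quadratic variations differ by at
most \<open>(1 / 2) ^ n\<close> outside an event of probability at most \<open>(1 / 2) ^ n\<close>. By the Borel-Cantelli argument
they converge uniformly almost surely. The limit is set to \<open>0\<close> where this fails, which makes its paths
continuous everywhere.
\<close>

lemma continuous_semilocally_summable_admits_tensor_qv:
  fixes X :: "real \<Rightarrow> 'a \<Rightarrow> 'b::banach"
  assumes cont: "\<And>\<omega>. \<omega> \<in> space M \<Longrightarrow> continuous_on {0..T} (\<lambda>t. X t \<omega>)" and X: "adapted F T X"
    and sum1: "semilocally_summable M F T (\<lambda>(a::'b) (b::'b). a \<otimes>\<^sub>\<pi> b) X"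
    and sum2: "semilocally_summable M F T (\<lambda>(a::'b) (b::'b). b \<otimes>\<^sub>\<pi> a) X"
  shows "admits_tensor_quadratic_variation M T X"
proof -
  let ?J = "regularised_qv T X"
  note Cauchy = regularised_qv_Cauchy_in_probability[OF cont X sum1 sum2]
  have "\<exists>\<kappa>>0. \<forall>\<epsilon> \<epsilon>'. 0 < \<epsilon> \<longrightarrow> \<epsilon> < \<kappa> \<longrightarrow> 0 < \<epsilon>' \<longrightarrow> \<epsilon>' < \<kappa> \<longrightarrow> (\<exists>E\<in>events. prob E \<le> (1 / 2) ^ n \<and>
    (\<forall>\<omega>\<in>space M - E. \<forall>t\<in>{0..T}. norm (?J \<epsilon> t \<omega> - ?J \<epsilon>' t \<omega>) \<le> (1 / 2) ^ n))" for n :: nat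
    by (rule Cauchy) auto
  then obtain \<kappa> where \<kappa>: "\<And>n::nat. 0 < \<kappa> n"
    and close: "\<And>n \<epsilon> \<epsilon>'. 0 < \<epsilon> \<Longrightarrow> \<epsilon> < \<kappa> n \<Longrightarrow> 0 < \<epsilon>' \<Longrightarrow> \<epsilon>' < \<kappa> n \<Longrightarrow> \<exists>E\<in>events. prob E \<le> (1 / 2) ^ n \<and>
      (\<forall>\<omega>\<in>space M - E. \<forall>t\<in>{0..T}. norm (?J \<epsilon> t \<omega> - ?J \<epsilon>' t \<omega>) \<le> (1 / 2) ^ n)"
    by metis
  \<comment> \<open>both \<open>e n\<close> and \<open>e (Suc n)\<close> must be below \<open>\<kappa> n\<close>, hence the minimum over all \<open>i \<le> n\<close>\<close>
  define e where "e n = min (1 / real (Suc n)) (Min (\<kappa> ` {..n})) / 2" for n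
  have e: "0 < e n" "e n < 1 / real (Suc n)" for n
  proof -
    have half: "0 < min a b / 2 \<and> min a b / 2 < a" if "0 < a" "0 < b" for a b :: real
      using that by (auto simp: min_def)
    have "0 < Min (\<kappa> ` {..n})" using \<kappa> by auto
    from half[OF _ this, of "1 / real (Suc n)"]
    show "0 < e n" "e n < 1 / real (Suc n)" unfolding e_def by simp_all
  qed
  have e\<kappa>: "e n < \<kappa> i" if "i \<le> n" for i n
  proof -
    have "Min (\<kappa> ` {..n}) \<le> \<kappa> i" using that by (intro Min_le) auto
    moreover have "0 < Min (\<kappa> ` {..n})" using \<kappa> by simp
    moreover have "min a b / 2 < c" if "b \<le> c" "0 < b" for a b c :: real
      using that by (auto simp: min_def)
    ultimately show ?thesis unfolding e_def by blast
  qed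
  have "\<forall>n. \<exists>E. E \<in> events \<and> prob E \<le> (1 / 2) ^ n \<and>
      (\<forall>\<omega>\<in>space M - E. \<forall>t\<in>{0..T}. norm (?J (e n) t \<omega> - ?J (e (Suc n)) t \<omega>) \<le> (1 / 2) ^ n)"
    using close[OF e(1) e\<kappa> e(1) e\<kappa>] by (meson le_Suc_eq order_refl)
  from choice[OF this] obtain E where E: "\<And>n. E n \<in> events" "\<And>n. prob (E n) \<le> (1 / 2) ^ n"
    and step: "\<And>n \<omega> t. \<omega> \<in> space M - E n \<Longrightarrow> t \<in> {0..T} \<Longrightarrow>
      norm (?J (e n) t \<omega> - ?J (e (Suc n)) t \<omega>) \<le> (1 / 2) ^ n"
    by blast
  define U where "U n = (\<Union>i\<in>{n..}. E i)" for n
  have U: "U n \<in> events" "prob (U n) \<le> 2 * (1 / 2) ^ n" for n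
    unfolding U_def using E prob_tail_Un_le[of E n] by auto
  define G where "G = space M - (\<Inter>n. U n)"
  have G: "G \<in> events" unfolding G_def using U(1) by auto
  define Q where "Q t \<omega> = (if \<omega> \<in> G then lim (\<lambda>n. ?J (e n) t \<omega>) else 0)" for t \<omega>
  have UG: "\<omega> \<in> G" if "\<omega> \<in> space M - U n" for \<omega> n using that by (auto simp: G_def)
  have conv: "convergent (\<lambda>n. ?J (e n) t \<omega>)" if "\<omega> \<in> G" "t \<in> {0..T}" for \<omega> t
  proof -
    obtain n where "\<omega> \<in> space M - U n" using \<open>\<omega> \<in> G\<close> by (auto simp: G_def)
    then show ?thesis
      by (intro geometric_Cauchy_limit(1)[of n]) (use step that in \<open>auto simp: U_def\<close>)
  qed
  have JQ: "norm (?J (e m) t \<omega> - Q t \<omega>) \<le> 2 * (1 / 2) ^ m"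
    if "\<omega> \<in> space M - U n" "t \<in> {0..T}" "n \<le> m" for \<omega> t n m
    using geometric_Cauchy_limit(2)[of n "\<lambda>n. ?J (e n) t \<omega>" m] step that UG[OF that(1)]
    by (auto simp: U_def Q_def)
  have Jm: "strongly_measurable M (?J \<epsilon> t)" if "0 < \<epsilon>" "t \<in> {0..T}" for \<epsilon> t
    by (rule regularised_qv_strongly_measurable[OF cont X that])
  have Qm: "strongly_measurable M (Q t)" if t: "t \<in> {0..T}" for t
  proof (rule strongly_measurable_limit)
    show "strongly_measurable M (\<lambda>\<omega>. if \<omega> \<in> G then ?J (e n) t \<omega> else 0)" for n
      by (intro strongly_measurable_if Jm e t G)
    show "(\<lambda>n. if \<omega> \<in> G then ?J (e n) t \<omega> else 0) \<longlonglongrightarrow> Q t \<omega>" if "\<omega> \<in> space M" for \<omega>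
      using conv[of \<omega> t] t by (simp add: Q_def convergent_LIMSEQ_iff)
  qed
  have pow: "(\<lambda>m. 2 * (1 / 2 :: real) ^ m) \<longlonglongrightarrow> 0"
    using tendsto_mult_right_zero[OF LIMSEQ_power_zero[of "1 / 2 :: real"], of 2] by simp
  have Qc: "continuous_on {0..T} (\<lambda>t. Q t \<omega>)" if \<omega>: "\<omega> \<in> space M" for \<omega>
  proof (cases "\<omega> \<in> G")
    case True
    then obtain n where n: "\<omega> \<in> space M - U n" by (auto simp: G_def)
    show ?thesis
    proof (rule uniform_limit_theorem)
      show "\<forall>\<^sub>F m in sequentially. continuous_on {0..T} (\<lambda>t. ?J (e m) t \<omega>)"
        by (intro always_eventually allI regularised_qv_continuous cont \<omega>)
      show "uniform_limit {0..T} (\<lambda>m t. ?J (e m) t \<omega>) (\<lambda>t. Q t \<omega>) sequentially"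
      proof (rule uniform_limitI)
        fix r :: real assume "0 < r"
        then have "\<forall>\<^sub>F m in sequentially. 2 * (1 / 2 :: real) ^ m < r" using order_tendstoD(2)[OF pow] by blast
        with eventually_ge_at_top[of n]
        show "\<forall>\<^sub>F m in sequentially. \<forall>t\<in>{0..T}. dist (?J (e m) t \<omega>) (Q t \<omega>) < r"
        proof eventually_elim
          case (elim m)
          then show ?case unfolding dist_norm using JQ[OF n, of _ m] le_less_trans by blast
        qed
      qed
    qed simp
  qed (simp add: Q_def)
  have "converges_ucp M T ?J Q"
    unfolding converges_ucp_def
  proof (intro allI impI conjI)
    fix \<delta> :: real assume \<delta>: "0 < \<delta>"
    let ?A = "\<lambda>\<epsilon>. {\<omega>\<in>space M. \<exists>t\<in>{0..T}. \<delta> < norm (?J \<epsilon> t \<omega> - Q t \<omega>)}"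
    show "?A \<epsilon> \<in> events" if "0 < \<epsilon>" for \<epsilon>
      by (rule sup_event_measurable)
         (auto intro!: strongly_measurable_diff Jm Qm continuous_on_diff regularised_qv_continuous cont Qc that
           simp del: atLeastAtMost_iff)
    show "((\<lambda>\<epsilon>. prob (?A \<epsilon>)) \<longlongrightarrow> 0) (at_right 0)"
    proof (rule order_tendstoI)
      fix r :: real assume r: "0 < r"
      have "\<exists>\<kappa>>0. \<forall>\<epsilon> \<epsilon>'. 0 < \<epsilon> \<longrightarrow> \<epsilon> < \<kappa> \<longrightarrow> 0 < \<epsilon>' \<longrightarrow> \<epsilon>' < \<kappa> \<longrightarrow> (\<exists>E\<in>events. prob E \<le> r / 3 \<and>
        (\<forall>\<omega>\<in>space M - E. \<forall>t\<in>{0..T}. norm (?J \<epsilon> t \<omega> - ?J \<epsilon>' t \<omega>) \<le> \<delta> / 2))"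
        by (rule Cauchy) (use \<delta> r in auto)
      then obtain k where k: "0 < k" and close': "\<And>\<epsilon> \<epsilon>'. 0 < \<epsilon> \<Longrightarrow> \<epsilon> < k \<Longrightarrow> 0 < \<epsilon>' \<Longrightarrow> \<epsilon>' < k \<Longrightarrow>
        \<exists>E\<in>events. prob E \<le> r / 3 \<and> (\<forall>\<omega>\<in>space M - E. \<forall>t\<in>{0..T}. norm (?J \<epsilon> t \<omega> - ?J \<epsilon>' t \<omega>) \<le> \<delta> / 2)"
        by metis
      have "\<forall>\<^sub>F m in sequentially. 2 * (1 / 2 :: real) ^ m < min (\<delta> / 2) (r / 3)"
        using \<delta> r by (intro order_tendstoD(2)[OF pow]) auto
      moreover have "\<forall>\<^sub>F m in sequentially. 1 / real (Suc m) < k"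
        using order_tendstoD(2)[OF LIMSEQ_inverse_real_of_nat k] by (simp add: inverse_eq_divide)
      ultimately have "\<forall>\<^sub>F m in sequentially. 2 * (1 / 2 :: real) ^ m < min (\<delta> / 2) (r / 3) \<and> 1 / real (Suc m) < k"
        by eventually_elim auto
      then obtain m where m: "2 * (1 / 2 :: real) ^ m < min (\<delta> / 2) (r / 3)" "1 / real (Suc m) < k"
        by (auto simp: eventually_sequentially)
      have em: "e m < k" using e(2)[of m] m(2) by simp
      have "prob (?A \<epsilon>) < r" if \<epsilon>: "0 < \<epsilon>" "\<epsilon> < k" for \<epsilon>
      proof -
        obtain B where B: "B \<in> events" "prob B \<le> r / 3"
          and JJ: "\<And>\<omega> t. \<omega> \<in> space M - B \<Longrightarrow> t \<in> {0..T} \<Longrightarrow> norm (?J \<epsilon> t \<omega> - ?J (e m) t \<omega>) \<le> \<delta> / 2"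
          using close'[OF \<epsilon> e(1) em] by blast
        have "?A \<epsilon> \<subseteq> B \<union> U m"
        proof (rule ccontr)
          assume "\<not> ?thesis"
          then obtain \<omega> t where \<omega>: "\<omega> \<in> space M - B" "\<omega> \<in> space M - U m" and t: "t \<in> {0..T}"
            and gt: "\<delta> < norm (?J \<epsilon> t \<omega> - Q t \<omega>)" by blast
          have "norm (?J \<epsilon> t \<omega> - Q t \<omega>) \<le> norm (?J \<epsilon> t \<omega> - ?J (e m) t \<omega>) + norm (?J (e m) t \<omega> - Q t \<omega>)"
            using norm_triangle_ineq[of "?J \<epsilon> t \<omega> - ?J (e m) t \<omega>" "?J (e m) t \<omega> - Q t \<omega>"] by simp
          also have "\<dots> \<le> \<delta> / 2 + 2 * (1 / 2) ^ m"
            by (intro add_mono JJ[OF \<omega>(1) t] JQ[OF \<omega>(2) t order_refl])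
          also have "\<dots> \<le> \<delta>" using m(1) by simp
          finally show False using gt by simp
        qed
        then have "prob (?A \<epsilon>) \<le> prob (B \<union> U m)"
          using B(1) U(1) by (intro finite_measure_mono) auto
        also have "\<dots> \<le> prob B + prob (U m)" using B(1) U(1) by (intro measure_Un_le)
        also have "\<dots> < r" using B(2) U(2)[of m] m(1) r by simp
        finally show ?thesis .
      qed
      then show "\<forall>\<^sub>F \<epsilon> in at_right 0. prob (?A \<epsilon>) < r"
        by (intro eventually_at_rightI[of 0 k]) (use k in auto)
    qed (rule always_eventually, rule allI, erule less_le_trans, rule measure_nonneg)
  qed
  moreover have "has_Bochner_integral (restrict_space lborel {0..t}) (tensor_increment T X \<epsilon> \<omega>) (?J \<epsilon> t \<omega>)"
    if "t \<in> {0..T}" "\<omega> \<in> space M" for \<epsilon> t \<omega>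
    unfolding regularised_qv_def
    by (intro has_Bochner_integral_continuous tensor_increment_continuous cont) (use that in auto)
  ultimately show ?thesis
    unfolding admits_tensor_quadratic_variation_def is_tensor_quadratic_variation_def
    using Qm by blast
qed

end

theorem proposition1p7:
  fixes M :: "'a measure" and F :: "real \<Rightarrow> 'a measure" and T :: real
    and X :: "real \<Rightarrow> 'a \<Rightarrow> 'b::banach"
  assumes "usual_filtration M F T"
    and "\<forall>\<omega>\<in>space M. continuous_on {0..T} (\<lambda>t. X t \<omega>)"
    and "adapted F T X"
    and "semilocally_summable M F T (\<lambda>(a::'b) (b::'b). a \<otimes>\<^sub>\<pi> b) X"
    and "semilocally_summable M F T (\<lambda>(a::'b) (b::'b). b \<otimes>\<^sub>\<pi> a) X"
  shows "admits_tensor_quadratic_variation M T X"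
  by (rule usual_filtration.continuous_semilocally_summable_admits_tensor_qv[OF assms(1) _ assms(3-5)])
     (use assms(2) in blast)

end
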